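(* Let $\omega$ be an end of a digraph $D$ such that $d^-(\omega)\ge 1$. Then $\Delta^-(\omega)$ is equal to the sum of $d^-(\omega)$ and the maximum number of disjoint $\lfloor\omega\rfloor$--$\mathring{\lceil\omega\rceil}$ tracks in $D$, where $\mathring{\lceil\omega\rceil}:=\lceil\omega\rceil\setminus\{\omega\}$.
   Context: Digraphs may be infinite; paths are directed; "disjoint" means vertex-disjoint. An $X$--$Y$ path for vertex sets $X,Y$ is a directed path (possibly a single vertex) meeting $X$ precisely in its startvertex and $Y$ precisely in its endvertex; subdigraphs in place of $X,Y$ stand for their vertex sets, single vertices for singletons. An in-ray is an orientation of a ray with all edges directed towards its unique vertex of degree 1 (its endvertex); an out-ray is an orientation of a ray with all edges directed away from its unique vertex of degree 1 (its startvertex). All other vertices are internal. A tail of an out-ray $R$ is an out-ray contained in $R$. Two in-/out-rays $R_1,R_2$ of $D$ (each an in-ray or an out-ray) are equivalent if there are infinitely many disjoint $R_1$--$R_2$ paths and infinitely many disjoint $R_2$--$R_1$ paths in $D$. An end of $D$ is an equivalence class of in- and out-rays; $\Omega(D)$ is the set of ends. Write $\omega_1\le\omega_2$ if there are $R_1\in\omega_1$, $R_2\in\omega_2$ with infinitely many disjoint $R_1$--$R_2$ paths. A vertex $v$ is $\omega$-in-dominating if for some in-/out-ray $R\in\omega$ there are infinitely many $R$--$v$ paths that pairwise intersect only in $v$; it is $\omega$-out-dominating if for some in-/out-ray $R\in\omega$ there are infinitely many $v$--$R$ paths that pairwise intersect only in $v$. $\lfloor\omega\rfloor$ is the union of the set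 of ends $\alpha$ with $\omega\le\alpha$ (including $\omega$) and the set of $\omega$-in-dominating vertices. $\lceil\omega\rceil$ is the union of the set of ends $\alpha$ with $\alpha\le\omega$ (including $\omega$) and the set of $\omega$-out-dominating vertices. For sets $A,B$ of vertices and ends, an $A$--$B$ track $T$ is one of: an $(A\cap V(D))$--$(B\cap V(D))$ path; an in-ray in an end in $A$ whose endvertex is in $B$; an out-ray in an end in $B$ whose startvertex is in $A$; a directed double ray (all of whose vertices count as internal) whose initial segment (an in-ray) is in an end in $A$ and whose terminal segment (an out-ray) is in an end in $B$; in each case such that no internal vertex of $T$ is in $A\cup B$. The degree $d^-(\omega)$ is the maximum number of disjoint out-rays in $\omega$. A set $S\subseteq V(D)$ is $\omega$-separating if for every out-ray $R\in\omega$ there exists a tail $Q$ of $R$ such that $S$ intersects every path starting in $V(Q)$ and ending in an $\omega$-out-dominating vertex, and $S$ intersects every out-ray that belongs to an end in $\{\alpha\in\Omega(D):\alpha\le\omega\}\setminus\{\omega\}$ and starts in $V(Q)$. The combined end degree is $\Delta^-(\omega):=d^-(\omega)+\inf\{|S|: S\subseteq V(D)\text{ is }\omega\text{-separating}\}$. All these numbers are taken in $\{0,1,2,\dots\}\cup\{\infty\}$, i.e. all infinite values are identified with $\infty$. *)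

theory Defs
  imports
    "Graph_Theory.Vertex_Walk"
    "HOL-Library.Extended_Nat"
    "HOL-Library.Disjoint_Sets"
begin

text \<open>
  Digraphs are the (possibly infinite) digraphs of the library, and finite directed paths are its
  \<^const>\<open>vpath\<close>s. Everything below refers to arcs only through adjacency, so loops and parallel
  arcs, which the locale \<^locale>\<open>wf_digraph\<close> permits, play no role.
\<close>

section \<open>Rays\<close>

text \<open>
  A ray is given by its orientation and the enumeration of its vertices that begins with its vertex
  of degree one. This is a one-to-one encoding of rays as subdigraphs: a vertex sequence whose
  consecutive vertices are joined by arcs in both directions carries both an in-ray and an out-ray.
\<close>

datatype 'a ray = In_Ray "nat \<Rightarrow> 'a" | Out_Ray "nat \<Rightarrow> 'a"

fun ray_verts :: "'a ray \<Rightarrow> 'a set" where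
  "ray_verts (In_Ray r) = range r"
| "ray_verts (Out_Ray r) = range r"

fun is_ray :: "('a, 'b) pre_digraph \<Rightarrow> 'a ray \<Rightarrow> bool" where
  "is_ray D (In_Ray r) \<longleftrightarrow> inj r \<and> (\<forall>i. r (Suc i) \<rightarrow>\<^bsub>D\<^esub> r i)"
| "is_ray D (Out_Ray r) \<longleftrightarrow> inj r \<and> (\<forall>i. r i \<rightarrow>\<^bsub>D\<^esub> r (Suc i))"

text \<open>The out-rays contained in an out-ray are the shifts of its vertex sequence.\<close>

definition is_tail :: "(nat \<Rightarrow> 'a) \<Rightarrow> (nat \<Rightarrow> 'a) \<Rightarrow> bool" where
  "is_tail q r \<longleftrightarrow> (\<exists>n. \<forall>i. q i = r (n + i))"

section \<open>Paths between vertex sets\<close>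

definition set_path :: "('a, 'b) pre_digraph \<Rightarrow> 'a set \<Rightarrow> 'a set \<Rightarrow> 'a list \<Rightarrow> bool" where
  "set_path D X Y p \<longleftrightarrow> vpath p D \<and> set p \<inter> X = {hd p} \<and> set p \<inter> Y = {last p}"

definition inf_disjoint_paths :: "('a, 'b) pre_digraph \<Rightarrow> 'a set \<Rightarrow> 'a set \<Rightarrow> bool" where
  "inf_disjoint_paths D X Y \<longleftrightarrow>
     (\<exists>P. infinite P \<and> (\<forall>p \<in> P. set_path D X Y p) \<and> disjoint_family_on set P)"

section \<open>Ends\<close>

definition ray_equiv :: "('a, 'b) pre_digraph \<Rightarrow> 'a ray rel" where
  "ray_equiv D = {(R1, R2). is_ray D R1 \<and> is_ray D R2 \<and>
     inf_disjoint_paths D (ray_verts R1) (ray_verts R2) \<and>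
     inf_disjoint_paths D (ray_verts R2) (ray_verts R1)}"

definition ends :: "('a, 'b) pre_digraph \<Rightarrow> 'a ray set set" where
  "ends D = {R. is_ray D R} // ray_equiv D"

definition end_le :: "('a, 'b) pre_digraph \<Rightarrow> 'a ray set \<Rightarrow> 'a ray set \<Rightarrow> bool" where
  "end_le D \<omega>1 \<omega>2 \<longleftrightarrow>
     (\<exists>R1 \<in> \<omega>1. \<exists>R2 \<in> \<omega>2. inf_disjoint_paths D (ray_verts R1) (ray_verts R2))"

definition in_dominating :: "('a, 'b) pre_digraph \<Rightarrow> 'a ray set \<Rightarrow> 'a \<Rightarrow> bool" where
  "in_dominating D \<omega> v \<longleftrightarrow>
     (\<exists>R \<in> \<omega>. \<exists>P. infinite P \<and> (\<forall>p \<in> P. set_path D (ray_verts R) {v} p) \<and>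
        pairwise (\<lambda>p q. set p \<inter> set q = {v}) P)"

definition out_dominating :: "('a, 'b) pre_digraph \<Rightarrow> 'a ray set \<Rightarrow> 'a \<Rightarrow> bool" where
  "out_dominating D \<omega> v \<longleftrightarrow>
     (\<exists>R \<in> \<omega>. \<exists>P. infinite P \<and> (\<forall>p \<in> P. set_path D {v} (ray_verts R) p) \<and>
        pairwise (\<lambda>p q. set p \<inter> set q = {v}) P)"

datatype 'a vertex_or_end = Vertex 'a | End "'a ray set"

text \<open>
  \<open>end_up\<close> and \<open>end_down\<close> are $\lfloor\omega\rfloor$ and $\lceil\omega\rceil$. Both contain the
  end itself, since \<^const>\<open>end_le\<close> is reflexive on ends by the trivial paths.
\<close>

definition end_up :: "('a, 'b) pre_digraph \<Rightarrow> 'a ray set \<Rightarrow> 'a vertex_or_end set" where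
  "end_up D \<omega> = End ` {\<alpha> \<in> ends D. end_le D \<omega> \<alpha>} \<union> Vertex ` {v. in_dominating D \<omega> v}"

definition end_down :: "('a, 'b) pre_digraph \<Rightarrow> 'a ray set \<Rightarrow> 'a vertex_or_end set" where
  "end_down D \<omega> = End ` {\<alpha> \<in> ends D. end_le D \<alpha> \<omega>} \<union> Vertex ` {v. out_dominating D \<omega> v}"

section \<open>Tracks\<close>

datatype 'a track =
    Path_Track "'a list"
  | In_Ray_Track "nat \<Rightarrow> 'a"
  | Out_Ray_Track "nat \<Rightarrow> 'a"
  | Double_Ray_Track "int \<Rightarrow> 'a"

fun track_verts :: "'a track \<Rightarrow> 'a set" where
  "track_verts (Path_Track p) = set p"
| "track_verts (In_Ray_Track r) = range r"
| "track_verts (Out_Ray_Track r) = range r"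
| "track_verts (Double_Ray_Track z) = range z"

fun internal_verts :: "'a track \<Rightarrow> 'a set" where
  "internal_verts (Path_Track p) = set p - {hd p, last p}"
| "internal_verts (In_Ray_Track r) = range r - {r 0}"
| "internal_verts (Out_Ray_Track r) = range r - {r 0}"
| "internal_verts (Double_Ray_Track z) = range z"

definition is_double_ray :: "('a, 'b) pre_digraph \<Rightarrow> (int \<Rightarrow> 'a) \<Rightarrow> bool" where
  "is_double_ray D z \<longleftrightarrow> inj z \<and> (\<forall>i. z i \<rightarrow>\<^bsub>D\<^esub> z (i + 1))"

definition vertices_in :: "('a, 'b) pre_digraph \<Rightarrow> 'a vertex_or_end set \<Rightarrow> 'a set" where
  "vertices_in D A = {v \<in> verts D. Vertex v \<in> A}"

definition ends_in :: "('a, 'b) pre_digraph \<Rightarrow> 'a vertex_or_end set \<Rightarrow> 'a ray set set" where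
  "ends_in D A = {\<alpha> \<in> ends D. End \<alpha> \<in> A}"

text \<open>
  All initial segments of a double ray are equivalent, and so are all its terminal segments;
  splitting it at index 0 is therefore no restriction.
\<close>

fun track_type ::
  "('a, 'b) pre_digraph \<Rightarrow> 'a vertex_or_end set \<Rightarrow> 'a vertex_or_end set \<Rightarrow> 'a track \<Rightarrow> bool" where
  "track_type D A B (Path_Track p) \<longleftrightarrow> set_path D (vertices_in D A) (vertices_in D B) p"
| "track_type D A B (In_Ray_Track r) \<longleftrightarrow>
     is_ray D (In_Ray r) \<and> (\<exists>\<alpha> \<in> ends_in D A. In_Ray r \<in> \<alpha>) \<and> r 0 \<in> vertices_in D B"
| "track_type D A B (Out_Ray_Track r) \<longleftrightarrow>
     is_ray D (Out_Ray r) \<and> (\<exists>\<beta> \<in> ends_in D B. Out_Ray r \<in> \<beta>) \<and> r 0 \<in> vertices_in D A"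
| "track_type D A B (Double_Ray_Track z) \<longleftrightarrow>
     is_double_ray D z \<and>
     (\<exists>\<alpha> \<in> ends_in D A. In_Ray (\<lambda>n. z (- int n)) \<in> \<alpha>) \<and>
     (\<exists>\<beta> \<in> ends_in D B. Out_Ray (\<lambda>n. z (int n)) \<in> \<beta>)"

definition is_track ::
  "('a, 'b) pre_digraph \<Rightarrow> 'a vertex_or_end set \<Rightarrow> 'a vertex_or_end set \<Rightarrow> 'a track \<Rightarrow> bool" where
  "is_track D A B T \<longleftrightarrow>
     track_type D A B T \<and> internal_verts T \<inter> (vertices_in D A \<union> vertices_in D B) = {}"

section \<open>Degrees\<close>

definition ecard :: "'x set \<Rightarrow> enat" where
  "ecard X = (if finite X then enat (card X) else \<infinity>)"

text \<open>
  The maximum number of disjoint objects in \<open>X\<close>, where \<open>V\<close> gives the vertex set of an object.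
  The supremum in \<^typ>\<open>enat\<close> is attained whenever it is finite.
\<close>

definition max_disjoint :: "('x \<Rightarrow> 'a set) \<Rightarrow> 'x set \<Rightarrow> enat" where
  "max_disjoint V X = (SUP F \<in> {F. F \<subseteq> X \<and> disjoint_family_on V F}. ecard F)"

definition end_in_degree :: "'a ray set \<Rightarrow> enat" where
  "end_in_degree \<omega> = max_disjoint range {r. Out_Ray r \<in> \<omega>}"

definition max_tracks ::
  "('a, 'b) pre_digraph \<Rightarrow> 'a vertex_or_end set \<Rightarrow> 'a vertex_or_end set \<Rightarrow> enat" where
  "max_tracks D A B = max_disjoint track_verts {T. is_track D A B T}"

definition end_separating :: "('a, 'b) pre_digraph \<Rightarrow> 'a ray set \<Rightarrow> 'a set \<Rightarrow> bool" where
  "end_separating D \<omega> S \<longleftrightarrow> S \<subseteq> verts D \<and>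
     (\<forall>r. Out_Ray r \<in> \<omega> \<longrightarrow>
        (\<exists>q. is_tail q r \<and>
           (\<forall>p. vpath p D \<and> hd p \<in> range q \<and> out_dominating D \<omega> (last p) \<longrightarrow>
              S \<inter> set p \<noteq> {}) \<and>
           (\<forall>\<alpha> \<in> {\<alpha> \<in> ends D. end_le D \<alpha> \<omega>} - {\<omega>}. \<forall>s. Out_Ray s \<in> \<alpha> \<and> s 0 \<in> range q \<longrightarrow>
              S \<inter> range s \<noteq> {})))"

definition combined_in_degree :: "('a, 'b) pre_digraph \<Rightarrow> 'a ray set \<Rightarrow> enat" where
  "combined_in_degree D \<omega> = end_in_degree \<omega> + (INF S \<in> {S. end_separating D \<omega> S}. ecard S)"

end

theory Submission
  imports Defs
begin

text \<open>
  Fix an out-ray \<open>R\<close> in \<open>\<omega>\<close>. Call \<open>A\<close> infinitely linked to \<open>B\<close> if no finite vertex set separates \<open>A\<close>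
  from \<open>B\<close>; the equivalence of rays, the order of ends and domination are all instances of this.
  Every track meets every finite separating set, since from tails of \<open>R\<close> its beginning, and through
  the track its end, can be reached while avoiding any finite set that misses the track.

  For the converse suppose that the degree of \<open>\<omega>\<close> is finite. Then some finite set is separating.
  Otherwise, given finitely many disjoint out-rays in \<open>\<omega>\<close>, infinitely many disjoint ears (paths to
  dominating vertices, or out-rays of smaller ends) leave them, all of which lead back to \<open>\<omega>\<close>, and
  an alternating ray through infinitely many ears gives one more disjoint out-ray in \<open>\<omega>\<close>.
  Let \<open>S\<close> be a smallest separating set. A version of Menger's theorem in which the paths may also be
  rays yields card S disjoint half tracks from \<open>S\<close> towards \<open>\<lceil>\<omega>\<rceil>\<close> on the far side of \<open>S\<close> and, in
  the reverse digraph, card S disjoint half tracks from \<open>S\<close> towards \<open>\<lfloor>\<omega>\<rfloor>\<close> on the near side. Their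
  unions are disjoint tracks.
\<close>

section \<open>Infinitely linked vertex sets\<close>

text \<open>The obstacle is that augmentation need not stop: an alternating walk towards a ray of
  \<open>B\<close> may be infinite, and it then has to produce rays that belong to \<open>B\<close>
  again. The star-comb dichotomy, applied in the residual digraph, settles this. A star would force
  its centre into \<open>W\<close>, from which no arcs are kept; a comb gives an alternating ray
  whose tail is linked to a ray of \<open>B\<close>. So the Menger theorem only asks that
  \<open>W\<close> contain all centres of stars and that \<open>B\<close> be closed under combs, and
  both sides of the separator satisfy this. The same augmentation lemma, with \<open>W = {}\<close>,
  enlarges a family of disjoint rays of the end. There the walk has no target; it is infinite
  because it keeps visiting new ears, and it is the ears that tie the resulting ray to the end in
  both directions. Finite separation is used as the basic notion because it is transitive through
  rays of either orientation; families of disjoint paths enter only when the original definitions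
  are translated.\<close>

definition avoid :: "'a rel \<Rightarrow> 'a set \<Rightarrow> 'a rel" where
  "avoid E X = {(u, v) \<in> E. u \<notin> X \<and> v \<notin> X}"

text \<open>The reflexive pair \<open>(a, a)\<close> is present even for \<open>a\<close> in
  \<open>X\<close>; this is why \<open>inf_linked\<close> and \<open>escapes\<close> demand
  \<open>a \<notin> X\<close> separately.\<close>

abbreviation reach :: "'a rel \<Rightarrow> 'a set \<Rightarrow> 'a \<Rightarrow> 'a \<Rightarrow> bool" where
  "reach E X a b \<equiv> (a, b) \<in> (avoid E X)\<^sup>*"

text \<open>
  If \<open>A\<close> and \<open>B\<close> are the vertex sets of rays, this says that there are infinitely many disjoint
  \<open>A\<close>--\<open>B\<close> paths. For \<open>A = E `` {v}\<close> with \<open>v\<close> outside \<open>B\<close> it says that there are infinitely many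
  \<open>v\<close>--\<open>B\<close> paths that pairwise meet only in \<open>v\<close>, because \<open>X\<close> may contain \<open>v\<close>.
\<close>

definition inf_linked :: "'a rel \<Rightarrow> 'a set \<Rightarrow> 'a set \<Rightarrow> bool" where
  "inf_linked E A B \<longleftrightarrow>
     (\<forall>X. finite X \<longrightarrow> (\<exists>a \<in> A. \<exists>b \<in> B. a \<notin> X \<and> reach E X a b))"

definition rays :: "'a rel \<Rightarrow> (nat \<Rightarrow> 'a) set" where
  "rays E = {q. inj q \<and> (\<forall>i. (q i, q (Suc i)) \<in> E)}"

lemma avoid_iff [simp]: "(u, v) \<in> avoid E X \<longleftrightarrow> (u, v) \<in> E \<and> u \<notin> X \<and> v \<notin> X"
  by (auto simp: avoid_def)

lemma avoid_mono: "E \<subseteq> E' \<Longrightarrow> X' \<subseteq> X \<Longrightarrow> reach E X a b \<Longrightarrow> reach E' X' a b"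
  by (erule rtrancl_mono[THEN subsetD, rotated]) (auto simp: avoid_def)

lemma avoid_notin: "reach E X a b \<Longrightarrow> a \<notin> X \<Longrightarrow> b \<notin> X"
  by (induction rule: rtrancl_induct) auto

lemma avoid_notin': "reach E X a b \<Longrightarrow> b \<notin> X \<Longrightarrow> a \<notin> X"
  by (induction rule: converse_rtrancl_induct) auto

lemma avoid_converse: "avoid (E\<inverse>) X = (avoid E X)\<inverse>"
  by (auto simp: avoid_def)

lemma inf_linkedE:
  assumes "inf_linked E A B" "finite X"
  obtains a b where "a \<in> A" "b \<in> B" "a \<notin> X" "b \<notin> X" "reach E X a b"
  using assms avoid_notin unfolding inf_linked_def by metis

lemma inf_linked_rayE:
  fixes r :: "nat \<Rightarrow> 'a"
  assumes "inf_linked E (range r) A" "finite X"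
  obtains i a where "n < i" "a \<in> A" "r i \<notin> X" "a \<notin> X" "reach E X (r i) a"
proof -
  have "finite (X \<union> r ` {..n})" using assms(2) by simp
  with assms(1) obtain b a where a: "b \<in> range r" "a \<in> A" "b \<notin> X \<union> r ` {..n}" "a \<notin> X \<union> r ` {..n}"
    "reach E (X \<union> r ` {..n}) b a"
    by (rule inf_linkedE)
  obtain i where i: "b = r i" using a(1) by blast
  have "n < i" using a(3) i by (auto intro: leI simp: not_le[symmetric])
  moreover have "reach E X b a" using a(5) by (rule avoid_mono[rotated 2]) auto
  ultimately show ?thesis using that[of i a] a(2-4) i by simp
qed

lemma inf_linked_mono:
  assumes "inf_linked E A B" "E \<subseteq> E'" "A \<subseteq> A'" "B \<subseteq> B'"
  shows "inf_linked E' A' B'"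
  using assms unfolding inf_linked_def by (meson avoid_mono order_refl subsetD)

lemma inf_linked_converse [simp]: "inf_linked (E\<inverse>) B A \<longleftrightarrow> inf_linked E A B"
  unfolding inf_linked_def avoid_converse rtrancl_converse
  by (metis avoid_notin avoid_notin' converse_iff)

text \<open>A finite separator for \<open>B\<close> and one for \<open>C\<close> together separate
  \<open>A\<close> from both. Extended to finite unions, this is the pigeonhole principle that
  singles out one ray of a finite linkage.\<close>

lemma inf_linked_Un_right: "inf_linked E A (B \<union> C) \<Longrightarrow> inf_linked E A B \<or> inf_linked E A C"
proof (rule ccontr)
  assume *: "inf_linked E A (B \<union> C)" "\<not> (inf_linked E A B \<or> inf_linked E A C)"
  then obtain X Y where XY: "finite X" "finite Y"
    "\<And>a b. a \<in> A \<Longrightarrow> b \<in> B \<Longrightarrow> a \<notin> X \<Longrightarrow> \<not> reach E X a b"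
    "\<And>a b. a \<in> A \<Longrightarrow> b \<in> C \<Longrightarrow> a \<notin> Y \<Longrightarrow> \<not> reach E Y a b"
    unfolding inf_linked_def by metis
  from *(1) obtain a b where ab: "a \<in> A" "b \<in> B \<union> C" "a \<notin> X \<union> Y" "b \<notin> X \<union> Y"
      "reach E (X \<union> Y) a b"
    by (rule inf_linkedE[where X = "X \<union> Y"]) (use XY(1,2) in auto)
  have "reach E X a b" "reach E Y a b"
    using ab(5) by (auto elim: avoid_mono[rotated 2])
  then show False using ab XY(3,4) by blast
qed

lemma inf_linked_empty [simp]: "\<not> inf_linked E A {}" "\<not> inf_linked E {} B"
  unfolding inf_linked_def by auto

lemma inf_linked_UN_right:
  "finite I \<Longrightarrow> inf_linked E A (\<Union>i\<in>I. B i) \<Longrightarrow> \<exists>i\<in>I. inf_linked E A (B i)"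
  by (induction I rule: finite_induct) (auto dest: inf_linked_Un_right)

lemma inf_linked_UN_left:
  assumes "finite I" "inf_linked E (\<Union>i\<in>I. A i) B"
  shows "\<exists>i\<in>I. inf_linked E (A i) B"
  using inf_linked_UN_right[of I "E\<inverse>" B A] assms by simp

lemma not_inf_linked_finite: "finite B \<Longrightarrow> \<not> inf_linked E A B"
  using avoid_notin unfolding inf_linked_def by metis

lemma inf_linked_self:
  assumes "infinite (A \<inter> B)"
  shows "inf_linked E A B"
  unfolding inf_linked_def
proof (intro allI impI)
  fix X :: "'a set" assume "finite X"
  then obtain a where "a \<in> (A \<inter> B) - X"
    using assms by (metis Diff_infinite_finite finite.emptyI subsetI subset_antisym empty_iff)
  then show "\<exists>a\<in>A. \<exists>b\<in>B. a \<notin> X \<and> reach E X a b" by auto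
qed

lemma rays_inj: "q \<in> rays E \<Longrightarrow> inj q" and rays_arc: "q \<in> rays E \<Longrightarrow> (q i, q (Suc i)) \<in> E"
  by (auto simp: rays_def)

lemma rays_mono: "E \<subseteq> E' \<Longrightarrow> q \<in> rays E \<Longrightarrow> q \<in> rays E'"
  by (auto simp: rays_def)

lemma inj_infinite_range: "inj (q :: nat \<Rightarrow> 'a) \<Longrightarrow> infinite (range q)"
  using finite_imageD by blast

lemma infinite_ray: "q \<in> rays E \<Longrightarrow> infinite (range q)"
  by (intro inj_infinite_range rays_inj)

lemma inj_eventually_notin:
  fixes q :: "nat \<Rightarrow> 'a"
  assumes "inj q" "finite (X \<inter> range q)"
  obtains n where "\<And>i. i \<ge> n \<Longrightarrow> q i \<notin> X"
proof -
  have "finite (q -` (X \<inter> range q))" using assms by (intro finite_vimageI) auto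
  then obtain n where "\<forall>i \<in> q -` (X \<inter> range q). i < n"
    using finite_nat_set_iff_bounded by auto
  then have "q i \<notin> X" if "i \<ge> n" for i using that by (meson IntI leD rangeI vimageI)
  then show ?thesis by (rule that)
qed

lemma last_index:
  fixes i :: nat
  assumes "finite {i. P i}" "P i"
  obtains k where "P k" "\<And>j. k < j \<Longrightarrow> \<not> P j"
proof
  show "P (Max {i. P i})" using Max_in[OF assms(1)] assms(2) by blast
  show "\<not> P j" if "Max {i. P i} < j" for j using Max_ge[OF assms(1), of j] that by auto
qed

lemma rays_tail: "q \<in> rays E \<Longrightarrow> (\<lambda>i. q (n + i)) \<in> rays E"
  unfolding rays_def by (fastforce simp: inj_def)

lemma chain_rtrancl:
  assumes "\<And>k. i \<le> k \<Longrightarrow> k < j \<Longrightarrow> (q k, q (Suc k)) \<in> E" "i \<le> j"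
  shows "(q i, q j) \<in> E\<^sup>*"
  using assms(2,1)
  by (induction j rule: dec_induct) (auto intro: rtrancl_into_rtrancl)

lemma chain_avoid:
  assumes "\<And>k. (q k, q (Suc k)) \<in> E" "\<And>k. i \<le> k \<Longrightarrow> k \<le> j \<Longrightarrow> q k \<notin> X" "i \<le> j"
  shows "reach E X (q i) (q j)"
  by (rule chain_rtrancl) (use assms in auto)

text \<open>The first path is made to arrive on \<open>r\<close> beyond all vertices of
  \<open>X\<close>; from there \<open>r\<close> itself leads on to a point further out where a path
  to \<open>C\<close> leaves. For an in-ray the same argument works after reversal, with the point
  of departure fixed first.\<close>

lemma inf_linked_trans_out:
  assumes "inf_linked E A (range r)" "inf_linked E (range r) C"
    "inj r" "\<And>i. (r i, r (Suc i)) \<in> E"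
  shows "inf_linked E A C"
  unfolding inf_linked_def
proof (intro allI impI)
  fix X :: "'a set" assume X: "finite X"
  obtain n where n: "\<And>i. i \<ge> n \<Longrightarrow> r i \<notin> X"
    using inj_eventually_notin[OF assms(3), of X] X by auto
  from assms(1) obtain a b where a: "a \<in> A" "b \<in> range r" "a \<notin> X \<union> r ` {..n}"
      "b \<notin> X \<union> r ` {..n}" "reach E (X \<union> r ` {..n}) a b"
    by (rule inf_linkedE[where X = "X \<union> r ` {..n}"]) (use X in auto)
  have ab: "reach E X a b" using a(5) by (rule avoid_mono[rotated 2]) auto
  from a(2) obtain i where i: "b = r i" by auto
  obtain j c where c: "i < j" "c \<in> C" "r j \<notin> X" "c \<notin> X" "reach E X (r j) c"
    using assms(2) X by (rule inf_linked_rayE)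
  have "n \<le> i" "i \<le> j" using a(4) c(1) i by (auto intro: leI simp: image_iff)
  then have "reach E X (r i) (r j)" using n assms(4) by (intro chain_avoid) auto
  then have "reach E X a c" using ab c(5) i by auto
  then show "\<exists>a\<in>A. \<exists>b\<in>C. a \<notin> X \<and> reach E X a b" using a c by blast
qed

lemma inf_linked_trans_in:
  assumes "inf_linked E A (range r)" "inf_linked E (range r) C"
    "inj r" "\<And>i. (r (Suc i), r i) \<in> E"
  shows "inf_linked E A C"
  using inf_linked_trans_out[of "E\<inverse>" C r A] assms by simp

text \<open>Zorn's lemma gives a maximal pairwise related family, and the extension hypothesis keeps
  it from being finite.\<close>

lemma infinite_pairwise:
  assumes ext: "\<And>P. finite P \<Longrightarrow> P \<subseteq> A \<Longrightarrow> pairwise R P \<Longrightarrow> \<exists>p \<in> A - P. \<forall>q \<in> P. R p q \<and> R q p"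
  shows "\<exists>P \<subseteq> A. infinite P \<and> pairwise R P"
proof -
  define \<F> where "\<F> = {P. P \<subseteq> A \<and> pairwise R P}"
  have "\<exists>M\<in>\<F>. \<forall>P\<in>\<F>. M \<subseteq> P \<longrightarrow> P = M"
  proof (rule subset_Zorn')
    fix C assume C: "subset.chain \<F> C"
    have "pairwise R (\<Union>C)"
    proof (rule pairwiseI)
      fix p q assume "p \<in> \<Union>C" "q \<in> \<Union>C" and ne: "p \<noteq> q"
      then obtain P Q where "P \<in> C" "Q \<in> C" "p \<in> P" "q \<in> Q" by auto
      moreover have "P \<subseteq> Q \<or> Q \<subseteq> P" using C \<open>P \<in> C\<close> \<open>Q \<in> C\<close> by (auto simp: subset_chain_def)
      moreover have "pairwise R P" "pairwise R Q"
        using C \<open>P \<in> C\<close> \<open>Q \<in> C\<close> by (auto simp: subset_chain_def \<F>_def)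
      ultimately show "R p q" using ne by (auto simp: pairwise_def)
    qed
    moreover have "\<Union>C \<subseteq> A" using C by (auto simp: subset_chain_def \<F>_def)
    ultimately show "\<Union>C \<in> \<F>" by (simp add: \<F>_def)
  qed
  then obtain M where M: "M \<subseteq> A" "pairwise R M"
    "\<And>P. P \<subseteq> A \<Longrightarrow> pairwise R P \<Longrightarrow> M \<subseteq> P \<Longrightarrow> P = M"
    by (auto simp: \<F>_def)
  have "infinite M"
  proof
    assume "finite M"
    from ext[OF this M(1,2)] obtain p where p: "p \<in> A - M" "\<forall>q \<in> M. R p q \<and> R q p" by auto
    then have "insert p M = M" using M(1,2) by (intro M(3)) (auto simp: pairwise_insert)
    then show False using p by auto
  qed
  with M show ?thesis by auto
qed

lemma simple_path:
  assumes "(x, y) \<in> r\<^sup>*"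
  obtains f :: "nat \<Rightarrow> 'a" and n where "f 0 = x" "f n = y" "inj_on f {..n}"
    "\<And>i. i < n \<Longrightarrow> (f i, f (Suc i)) \<in> r"
proof -
  \<comment> \<open>A shortest walk is simple: the part between two occurrences of a vertex could be
    cut out.\<close>
  define n where "n = (LEAST n. (x, y) \<in> r ^^ n)"
  have "\<exists>n. (x, y) \<in> r ^^ n" using assms by (simp add: rtrancl_power)
  then have n: "(x, y) \<in> r ^^ n" and least: "\<And>m. (x, y) \<in> r ^^ m \<Longrightarrow> n \<le> m"
    unfolding n_def by (auto intro: LeastI_ex Least_le)
  from n obtain f where f: "f 0 = x" "f n = y" "\<And>i. i < n \<Longrightarrow> (f i, f (Suc i)) \<in> r"
    unfolding relpow_fun_conv by blast
  have seg: "(f i, f j) \<in> r ^^ (j - i)" if "i \<le> j" "j \<le> n" for i j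
    unfolding relpow_fun_conv using f that by (intro exI[of _ "\<lambda>k. f (i + k)"]) auto
  have "f i \<noteq> f j" if "i < j" "j \<le> n" for i j
  proof
    assume "f i = f j"
    then have "(x, y) \<in> r ^^ (i + (n - j))"
      unfolding relpow_add using seg[of 0 i] seg[of j n] that f(1,2) by auto
    from least[OF this] show False using that by simp
  qed
  then have "inj_on f {..n}" by (intro inj_onI) (metis atMost_iff linorder_neqE_nat)
  with f that show ?thesis by blast
qed

lemma star_comb:
  assumes "infinite \<Phi>" "\<Phi> \<subseteq> \<rho>\<^sup>* `` {x}"
  shows "(\<exists>v \<in> \<rho>\<^sup>* `` {x}. inf_linked \<rho> (\<rho> `` {v}) \<Phi>) \<or>
    (\<exists>q \<in> rays \<rho>. q 0 = x \<and> inf_linked \<rho> (range q) \<Phi>)"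
proof -
  \<comment> \<open>Work in a breadth-first tree \<open>T\<close>: there the descendants of distinct children are disjoint,
    so a vertex with infinitely many descendants in \<open>\<Phi>\<close> none of whose children has this property is
    the centre of a star, and otherwise such vertices form a ray.\<close>
  let ?N = "\<rho>\<^sup>* `` {x}"
  define dist where "dist v = (LEAST n. (x, v) \<in> \<rho> ^^ n)" for v
  have dist: "(x, v) \<in> \<rho> ^^ dist v" if "v \<in> ?N" for v
    using that unfolding dist_def by (auto simp: rtrancl_power intro: LeastI)
  have dist_le: "dist v \<le> n" if "(x, v) \<in> \<rho> ^^ n" for v n
    unfolding dist_def using that by (rule Least_le)
  have dist_x: "dist x = 0" using dist_le[of x 0] by simp
  have "\<exists>p. p \<in> ?N \<and> (p, v) \<in> \<rho> \<and> dist v = Suc (dist p)" if v: "v \<in> ?N" "v \<noteq> x" for v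
  proof -
    have "dist v \<noteq> 0" using dist[OF v(1)] v(2) by (cases "dist v") auto
    then obtain n where n: "dist v = Suc n" by (cases "dist v") auto
    then obtain p where p: "(x, p) \<in> \<rho> ^^ n" "(p, v) \<in> \<rho>" using dist[OF v(1)] by auto
    have "dist p \<le> n" using p dist_le by auto
    moreover have "p \<in> ?N" using p(1) by (auto simp: rtrancl_power)
    moreover have "(x, v) \<in> \<rho> ^^ Suc (dist p)" using dist[OF \<open>p \<in> ?N\<close>] p(2) by auto
    then have "Suc n \<le> Suc (dist p)" using dist_le n by metis
    ultimately show ?thesis using p n by auto
  qed
  then obtain par where par: "\<And>v. v \<in> ?N \<Longrightarrow> v \<noteq> x \<Longrightarrow> par v \<in> ?N \<and> (par v, v) \<in> \<rho> \<and> dist v = Suc (dist (par v))"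
    by metis
  define T where "T = {(par v, v) |v. v \<in> ?N \<and> v \<noteq> x}"
  define D where "D v = T\<^sup>* `` {v}" for v
  have T: "(u, v) \<in> T \<Longrightarrow> u \<in> ?N \<and> v \<in> ?N \<and> (u, v) \<in> \<rho> \<and> dist v = Suc (dist u)" for u v
    using par by (auto simp: T_def)
  have T_unique: "(u, v) \<in> T \<Longrightarrow> (u', v) \<in> T \<Longrightarrow> u = u'" for u u' v by (auto simp: T_def)
  have dist_mono: "dist u \<le> dist v" if "v \<in> D u" for u v
  proof -
    have "(u, v) \<in> T\<^sup>*" using that by (simp add: D_def)
    then show ?thesis by induction (auto dest: T)
  qed
  \<comment> \<open>Parents are unique, so two ancestors of \<open>w\<close> lie on a common branch
    of the tree, and \<open>dist\<close> increases strictly along it.\<close>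
  have D_eq: "u = v" if "w \<in> D u" "w \<in> D v" "dist u = dist v" for u v w
  proof -
    have "single_valued (T\<inverse>)" using T_unique by (auto simp: single_valued_def)
    then have "(u, v) \<in> T\<^sup>* \<or> (v, u) \<in> T\<^sup>*"
      using single_valued_confluent[of "T\<inverse>" w u v] that by (auto simp: D_def rtrancl_converse)
    moreover have "a = b" if "(a, b) \<in> T\<^sup>*" "dist a = dist b" for a b
      using that(1)
    proof (cases rule: converse_rtranclE)
      case (step c)
      then have "dist c \<le> dist b" using dist_mono[of b c] by (auto simp: D_def)
      then show ?thesis using T[OF step(1)] that(2) by simp
    qed
    ultimately show ?thesis using that(3) by metis
  qed
  have root: "v \<in> D x" if "v \<in> ?N" for v
    using that
  proof (induction "dist v" arbitrary: v rule: less_induct)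
    case less
    show ?case
    proof (cases "v = x")
      case False
      then have "par v \<in> D x" "(par v, v) \<in> T" using par[OF less.prems] less by (auto simp: T_def)
      then show ?thesis by (auto simp: D_def intro: rtrancl_into_rtrancl)
    qed (simp add: D_def)
  qed
  have path: "reach \<rho> X v w" if "w \<in> D v" "D v \<inter> X = {}" for v w X
  proof -
    have "(v, w) \<in> T\<^sup>*" using that by (simp add: D_def)
    then show ?thesis
    proof induction
      case (step y z)
      then have "y \<in> D v" "z \<in> D v" by (auto simp: D_def intro: rtrancl_into_rtrancl)
      then have "(y, z) \<in> avoid \<rho> X" using T[OF step(2)] that(2) by auto
      with step.IH show ?case by (rule rtrancl_into_rtrancl)
    qed simp
  qed
  define big where "big v \<longleftrightarrow> v \<in> ?N \<and> infinite (\<Phi> \<inter> D v)" for v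
  have "\<Phi> \<inter> D x = \<Phi>" using root assms(2) by auto
  then have big_x: "big x" using assms by (simp add: big_def)
  show ?thesis
  proof (cases "\<exists>v \<in> ?N. inf_linked \<rho> (\<rho> `` {v}) \<Phi>")
    case no_star: False
    have "\<exists>c. (v, c) \<in> T \<and> big c" if v: "big v" for v
    proof (rule ccontr)
      assume no_big: "\<nexists>c. (v, c) \<in> T \<and> big c"
      define C where "C = {c. (v, c) \<in> T \<and> \<Phi> \<inter> D c \<noteq> {}}"
      have "\<Phi> \<inter> D v \<subseteq> {v} \<union> (\<Union>c\<in>C. \<Phi> \<inter> D c)"
      proof
        fix \<phi> assume \<phi>: "\<phi> \<in> \<Phi> \<inter> D v"
        then have "(v, \<phi>) \<in> T\<^sup>*" by (simp add: D_def)
        then show "\<phi> \<in> {v} \<union> (\<Union>c\<in>C. \<Phi> \<inter> D c)"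
          by (cases rule: converse_rtranclE) (use \<phi> in \<open>auto simp: C_def D_def\<close>)
      qed
      moreover have "finite (\<Phi> \<inter> D c)" if "c \<in> C" for c
        using that no_big T by (auto simp: C_def big_def)
      ultimately have "finite C \<Longrightarrow> finite (\<Phi> \<inter> D v)"
        by (metis finite_UN finite.emptyI finite.insertI finite_Un finite_subset)
      then have "infinite C" using v by (auto simp: big_def)
      have "inf_linked \<rho> (\<rho> `` {v}) \<Phi>"
        unfolding inf_linked_def
      proof (intro allI impI)
        fix X :: "'a set" assume X: "finite X"
        have "\<exists>c \<in> C. D c \<inter> X = {}"
        proof (rule ccontr)
          assume "\<not> (\<exists>c \<in> C. D c \<inter> X = {})"
          then have "\<forall>c \<in> C. \<exists>z. z \<in> D c \<inter> X" by auto
          then obtain g where g: "\<And>c. c \<in> C \<Longrightarrow> g c \<in> D c \<inter> X" by metis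
          have "inj_on g C"
          proof (rule inj_onI)
            fix c c' assume "c \<in> C" "c' \<in> C" "g c = g c'"
            then show "c = c'" using g[of c] g[of c'] T
              by (intro D_eq[of "g c"]) (auto simp: C_def)
          qed
          moreover have "g ` C \<subseteq> X" using g by auto
          ultimately show False using X \<open>infinite C\<close> by (meson finite_imageD finite_subset)
        qed
        then obtain c where c: "c \<in> C" "D c \<inter> X = {}" by auto
        then obtain \<phi> where "\<phi> \<in> \<Phi>" "\<phi> \<in> D c" by (auto simp: C_def)
        moreover have "(v, c) \<in> \<rho>" using c T by (auto simp: C_def)
        moreover have "c \<notin> X" using c by (auto simp: D_def)
        ultimately show "\<exists>a\<in>\<rho> `` {v}. \<exists>b\<in>\<Phi>. a \<notin> X \<and> reach \<rho> X a b"
          using path c(2) by blast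
      qed
      with no_star v show False by (auto simp: big_def)
    qed
    then obtain ch where ch: "\<And>v. big v \<Longrightarrow> (v, ch v) \<in> T \<and> big (ch v)" by metis
    define q where "q n = (ch ^^ n) x" for n
    have q_big: "big (q n)" for n by (induction n) (auto simp: q_def big_x ch)
    have q_step: "(q n, q (Suc n)) \<in> T" for n using ch[OF q_big] by (simp add: q_def)
    have q_dist: "dist (q n) = n" for n
      using T[OF q_step] by (induction n) (auto simp: q_def dist_x)
    have "inj q" by (rule injI) (metis q_dist)
    then have "q \<in> rays \<rho>" using T[OF q_step] by (auto simp: rays_def)
    moreover have "inf_linked \<rho> (range q) \<Phi>"
      unfolding inf_linked_def
    proof (intro allI impI)
      fix X :: "'a set" assume X: "finite X"
      \<comment> \<open>\<open>dist\<close> never drops along the tree, so from this level on no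
        descendant lies in \<open>X\<close>; the inserted 0 covers empty \<open>X\<close>.\<close>
      define n where "n = Suc (Max (insert 0 (dist ` X)))"
      have "D (q n) \<inter> X = {}"
      proof (rule ccontr)
        assume "D (q n) \<inter> X \<noteq> {}"
        then obtain z where "z \<in> X" "z \<in> D (q n)" by auto
        then have "n \<le> dist z" "dist z < n"
          using dist_mono[of z "q n"] q_dist X by (auto simp: n_def less_Suc_eq_le)
        then show False by simp
      qed
      moreover obtain \<phi> where "\<phi> \<in> \<Phi>" "\<phi> \<in> D (q n)"
        using q_big[of n] unfolding big_def by (metis IntE ex_in_conv finite.emptyI)
      moreover have "q n \<in> D (q n)" by (simp add: D_def)
      ultimately show "\<exists>a\<in>range q. \<exists>b\<in>\<Phi>. a \<notin> X \<and> reach \<rho> X a b"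
        using path by blast
    qed
    moreover have "q 0 = x" by (simp add: q_def)
    ultimately show ?thesis by blast
  qed blast
qed

section \<open>Linkages and alternating walks\<close>

text \<open>Two equal vertices could be traced back in step along the unique predecessors until
  \<open>q 0\<close> itself had a predecessor.\<close>

lemma chain_inj:
  assumes "single_valued (F\<inverse>)" "q 0 \<notin> Range F" "\<And>i. (q i, q (Suc i)) \<in> F"
  shows "inj (q :: nat \<Rightarrow> 'a)"
proof -
  have "q i \<noteq> q (i + Suc k)" for i k
  proof (induction i)
    case 0
    then show ?case using assms(2) assms(3)[of k] by auto
  next
    case (Suc i)
    then show ?case using assms(1) assms(3)[of i] assms(3)[of "i + Suc k"]
      by (auto simp: single_valued_def)
  qed
  then show ?thesis by (metis add_Suc_right less_iff_Suc_add linorder_injI)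
qed

lemma rtrancl_restrict_reachable:
  "{(a, b) \<in> F. a \<in> F\<^sup>* `` Y}\<^sup>* `` Y = F\<^sup>* `` Y"
proof
  show "{(a, b) \<in> F. a \<in> F\<^sup>* `` Y}\<^sup>* `` Y \<subseteq> F\<^sup>* `` Y"
    using rtrancl_mono[of "{(a, b) \<in> F. a \<in> F\<^sup>* `` Y}" F] by auto
  show "F\<^sup>* `` Y \<subseteq> {(a, b) \<in> F. a \<in> F\<^sup>* `` Y}\<^sup>* `` Y"
  proof
    fix v assume "v \<in> F\<^sup>* `` Y"
    then obtain y where y: "y \<in> Y" "(y, v) \<in> F\<^sup>*" by auto
    from y(2) have "(y, v) \<in> {(a, b) \<in> F. a \<in> F\<^sup>* `` Y}\<^sup>*"
    proof induction
      case (step b c)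
      then show ?case using y(1) by (auto intro: rtrancl_into_rtrancl)
    qed simp
    then show "v \<in> {(a, b) \<in> F. a \<in> F\<^sup>* `` Y}\<^sup>* `` Y" using y(1) by auto
  qed
qed

lemma finite_Image_single_valued:
  assumes "finite X" "single_valued r"
  shows "finite (r `` X)"
proof -
  have "\<exists>b. r `` {a} \<subseteq> {b}" for a using assms(2) unfolding single_valued_def by blast
  then have "finite (r `` {a})" for a by (meson finite.emptyI finite.insertI finite_subset)
  then have "finite (\<Union>a\<in>X. r `` {a})" using assms(1) by auto
  moreover have "r `` X = (\<Union>a\<in>X. r `` {a})" by auto
  ultimately show ?thesis by simp
qed

text \<open>
  \<open>F\<close> is the arc set of a family of disjoint paths ending in \<open>W\<close> and rays belonging to \<open>B\<close>, one
  starting at each vertex of \<open>Y\<close>.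
\<close>

locale linkage =
  fixes E :: "'a rel" and W :: "'a set" and B :: "(nat \<Rightarrow> 'a) set" and Y :: "'a set" and F :: "'a rel"
  assumes finite_Y: "finite Y"
    and F_E: "F \<subseteq> E"
    and out_unique: "single_valued F"
    and in_unique: "single_valued (F\<inverse>)"
    and Y_start: "Y \<inter> Range F = {}"
    and F_reach: "Domain F \<subseteq> F\<^sup>* `` Y"
    and ends_in_W: "v \<in> F\<^sup>* `` Y \<Longrightarrow> v \<notin> Domain F \<Longrightarrow> v \<in> W"
    and rays_in_B: "q 0 \<in> Y \<Longrightarrow> (\<And>i. (q i, q (Suc i)) \<in> F) \<Longrightarrow> q \<in> B"
begin

definition V :: "'a set" where "V = F\<^sup>* `` Y"

lemma Y_V: "Y \<subseteq> V" by (auto simp: V_def)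

lemma F_V: "(u, v) \<in> F \<Longrightarrow> u \<in> V" "(u, v) \<in> F \<Longrightarrow> v \<in> V"
proof -
  assume uv: "(u, v) \<in> F"
  then show "u \<in> V" using F_reach by (auto simp: V_def)
  then show "v \<in> V" using uv by (auto simp: V_def intro: rtrancl_into_rtrancl)
qed

lemma V_pred: "v \<in> V \<Longrightarrow> v \<notin> Y \<Longrightarrow> \<exists>u. (u, v) \<in> F"
  unfolding V_def by (auto elim: rtranclE)

lemma out_eq: "(u, v) \<in> F \<Longrightarrow> (u, v') \<in> F \<Longrightarrow> v = v'"
  using out_unique by (auto simp: single_valued_def)

lemma in_eq: "(u, v) \<in> F \<Longrightarrow> (u', v) \<in> F \<Longrightarrow> u = u'"
  using in_unique by (auto simp: single_valued_def)

lemma chain_ray: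
  assumes "q 0 \<in> Y" "\<And>i. (q i, q (Suc i)) \<in> F"
  shows "q \<in> rays E" "q \<in> B"
  using chain_inj[OF in_unique, of q] assms Y_start F_E rays_in_B[of q] by (auto simp: rays_def)

text \<open>Successors in \<open>F\<close> are unique, so everything reachable from \<open>y\<close>
  forms one sequence, which either stops or runs forever.\<close>

lemma orbit_cases:
  assumes "y \<in> Y"
  obtains (path) f n where "f 0 = y" "inj_on f {..n}" "\<And>i. i < n \<Longrightarrow> (f i, f (Suc i)) \<in> F"
      "f n \<in> W" "f n \<notin> Domain F" "F\<^sup>* `` {y} = f ` {..n}"
    | (ray) q where "q 0 = y" "\<And>i. (q i, q (Suc i)) \<in> F" "F\<^sup>* `` {y} = range q"
proof -
  define s where "s v = (SOME w. (v, w) \<in> F)" for v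
  have s: "(v, s v) \<in> F" if "v \<in> Domain F" for v
    using that unfolding s_def by (auto intro: someI)
  define q where "q n = (s ^^ n) y" for n
  have q0: "q 0 = y" and q_Suc: "q (Suc n) = s (q n)" for n by (simp_all add: q_def)
  have sub: "F\<^sup>* `` {y} \<subseteq> range q"
  proof safe
    fix v assume "(y, v) \<in> F\<^sup>*"
    then show "v \<in> range q"
    proof induction
      case base
      then show ?case using q0 by (metis rangeI)
    next
      case (step b c)
      then obtain n where "b = q n" by auto
      then have "c = q (Suc n)" using step s[of b] out_eq q_Suc by auto
      then show ?case by auto
    qed
  qed
  show ?thesis
  proof (cases "\<forall>n. q n \<in> Domain F")
    case True
    then have arcs: "(q i, q (Suc i)) \<in> F" for i using s q_Suc by auto
    have "(y, q n) \<in> F\<^sup>*" for n using chain_rtrancl[of 0 n q F] arcs q0 by auto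
    then have "F\<^sup>* `` {y} = range q" using sub by auto
    with arcs q0 show ?thesis using ray by blast
  next
    case False
    define n where "n = (LEAST n. q n \<notin> Domain F)"
    have n: "q n \<notin> Domain F" unfolding n_def by (rule LeastI_ex) (use False in blast)
    have less: "q i \<in> Domain F" if "i < n" for i using that not_less_Least unfolding n_def by blast
    have arcs: "(q i, q (Suc i)) \<in> F" if "i < n" for i using s less q_Suc that by auto
    have reach: "(q i, q j) \<in> F\<^sup>*" if "i \<le> j" "j \<le> n" for i j
      using chain_rtrancl[of i j q F] arcs that by auto
    have img: "F\<^sup>* `` {y} = q ` {..n}"
    proof
      show "q ` {..n} \<subseteq> F\<^sup>* `` {y}" using reach[of 0] q0 by auto
      show "F\<^sup>* `` {y} \<subseteq> q ` {..n}"
      proof safe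
        fix v assume "(y, v) \<in> F\<^sup>*"
        then show "v \<in> q ` {..n}"
        proof induction
          case base
          then show ?case using q0 by force
        next
          case (step b c)
          then obtain i where i: "b = q i" "i \<le> n" by auto
          then have "i < n" using step(2) n by (cases "i = n") auto
          then have "c = q (Suc i)" using arcs step(2) i out_eq by auto
          then show ?case using \<open>i < n\<close> by auto
        qed
      qed
    qed
    have "q i \<noteq> q j" if "i < j" "j \<le> n" for i j
      using that
    proof (induction i arbitrary: j)
      case 0
      then obtain k where "j = Suc k" by (cases j) auto
      then have "q j \<in> Range F" using arcs[of k] 0 by auto
      then show ?case using q0 assms Y_start by auto
    next
      case (Suc i)
      then obtain k where k: "j = Suc k" by (cases j) auto
      then have "q i \<noteq> q k" using Suc by auto
      then show ?case using arcs[of i] arcs[of k] Suc.prems k in_eq by auto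
    qed
    then have "inj_on q {..n}" by (intro inj_onI) (metis atMost_iff linorder_neqE_nat)
    moreover have "q n \<in> W"
      using reach[of 0 n] q0 assms n by (intro ends_in_W) auto
    ultimately show ?thesis using path[of q n] q0 arcs n img by blast
  qed
qed

text \<open>Unique predecessors make two starts with a common descendant comparable, but no start
  has a predecessor. Applied to a vertex of \<open>Y\<close> in the role of \<open>v\<close>, this
  also shows that an orbit meets \<open>Y\<close> only in its start.\<close>

lemma orbit_disjoint:
  assumes "y \<in> Y" "y' \<in> Y" "(y, v) \<in> F\<^sup>*" "(y', v) \<in> F\<^sup>*"
  shows "y = y'"
proof -
  have "(y, y') \<in> F\<^sup>* \<or> (y', y) \<in> F\<^sup>*"
    using single_valued_confluent[OF in_unique, of v y y'] assms by (auto simp: rtrancl_converse)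
  then show ?thesis using assms(1,2) Y_start by (metis Range.intros disjoint_iff rtranclE)
qed

lemma V_orbits: "V = (\<Union>y\<in>Y. F\<^sup>* `` {y})" by (auto simp: V_def)

lemma infinite_Int_V:
  assumes "infinite (A \<inter> V)"
  obtains q where "q \<in> B" "q \<in> rays E" "infinite (A \<inter> range q)"
proof -
  have "infinite (\<Union>y\<in>Y. A \<inter> F\<^sup>* `` {y})" using assms unfolding V_orbits Int_UN_distrib .
  then obtain y where y: "y \<in> Y" "infinite (A \<inter> F\<^sup>* `` {y})" using finite_Y by (meson finite_UN)
  from y(1) show ?thesis
  proof (cases rule: orbit_cases)
    case (path f n)
    then show ?thesis using y(2) by simp
  next
    case (ray q)
    then show ?thesis using that[of q] chain_ray[of q] y by simp
  qed
qed

lemma inf_linked_V: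
  assumes "inf_linked E A V"
  obtains q where "q \<in> B" "q \<in> rays E" "inf_linked E A (range q)"
proof -
  obtain y where y: "y \<in> Y" "inf_linked E A (F\<^sup>* `` {y})"
    using inf_linked_UN_right[OF finite_Y assms[unfolded V_orbits]] by auto
  from y(1) show ?thesis
  proof (cases rule: orbit_cases)
    case (path f n)
    then show ?thesis using y(2) not_inf_linked_finite[of "f ` {..n}"] by simp
  next
    case (ray q)
    then show ?thesis using that[of q] chain_ray[of q] y by simp
  qed
qed

text \<open>
  Alternating walks are walks in the residual digraph of the unit flow \<open>F\<close> with vertex capacities.
  It suffices to record the vertices that may be left along an arc outside \<open>F\<close>: a walk entering a
  vertex \<open>x\<close> of the linkage has to go back along \<open>F\<close> at once, so it ends up at the predecessor
  of \<open>x\<close>. In general, entering \<open>x\<close> makes available the vertex \<open>u\<close> with \<open>entry u x\<close>; there is none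
  if \<open>x\<close> belongs to \<open>Y\<close>. The second alternative in \<open>residual\<close> is a further step back along \<open>F\<close>.
\<close>

definition entry :: "'a \<Rightarrow> 'a \<Rightarrow> bool" where
  "entry u x \<longleftrightarrow> u \<notin> V \<and> x = u \<or> (u, x) \<in> F"

definition residual :: "'a rel" where
  "residual = {(u, v). \<exists>x. entry v x \<and> ((u, x) \<in> E - F \<or> u = x \<and> v \<in> V)}"

lemma entry_unique: "entry u x \<Longrightarrow> entry u x' \<Longrightarrow> x = x'"
  using out_eq F_V by (auto simp: entry_def)

lemma entry_inj: "entry u x \<Longrightarrow> entry u' x \<Longrightarrow> u = u'"
  using in_eq F_V by (auto simp: entry_def)

lemma entry_self: "u \<notin> V \<Longrightarrow> entry u u" by (simp add: entry_def)

lemma entry_V: "entry u x \<Longrightarrow> u \<in> V \<longleftrightarrow> x \<in> V" using F_V by (auto simp: entry_def)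

lemma residual_back: "(u, v) \<in> F \<Longrightarrow> (v, u) \<in> residual"
  using F_V by (auto simp: residual_def entry_def)

lemma residual_forward: "(u, x) \<in> E - F \<Longrightarrow> entry v x \<Longrightarrow> (u, v) \<in> residual"
  by (auto simp: residual_def)

text \<open>The residual walk is followed only up to its first contact with \<open>V\<close>; until
  then it uses ordinary arcs of \<open>E\<close>. An available vertex \<open>c\<close> may stand for
  having entered its \<open>F\<close>-successor, so the predecessors of \<open>X\<close> must be
  avoided too if the entered vertex is to stay off \<open>X\<close>.\<close>

lemma residual_to_E:
  assumes "reach residual (X \<union> F\<inverse> `` X) c b" "c \<notin> X \<union> F\<inverse> `` X" "b \<in> V \<union> Z" "entry c x"
  shows "x \<notin> X \<and> (\<exists>b' \<in> V \<union> Z. reach E X x b')"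
  using assms(1,2,4)
proof (induction arbitrary: x rule: converse_rtrancl_induct)
  case base
  have "x \<notin> X" using base by (auto simp: entry_def)
  moreover have "x \<in> V \<union> Z" using base assms(3) F_V by (auto simp: entry_def)
  ultimately show ?case by blast
next
  case (step c c')
  have x: "x \<notin> X" using step by (auto simp: entry_def)
  show ?case
  proof (cases "c \<in> V")
    case True
    then have "x \<in> V" using step.prems entry_V by auto
    then show ?thesis using x by blast
  next
    case False
    then have "x = c" using step.prems F_V by (auto simp: entry_def)
    obtain x' where x': "entry c' x'" "(c, x') \<in> E - F \<or> c = x' \<and> c' \<in> V"
      using step.hyps(1) by (auto simp: residual_def)
    have "(c, x') \<in> E" using x' entry_V False by auto
    moreover obtain b' where "x' \<notin> X" "b' \<in> V \<union> Z" "reach E X x' b'"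
      using step.IH[OF _ x'(1)] step.hyps(1) by auto
    ultimately have "reach E X c b'"
      using x \<open>x = c\<close> by (auto intro: converse_rtrancl_into_rtrancl[of c x'])
    then show ?thesis using x \<open>x = c\<close> \<open>b' \<in> V \<union> Z\<close> by blast
  qed
qed

lemma residual_star:
  assumes "inf_linked residual (residual `` {v}) (V \<union> Z)"
  shows "inf_linked E (E `` {v}) (V \<union> Z)"
  unfolding inf_linked_def
proof (intro allI impI)
  fix X :: "'a set" assume X: "finite X"
  let ?X = "insert v X"
  have fin: "finite (?X \<union> F\<inverse> `` ?X)"
    using X finite_Image_single_valued[OF _ in_unique, of ?X] by simp
  from assms fin obtain c b where cb: "c \<in> residual `` {v}" "b \<in> V \<union> Z" "c \<notin> ?X \<union> F\<inverse> `` ?X"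
      "b \<notin> ?X \<union> F\<inverse> `` ?X" "reach residual (?X \<union> F\<inverse> `` ?X) c b"
    by (rule inf_linkedE)
  obtain x where x: "entry c x" "(v, x) \<in> E - F \<or> v = x \<and> c \<in> V"
    using cb(1) by (auto simp: residual_def)
  have "(v, x) \<in> E" using x cb(3) by (auto simp: entry_def)
  moreover obtain b' where "x \<notin> ?X" "b' \<in> V \<union> Z" "reach E ?X x b'"
    using residual_to_E[OF cb(5,3,2) x(1)] by auto
  then have "reach E X x b'" by (auto elim: avoid_mono[rotated 2])
  ultimately show "\<exists>a\<in>E `` {v}. \<exists>b\<in>V \<union> Z. a \<notin> X \<and> reach E X a b"
    using \<open>x \<notin> ?X\<close> \<open>b' \<in> V \<union> Z\<close> by blast
qed

lemma residual_comb:
  fixes u :: "nat \<Rightarrow> 'a"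
  assumes "inf_linked residual (range u) (V \<union> Z)" "\<And>i. i \<ge> n \<Longrightarrow> u i \<notin> V"
  shows "inf_linked E (range (\<lambda>i. u (n + i))) (V \<union> Z)"
  unfolding inf_linked_def
proof (intro allI impI)
  fix X :: "'a set" assume X: "finite X"
  let ?X = "X \<union> u ` {..n}"
  have "finite ?X" using X by simp
  then have fin: "finite (?X \<union> F\<inverse> `` ?X)"
    using finite_Image_single_valued[OF _ in_unique, of ?X] by blast
  from assms(1) fin obtain c b where cb: "c \<in> range u" "b \<in> V \<union> Z" "c \<notin> ?X \<union> F\<inverse> `` ?X"
      "b \<notin> ?X \<union> F\<inverse> `` ?X" "reach residual (?X \<union> F\<inverse> `` ?X) c b"
    by (rule inf_linkedE)
  obtain j where j: "c = u j" using cb(1) by auto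
  have "n \<le> j" using cb(3) j by (auto intro: leI)
  then have "entry c c" using assms(2) j by (auto intro: entry_self)
  then obtain b' where b': "b' \<in> V \<union> Z" "reach E ?X c b'"
    using residual_to_E[OF cb(5,3,2)] by auto
  then have "reach E X c b'" by (auto elim: avoid_mono[rotated 2])
  moreover have "c \<in> range (\<lambda>i. u (n + i))"
    using j \<open>n \<le> j\<close> by (intro image_eqI[of _ _ "j - n"]) auto
  ultimately show "\<exists>a\<in>range (\<lambda>i. u (n + i)). \<exists>b\<in>V \<union> Z. a \<notin> X \<and> reach E X a b"
    using b'(1) cb(3) by blast
qed

text \<open>Augmentation of a flow along a walk that may be infinite: \<open>I\<close> is a finite
  initial segment of the natural numbers or all of them. A step back from \<open>u i\<close> to its
  \<open>F\<close>-predecessor cancels an arc instead of adding one, whence the condition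
  \<open>x \<noteq> u i\<close> in \<open>F1\<close>. New rays are of two kinds: those meeting the
  old linkage infinitely often are put into \<open>B\<close> by \<open>B_meet\<close>, those that
  finally run along \<open>u\<close> by \<open>B_tail\<close>.\<close>

lemma augment:
  fixes u :: "nat \<Rightarrow> 'a"
  assumes I: "0 \<in> I" "\<And>i. Suc i \<in> I \<Longrightarrow> i \<in> I"
    and u_inj: "inj_on u I"
    and u_step: "\<And>i. Suc i \<in> I \<Longrightarrow> (u i, u (Suc i)) \<in> residual"
    and u_start: "entry (u 0) y"
    and u_end: "\<And>i. i \<in> I \<Longrightarrow> Suc i \<notin> I \<Longrightarrow> u i \<in> W"
    and B_meet: "\<And>q q'. q \<in> rays E \<Longrightarrow> q' \<in> B \<Longrightarrow> q' \<in> rays E \<Longrightarrow> infinite (range q \<inter> range q') \<Longrightarrow> q \<in> B"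
    and B_tail: "\<And>q k n. I = UNIV \<Longrightarrow> q \<in> rays E \<Longrightarrow> (\<And>i. q (k + i) = u (n + i)) \<Longrightarrow>
      (\<And>i. i \<ge> n \<Longrightarrow> u i \<notin> V) \<Longrightarrow> q \<in> B"
  shows "\<exists>F'. linkage E W B (insert y Y) F'"
proof -
  let ?Y = "insert y Y"
  \<comment> \<open>the symmetric difference of \<open>F\<close> and the alternating walk \<open>u\<close>; it may contain components
    that are not reachable from the new set of starting vertices, which are dropped in \<open>F'\<close>\<close>
  define F1 where "F1 = {(a, b) \<in> F. a \<notin> u ` I} \<union>
    {(u i, x) |i x. Suc i \<in> I \<and> entry (u (Suc i)) x \<and> x \<noteq> u i}"
  have F1_cases: "(a, b) \<in> F \<and> a \<notin> u ` I \<or>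
      (\<exists>i. a = u i \<and> Suc i \<in> I \<and> entry (u (Suc i)) b \<and> b \<noteq> u i)" if "(a, b) \<in> F1" for a b
    using that by (auto simp: F1_def)
  have u_eq: "i = j" if "u i = u j" "i \<in> I" "j \<in> I" for i j
    using u_inj that by (auto dest: inj_onD)
  have F1_out: "b = b'" if "(a, b) \<in> F1" "(a, b') \<in> F1" for a b b'
    using F1_cases[OF that(1)]
  proof (elim disjE exE conjE)
    assume "(a, b) \<in> F" "a \<notin> u ` I"
    then show ?thesis using F1_cases[OF that(2)] out_eq I(2) by auto
  next
    fix i assume i: "a = u i" "Suc i \<in> I" "entry (u (Suc i)) b"
    then have "\<exists>j. a = u j \<and> Suc j \<in> I \<and> entry (u (Suc j)) b'"
      using F1_cases[OF that(2)] I(2) by auto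
    then obtain j where j: "a = u j" "Suc j \<in> I" "entry (u (Suc j)) b'" by auto
    then have "i = j" using i u_eq[of i j] I(2) by auto
    then show ?thesis using i j entry_unique by auto
  qed
  \<comment> \<open>An \<open>F\<close>-arc into a vertex entered by the walk has its tail on the
    walk, so it is not kept in \<open>F1\<close>.\<close>
  have F_entry: "a \<in> u ` I" if "(a, b) \<in> F" "entry (u i) b" "i \<in> I" for a b i
    using that entry_inj[of a b "u i"] by (auto simp: entry_def)
  have F1_in: "a = a'" if "(a, b) \<in> F1" "(a', b) \<in> F1" for a a' b
    using F1_cases[OF that(1)]
  proof (elim disjE exE conjE)
    assume a: "(a, b) \<in> F" "a \<notin> u ` I"
    then have "(a', b) \<in> F" using F1_cases[OF that(2)] F_entry[OF a(1)] by auto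
    then show ?thesis using a(1) in_eq by auto
  next
    fix i assume i: "a = u i" "Suc i \<in> I" "entry (u (Suc i)) b"
    then have "\<exists>j. a' = u j \<and> Suc j \<in> I \<and> entry (u (Suc j)) b"
      using F1_cases[OF that(2)] F_entry by auto
    then obtain j where j: "a' = u j" "Suc j \<in> I" "entry (u (Suc j)) b" by auto
    then have "Suc i = Suc j" using entry_inj[OF i(3) j(3)] u_eq[of "Suc i" "Suc j"] i(2) by auto
    then show ?thesis using i j by auto
  qed
  have F1_E: "F1 \<subseteq> E"
  proof safe
    fix a b assume "(a, b) \<in> F1"
    from F1_cases[OF this] show "(a, b) \<in> E"
    proof (elim disjE exE conjE)
      fix i assume *: "a = u i" "Suc i \<in> I" "entry (u (Suc i)) b" "b \<noteq> u i"
      obtain x where "entry (u (Suc i)) x" "(u i, x) \<in> E - F \<or> u i = x \<and> u (Suc i) \<in> V"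
        using u_step[OF *(2)] by (auto simp: residual_def)
      then show ?thesis using * entry_unique by auto
    qed (use F_E in auto)
  qed
  have F1_start: "(a, b) \<notin> F1" if b: "b \<in> ?Y" for a b
  proof
    assume "(a, b) \<in> F1"
    from F1_cases[OF this] show False
    proof (elim disjE exE conjE)
      assume ab: "(a, b) \<in> F" "a \<notin> u ` I"
      then have "b = y" using b Y_start by auto
      then show False using F_entry[OF ab(1), of 0] u_start I(1) ab(2) by auto
    next
      fix i assume i: "Suc i \<in> I" "entry (u (Suc i)) b"
      show False
      proof (cases "b \<in> Y")
        case True
        then show False using i(2) Y_V Y_start by (auto simp: entry_def)
      next
        case False
        then have "u (Suc i) = u 0" using b u_start i(2) entry_inj by auto
        then show False using u_eq[OF _ i(1) I(1)] by auto
      qed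
    qed
  qed
  define V1 where "V1 = F1\<^sup>* `` ?Y"
  define F' where "F' = {(a, b) \<in> F1. a \<in> V1}"
  have V': "F'\<^sup>* `` ?Y = V1" unfolding F'_def V1_def by (rule rtrancl_restrict_reachable)
  have start_or_in: "v \<in> ?Y \<or> (\<exists>a. (a, v) \<in> F1)" if "v \<in> V1" for v
    using that unfolding V1_def by (auto elim: rtranclE)
  have "linkage E W B ?Y F'"
  proof
    show "finite ?Y" using finite_Y by simp
    show "F' \<subseteq> E" using F1_E by (auto simp: F'_def)
    show "single_valued F'" "single_valued (F'\<inverse>)"
      using F1_out F1_in by (auto simp: single_valued_def F'_def)
    show "?Y \<inter> Range F' = {}" using F1_start by (auto simp: F'_def)
    show "Domain F' \<subseteq> F'\<^sup>* `` ?Y" unfolding V' by (auto simp: F'_def)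
  next
    fix v assume v: "v \<in> F'\<^sup>* `` ?Y" "v \<notin> Domain F'"
    have vV: "v \<in> V1" using v(1) V' by simp
    have "(v, b) \<in> F'" if "(v, b) \<in> F1" for b using that vV by (simp add: F'_def)
    then have no_out: "(v, b) \<notin> F1" for b using v(2) by blast
    show "v \<in> W"
    proof (cases "v \<in> u ` I")
      case False
      then have "v \<notin> Domain F" using no_out unfolding F1_def by blast
      moreover have "v \<in> V"
      proof (rule ccontr)
        assume nV: "v \<notin> V"
        from start_or_in[OF vV] show False
        proof (elim disjE exE)
          assume "v \<in> ?Y"
          then have "v = y" using nV Y_V by auto
          then have "v = u 0" using u_start nV F_V(2) unfolding entry_def by blast
          then show False using False I(1) by blast
        next
          fix a assume "(a, v) \<in> F1"
          from F1_cases[OF this] show False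
          proof (elim disjE exE conjE)
            fix i assume i: "Suc i \<in> I" "entry (u (Suc i)) v"
            then have "v = u (Suc i)" using nV F_V(2) unfolding entry_def by blast
            then show False using False i(1) by blast
          qed (use nV F_V(2) in blast)
        qed
      qed
      ultimately show ?thesis unfolding V_def by (rule ends_in_W[rotated])
    next
      case True
      then obtain i where i: "v = u i" "i \<in> I" by auto
      show ?thesis
      proof (cases "Suc i \<in> I")
        case False
        then show ?thesis using u_end i by auto
      next
        case True
        obtain x where x: "entry (u (Suc i)) x" "(u i, x) \<in> E - F \<or> u i = x \<and> u (Suc i) \<in> V"
          using u_step[OF True] by (auto simp: residual_def)
        \<comment> \<open>Otherwise the walk would give \<open>v\<close> an outgoing arc. So the
          walk steps back over \<open>v\<close>, which removes the arc into \<open>v\<close>, and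
          then \<open>v\<close> cannot be reached at all.\<close>
        have "x = u i"
        proof (rule ccontr)
          assume "x \<noteq> u i"
          then have "(v, x) \<in> F1" unfolding F1_def using x(1) i(1) True by blast
          then show False using no_out by blast
        qed
        then have ent: "entry (u (Suc i)) v" using x(1) i by simp
        from start_or_in[OF vV] have False
        proof (elim disjE exE)
          assume "v \<in> ?Y"
          show False
          proof (cases "v \<in> Y")
            case True
            then have "(u (Suc i), v) \<in> F" using ent Y_V unfolding entry_def by blast
            then show False using True Y_start by blast
          next
            case False
            then have "u (Suc i) = u 0" using \<open>v \<in> ?Y\<close> u_start ent entry_inj by auto
            then show False using u_eq[OF _ True I(1)] by auto
          qed
        next
          fix a assume "(a, v) \<in> F1"
          from F1_cases[OF this] show False
          proof (elim disjE exE conjE)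
            assume "(a, v) \<in> F" "a \<notin> u ` I"
            then show False using F_entry[OF _ ent True] by auto
          next
            fix j assume j: "a = u j" "Suc j \<in> I" "entry (u (Suc j)) v" "v \<noteq> u j"
            then have "Suc j = Suc i" using entry_inj[OF ent j(3)] u_eq[OF _ True j(2)] by auto
            then show False using j(4) i(1) by auto
          qed
        qed
        then show ?thesis ..
      qed
    qed
  next
    fix q assume q0: "q 0 \<in> ?Y" and "\<And>i. (q i, q (Suc i)) \<in> F'"
    then have arcs: "\<And>i. (q i, q (Suc i)) \<in> F1" by (auto simp: F'_def)
    have "single_valued (F1\<inverse>)" using F1_in unfolding single_valued_def by blast
    moreover have "q 0 \<notin> Range F1" using F1_start[OF q0] by blast
    ultimately have "inj q" using arcs by (rule chain_inj)
    then have q: "q \<in> rays E" using arcs F1_E by (auto simp: rays_def)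
    show "q \<in> B"
    proof (cases "infinite (range q \<inter> V)")
      case True
      then obtain q' where "q' \<in> B" "q' \<in> rays E" "infinite (range q \<inter> range q')"
        by (rule infinite_Int_V)
      then show ?thesis using B_meet[OF q] by blast
    next
      case False
      then have "finite (V \<inter> range q)" by (simp add: Int_commute)
      with \<open>inj q\<close> obtain k where k: "\<And>i. i \<ge> k \<Longrightarrow> q i \<notin> V"
        by (rule inj_eventually_notin) blast
      \<comment> \<open>Outside \<open>V\<close> only arcs added by the walk are left. Since
        \<open>u\<close> is injective, \<open>q\<close> runs through consecutive indices of
        \<open>u\<close>; as it never stops, \<open>I\<close> must be everything.\<close>
      have nxt: "\<exists>j. q i = u j \<and> Suc j \<in> I \<and> u (Suc j) = q (Suc i)" if "i \<ge> k" for i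
      proof -
        have "(q i, q (Suc i)) \<notin> F" using k[OF that] F_V by auto
        then obtain j where "q i = u j" "Suc j \<in> I" "entry (u (Suc j)) (q (Suc i))"
          using F1_cases[OF arcs, of i] by auto
        moreover have "q (Suc i) \<notin> V" using k that by auto
        ultimately show ?thesis using F_V by (auto simp: entry_def)
      qed
      from nxt[of k] obtain n where n: "q k = u n" "Suc n \<in> I" by auto
      have tail: "q (k + i) = u (n + i) \<and> n + i \<in> I" for i
      proof (induction i)
        case 0
        then show ?case using n I(2) by auto
      next
        case (Suc i)
        obtain j where j: "q (k + i) = u j" "Suc j \<in> I" "u (Suc j) = q (Suc (k + i))"
          using nxt[of "k + i"] by auto
        then have "j = n + i" using Suc u_eq I(2) by metis
        then show ?case using j by auto
      qed
      have down: "j \<in> I" if "i \<in> I" "j \<le> i" for i j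
        using that(2,1) by (induction rule: inc_induct) (use I(2) in blast)+
      have "i \<in> I" for i using down[of "n + i" i] tail[of i] by simp
      then have "I = UNIV" by blast
      moreover have "u i \<notin> V" if "i \<ge> n" for i
        using tail[of "i - n"] k[of "k + (i - n)"] that by auto
      ultimately show ?thesis using B_tail[of q k n] q tail by auto
    qed
  qed
  then show ?thesis by blast
qed

end

section \<open>A Menger theorem for rays\<close>

text \<open>The two alternatives correspond to the two kinds of half tracks. The ray has to start at
  \<open>z\<close> itself; \<open>esc_step\<close> shows for lower rays that reaching the start of
  such a ray suffices.\<close>

definition escapes :: "'a rel \<Rightarrow> 'a set \<Rightarrow> (nat \<Rightarrow> 'a) set \<Rightarrow> 'a set \<Rightarrow> 'a \<Rightarrow> bool" where
  "escapes E W B H z \<longleftrightarrow> z \<notin> H \<and>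
     ((\<exists>w \<in> W. reach E H z w) \<or>
      (\<exists>q \<in> B. q \<in> rays E \<and> q 0 = z \<and> range q \<inter> H = {}))"

lemma escapes_antimono: "escapes E W B H z \<Longrightarrow> H' \<subseteq> H \<Longrightarrow> escapes E W B H' z"
  unfolding escapes_def using avoid_mono[of E E H' H] by blast

lemma ray_avoid:
  assumes "q \<in> rays E" "range q \<inter> H = {}" "i \<le> j"
  shows "reach E H (q i) (q j)"
  using assms by (intro chain_avoid) (auto simp: rays_def)

text \<open>The set \<open>H\<close> built below has at most one vertex on each member of the
  linkage, so \<open>esc\<close> provides an escape from it, and this escape stays within residual
  reach. If it is a path, there is a finite alternating walk to its end. If it is a ray, the
  star-comb dichotomy yields a star, ruled out by \<open>no_star\<close>, or an infinite alternating
  walk, whose tails \<open>comb\<close> places in \<open>B\<close>.\<close>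

lemma (in linkage) extend:
  assumes y: "y \<notin> Y"
    and esc: "\<And>H. finite H \<Longrightarrow> card H \<le> card Y \<Longrightarrow> \<exists>z \<in> insert y Y. escapes E W B H z"
    and no_star: "\<And>q v. q \<in> B \<Longrightarrow> q \<in> rays E \<Longrightarrow> \<not> inf_linked E (E `` {v}) (range q)"
    and comb: "\<And>q t. q \<in> B \<Longrightarrow> q \<in> rays E \<Longrightarrow> t \<in> rays E \<Longrightarrow> inf_linked E (range t) (range q) \<Longrightarrow> t \<in> B"
  shows "\<exists>F'. linkage E W B (insert y Y) F'"
proof -
  have "\<exists>u0. entry u0 y" using V_pred[of y] y unfolding entry_def by blast
  then obtain u0 where u0: "entry u0 y" ..
  define N where "N = residual\<^sup>* `` {u0}"
  have u0_N: "u0 \<in> N" by (simp add: N_def)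
  have N_step: "b \<in> N" if "a \<in> N" "(a, b) \<in> residual" for a b
    using that unfolding N_def by (auto intro: rtrancl_into_rtrancl)
  have N_back: "h \<in> N" if "(h, z) \<in> F\<^sup>*" "z \<in> N" for h z
    using that by (induction rule: converse_rtrancl_induct) (auto intro: N_step residual_back)
  \<comment> \<open>\<open>N\<close> meets each path or ray of the linkage in an initial segment; \<open>H\<close> consists of the first
    vertices outside \<open>N\<close>. What starts in \<open>insert y Y\<close> and avoids \<open>H\<close> stays in \<open>N\<close>.\<close>
  define H where "H = {z \<in> V. z \<notin> N \<and> (z \<in> Y \<or> (\<exists>p \<in> N. (p, z) \<in> F))}"
  have "\<forall>z \<in> H. \<exists>x. x \<in> Y \<and> (x, z) \<in> F\<^sup>*" unfolding H_def V_def by blast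
  then obtain org where org: "\<And>z. z \<in> H \<Longrightarrow> org z \<in> Y \<and> (org z, z) \<in> F\<^sup>*" by metis
  have H_top: "z = z'" if "z \<in> H" "z' \<in> H" "(z, z') \<in> F\<^sup>*" for z z'
    using that(3)
  proof (cases rule: rtranclE)
    case (step p)
    then have "z' \<notin> Y" using Y_start by blast
    then have "p \<in> N" using that(2) step(2) in_eq unfolding H_def by blast
    then have "z \<in> N" using N_back step(1) by blast
    then show ?thesis using that(1) unfolding H_def by blast
  qed
  have "inj_on org H"
  proof (rule inj_onI)
    fix z z' assume *: "z \<in> H" "z' \<in> H" "org z = org z'"
    then have "(z, z') \<in> F\<^sup>* \<or> (z', z) \<in> F\<^sup>*"
      using single_valued_confluent[OF out_unique, of "org z" z z'] org[of z] org[of z'] by simp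
    then show "z = z'" using H_top * by blast
  qed
  moreover have "org ` H \<subseteq> Y" using org by blast
  ultimately have H: "finite H" "card H \<le> card Y"
    using finite_Y by (auto intro: card_inj_on_le inj_on_finite)
  have stay: "z \<in> N" if vz: "v \<in> N" "(v, z) \<in> E" "z \<notin> H" for v z
  proof (rule ccontr)
    assume zN: "z \<notin> N"
    show False
    proof (cases "(v, z) \<in> F")
      case True
      then show False using vz zN F_V unfolding H_def by blast
    next
      case False
      show False
      proof (cases "\<exists>p. entry p z")
        case True
        then obtain p where p: "entry p z" ..
        then have "p \<in> N" using residual_forward[of v z p] vz False N_step by blast
        moreover from this have "(p, z) \<in> F" using p zN unfolding entry_def by blast
        ultimately show False using vz(3) zN F_V unfolding H_def by blast
      next
        case False
        then have "z \<in> V" "z \<in> Y" using V_pred[of z] unfolding entry_def by blast+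
        then show False using vz(3) zN unfolding H_def by blast
      qed
    qed
  qed
  have start: "z \<in> N" if z: "z \<in> insert y Y" "z \<notin> H" for z
  proof (cases "z \<in> V")
    case True
    then have "z \<in> Y \<or> (u0, z) \<in> F" using z(1) u0 unfolding entry_def by blast
    then show ?thesis using True z(2) u0_N unfolding H_def by blast
  next
    case False
    then have "z = u0" using z(1) u0 Y_V F_V(2) unfolding entry_def by blast
    then show ?thesis using u0_N by simp
  qed
  have meet: "q \<in> B" if "q \<in> rays E" "q' \<in> B" "q' \<in> rays E" "infinite (range q \<inter> range q')" for q q'
    using comb[OF that(2,3,1)] inf_linked_self[OF that(4)] by blast
  obtain z where z: "z \<in> insert y Y" "escapes E W B H z" using esc[OF H] by blast
  then have zN: "z \<in> N" "z \<notin> H" using start unfolding escapes_def by blast+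
  have reach: "b \<in> N" if "reach E H a b" "a \<in> N" for a b
    using that by induction (auto intro: stay)
  from z(2) consider
      (path) w where "w \<in> W" "reach E H z w"
    | (ray) q where "q \<in> B" "q \<in> rays E" "q 0 = z" "range q \<inter> H = {}"
    unfolding escapes_def by blast
  then show ?thesis
  proof cases
    case path
    then have "(u0, w) \<in> residual\<^sup>*" using reach zN unfolding N_def by blast
    then obtain u n where u: "u 0 = u0" "u n = w" "inj_on u {..n}"
      "\<And>i. i < n \<Longrightarrow> (u i, u (Suc i)) \<in> residual"
      by (rule simple_path) blast
    show ?thesis
    proof (rule augment[of "{..n}" u y])
      show "u i \<in> W" if "i \<in> {..n}" "Suc i \<notin> {..n}" for i
        using that u(2) path(1) by (cases "i = n") auto
      show "q \<in> B" if "{..n} = UNIV" for q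
        using that finite_atMost[of n] infinite_UNIV_nat by simp
      show "entry (u 0) y" using u(1) u0 by simp
      show "q \<in> B" if "q \<in> rays E" "q' \<in> B" "q' \<in> rays E" "infinite (range q \<inter> range q')" for q q'
        using that by (rule meet)
    qed (use u(3,4) in simp_all)
  next
    case (ray q)
    have q_N: "range q \<subseteq> N"
      using reach[OF ray_avoid[OF ray(2,4), of 0]] zN ray(3) by auto
    have "infinite (range q)" using ray(2) by (intro inj_infinite_range rays_inj)
    from star_comb[OF this q_N[unfolded N_def]] show ?thesis
    proof (elim disjE bexE conjE)
      fix v assume "inf_linked residual (residual `` {v}) (range q)"
      then have "inf_linked residual (residual `` {v}) (V \<union> range q)" by (rule inf_linked_mono) auto
      then have "inf_linked E (E `` {v}) (V \<union> range q)" by (rule residual_star)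
      then have "inf_linked E (E `` {v}) V"
        using no_star[OF ray(1,2)] inf_linked_Un_right by blast
      then show ?thesis using inf_linked_V no_star by metis
    next
      fix u assume u: "u \<in> rays residual" "u 0 = u0" "inf_linked residual (range u) (range q)"
      then have lu: "inf_linked residual (range u) (V \<union> range q)" by (elim inf_linked_mono) auto
      show ?thesis
      proof (rule augment[of UNIV u y])
        show "t \<in> B" if t: "t \<in> rays E" "\<And>i. t (k + i) = u (n + i)" "\<And>i. n \<le> i \<Longrightarrow> u i \<notin> V"
          for t k n
        proof -
          have sub: "range (\<lambda>i. u (n + i)) \<subseteq> range t" using t(2) by (metis image_subsetI rangeI)
          have "inf_linked E (range (\<lambda>i. u (n + i))) (V \<union> range q)"
            using lu t(3) by (rule residual_comb)
          then have "inf_linked E (range t) (V \<union> range q)" using sub by (elim inf_linked_mono) auto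
          then consider "inf_linked E (range t) V" | "inf_linked E (range t) (range q)"
            using inf_linked_Un_right by blast
          then show ?thesis
          proof cases
            case 1
            then obtain q' where "q' \<in> B" "q' \<in> rays E" "inf_linked E (range t) (range q')"
              by (rule inf_linked_V)
            then show ?thesis using comb t(1) by blast
          qed (use comb ray t(1) in blast)
        qed
        show "entry (u 0) y" using u(2) u0 by simp
        show "q \<in> B" if "q \<in> rays E" "q' \<in> B" "q' \<in> rays E" "infinite (range q \<inter> range q')" for q q'
          using that by (rule meet)
      qed (use u(1) in \<open>simp_all add: rays_def\<close>)
    qed
  qed
qed

text \<open>Starts are added one at a time. Removing the arcs that leave \<open>W\<close> stops each
  path at its first vertex of \<open>W\<close>, and it makes stars harmless: by \<open>star\<close>
  their centres lie in \<open>W\<close> and then have no arcs left.\<close>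

theorem ray_menger:
  assumes Y: "finite Y"
    and esc: "\<And>H. finite H \<Longrightarrow> card H < card Y \<Longrightarrow> \<exists>y \<in> Y. escapes E W B H y"
    and star: "\<And>q v. q \<in> B \<Longrightarrow> q \<in> rays E \<Longrightarrow> inf_linked E (E `` {v}) (range q) \<Longrightarrow> v \<in> W"
    and comb: "\<And>q t. q \<in> B \<Longrightarrow> q \<in> rays E \<Longrightarrow> t \<in> rays E \<Longrightarrow> inf_linked E (range t) (range q) \<Longrightarrow> t \<in> B"
  shows "\<exists>F. linkage {(u, v) \<in> E. u \<notin> W} W B Y F"
proof -
  let ?E = "{(u, v) \<in> E. u \<notin> W}"
  have sub: "?E \<subseteq> E" by auto
  have to_W: "\<exists>w \<in> W. reach ?E H z w" if "reach E H z w" "w \<in> W" for z w H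
    using that
  proof (induction rule: converse_rtrancl_induct)
    case (step a b)
    then obtain w' where w': "w' \<in> W" "reach ?E H b w'" by blast
    show ?case
    proof (cases "a \<in> W")
      case False
      then have "(a, b) \<in> avoid ?E H" using step(1) by auto
      then show ?thesis using w' by (meson converse_rtrancl_into_rtrancl)
    qed blast
  qed blast
  have trim: "escapes ?E W B H z" if z: "escapes E W B H z" for z H
  proof -
    from z consider
        (path) w where "w \<in> W" "reach E H z w"
      | (ray) q where "q \<in> B" "q \<in> rays E" "q 0 = z" "range q \<inter> H = {}"
      unfolding escapes_def by blast
    then show ?thesis
    proof cases
      case path
      then show ?thesis using to_W[OF path(2,1)] z unfolding escapes_def by blast
    next
      case (ray q)
      show ?thesis
      proof (cases "\<exists>i. q i \<in> W")
        case True
        then obtain i where i: "q i \<in> W" ..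
        have "reach E H z (q i)" using ray_avoid[OF ray(2,4), of 0 i] ray(3) by simp
        then show ?thesis using to_W[OF _ i] z unfolding escapes_def by blast
      next
        case False
        then have "q \<in> rays ?E" using ray(2) by (simp add: rays_def)
        then show ?thesis using ray z unfolding escapes_def by blast
      qed
    qed
  qed
  have "\<exists>F. linkage ?E W B Y' F" if "Y' \<subseteq> Y" for Y'
    using finite_subset[OF that Y] that
  proof (induction rule: finite_induct)
    case empty
    have "linkage ?E W B {} {}" by standard auto
    then show ?case ..
  next
    case (insert y Y')
    then obtain F where "linkage ?E W B Y' F" by blast
    then interpret linkage ?E W B Y' F .
    show ?case
    proof (rule extend)
      show "y \<notin> Y'" by fact
      show "\<exists>z\<in>insert y Y'. escapes ?E W B H z" if H: "finite H" "card H \<le> card Y'" for H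
      proof -
        \<comment> \<open>The starts not yet treated are blocked by adding them to \<open>H\<close>,
          which keeps its size below \<open>card Y\<close>; the escape must then start in
          \<open>insert y Y'\<close>.\<close>
        have fin: "finite (Y - insert y Y')" using Y by simp
        have "card (Y - insert y Y') = card Y - Suc (card Y')"
          using insert Y by (subst card_Diff_subset) auto
        moreover have "Suc (card Y') \<le> card Y"
          using card_mono[OF Y insert.prems] insert.hyps by simp
        moreover have "card (H \<union> (Y - insert y Y')) \<le> card H + card (Y - insert y Y')"
          by (rule card_Un_le)
        ultimately have "card (H \<union> (Y - insert y Y')) < card Y" using H(2) by linarith
        then obtain z where "z \<in> Y" "escapes E W B (H \<union> (Y - insert y Y')) z"
          using esc[of "H \<union> (Y - insert y Y')"] H(1) fin by blast
        then have "z \<in> insert y Y'" unfolding escapes_def by blast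
        moreover have "escapes E W B H z"
          by (rule escapes_antimono) (use \<open>escapes E W B (H \<union> (Y - insert y Y')) z\<close> in auto)
        ultimately have "z \<in> insert y Y'" "escapes E W B H z" by auto
        then show ?thesis using trim by blast
      qed
    next
      fix q v assume q: "q \<in> B" "q \<in> rays ?E"
      show "\<not> inf_linked ?E (?E `` {v}) (range q)"
      proof
        assume *: "inf_linked ?E (?E `` {v}) (range q)"
        then have "inf_linked E (E `` {v}) (range q)" by (rule inf_linked_mono) auto
        then have "v \<in> W" using star q(1) rays_mono[OF sub q(2)] by blast
        then have "?E `` {v} = {}" by auto
        from *[unfolded this] show False by simp
      qed
    next
      fix q t assume q: "q \<in> B" "q \<in> rays ?E" "t \<in> rays ?E" "inf_linked ?E (range t) (range q)"
      from q(4) have "inf_linked E (range t) (range q)" by (rule inf_linked_mono) auto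
      then show "t \<in> B" using comb q(1) rays_mono[OF sub q(2)] rays_mono[OF sub q(3)] by blast
    qed
  qed
  then show ?thesis by blast
qed

section \<open>Rays in an end and separators\<close>

lemma finite_meeting:
  assumes "pairwise (\<lambda>S T. disjnt (V S) (V T)) \<T>" "finite X"
  shows "finite {T \<in> \<T>. V T \<inter> X \<noteq> {}}"
proof -
  define g where "g T = (SOME x. x \<in> V T \<inter> X)" for T
  have g: "g T \<in> V T \<inter> X" if "V T \<inter> X \<noteq> {}" for T
    unfolding g_def by (rule someI_ex) (use that in blast)
  have "inj_on g {T \<in> \<T>. V T \<inter> X \<noteq> {}}"
  proof (rule inj_onI)
    fix S T assume *: "S \<in> {T \<in> \<T>. V T \<inter> X \<noteq> {}}" "T \<in> {T \<in> \<T>. V T \<inter> X \<noteq> {}}" "g S = g T"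
    then have "\<not> disjnt (V S) (V T)" using g[of S] g[of T] by (auto simp: disjnt_def)
    then show "S = T" using assms(1) * unfolding pairwise_def by blast
  qed
  moreover have "g ` {T \<in> \<T>. V T \<inter> X \<noteq> {}} \<subseteq> X" using g by blast
  ultimately show ?thesis using assms(2) by (meson finite_imageD finite_subset)
qed

lemma limit_ray:
  assumes p0: "p 0 \<noteq> []"
    and ext: "\<And>k. \<exists>r. r \<noteq> [] \<and> p (Suc k) = p k @ r"
    and dist: "\<And>k. distinct (p k)"
    and succ: "\<And>k. successively (\<lambda>a b. (a, b) \<in> \<rho>) (p k)"
  obtains u where "u \<in> rays \<rho>" "u 0 = hd (p 0)" "\<And>k. set (p k) \<subseteq> range u"
proof -
  have len: "k < length (p k)" for k
  proof (induction k)
    case (Suc k)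
    obtain r where "r \<noteq> []" "p (Suc k) = p k @ r" using ext by blast
    then show ?case using Suc by (cases r) auto
  qed (use p0 in simp)
  have ext': "\<exists>r. p (k + d) = p k @ r" for k d
  proof (induction d)
    case (Suc d)
    then obtain r where "p (k + d) = p k @ r" by blast
    moreover obtain r' where "p (Suc (k + d)) = p (k + d) @ r'" using ext by blast
    ultimately show ?case by simp
  qed simp
  define u where "u i = p i ! i" for i
  have u: "u i = p k ! i" if "i < length (p k)" for i k
  proof (cases "i \<le> k")
    case True
    then obtain r where "p k = p i @ r" using ext'[of i "k - i"] by auto
    then show ?thesis using len[of i] by (simp add: u_def nth_append)
  next
    case False
    then obtain r where "p i = p k @ r" using ext'[of k "i - k"] by auto
    then show ?thesis using that by (simp add: u_def nth_append)
  qed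
  have "inj u"
  proof (rule injI)
    fix i j assume "u i = u j"
    moreover define k where "k = max i j"
    moreover have "i < length (p k)" "j < length (p k)" using len[of k] by (auto simp: k_def)
    ultimately show "i = j" using dist[of k] u by (metis nth_eq_iff_index_eq)
  qed
  moreover have "(u i, u (Suc i)) \<in> \<rho>" for i
  proof -
    have "Suc i < length (p (Suc i))" by (rule len)
    moreover have "u i = p (Suc i) ! i" using len[of "Suc i"] by (intro u) simp
    moreover have "u (Suc i) = p (Suc i) ! Suc i" using len[of "Suc i"] by (rule u)
    ultimately show ?thesis using succ[of "Suc i"] unfolding successively_conv_nth by auto
  qed
  moreover have "u 0 = hd (p 0)" using p0 by (simp add: u_def hd_conv_nth)
  moreover have "set (p k) \<subseteq> range u" for k
    unfolding set_conv_nth using u by (auto simp: image_iff) metis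
  ultimately show ?thesis using that[of u] unfolding rays_def by blast
qed

lemma inf_linked_trans:
  assumes "inf_linked E A (range r)" "inf_linked E (range r) C" "r \<in> rays E"
  shows "inf_linked E A C"
  using inf_linked_trans_out[OF assms(1,2)] assms(3) unfolding rays_def by blast

locale base_ray =
  fixes E :: "'a rel" and R :: "nat \<Rightarrow> 'a"
  assumes R: "R \<in> rays E"
begin

text \<open>
  If \<open>R\<close> belongs to the end \<open>\<omega>\<close>, then \<open>own_rays\<close> are the out-rays in \<open>\<omega>\<close>, \<open>lower_rays\<close> are those in
  the ends strictly below \<open>\<omega>\<close>, and \<open>dominators\<close> are the \<open>\<omega>\<close>-out-dominating vertices.
\<close>

definition dominators :: "'a set" where
  "dominators = {v. inf_linked E (E `` {v}) (range R)}"

definition lower_rays :: "(nat \<Rightarrow> 'a) set" where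
  "lower_rays = {q \<in> rays E. inf_linked E (range q) (range R) \<and> \<not> inf_linked E (range R) (range q)}"

definition own_rays :: "(nat \<Rightarrow> 'a) set" where
  "own_rays = {q \<in> rays E. inf_linked E (range q) (range R) \<and> inf_linked E (range R) (range q)}"

abbreviation esc :: "'a set \<Rightarrow> 'a \<Rightarrow> bool" where
  "esc \<equiv> escapes E dominators lower_rays"

lemma R_own: "R \<in> own_rays"
  using R inf_linked_self[of "range R" "range R"] infinite_ray[OF R]
  by (simp add: own_rays_def)

text \<open>Infinitely many common vertices link two rays in both directions, so the rays have the
  same links to and from \<open>R\<close>.\<close>

lemma lower_meet:
  assumes "q \<in> lower_rays" "t \<in> rays E" "infinite (range t \<inter> range q)"
  shows "t \<in> lower_rays"
proof -
  have tq: "inf_linked E (range t) (range q)" using assms(3) by (rule inf_linked_self)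
  have q: "q \<in> rays E" "inf_linked E (range q) (range R)" "\<not> inf_linked E (range R) (range q)"
    using assms(1) by (auto simp: lower_rays_def)
  have "inf_linked E (range t) (range R)" using inf_linked_trans[OF tq q(2,1)] .
  moreover have "\<not> inf_linked E (range R) (range t)"
    using inf_linked_trans[OF _ tq assms(2)] q(3) by blast
  ultimately show ?thesis using assms(2) by (simp add: lower_rays_def)
qed

lemma own_meet:
  assumes "q \<in> own_rays" "t \<in> rays E" "infinite (range t \<inter> range q)"
  shows "t \<in> own_rays"
proof -
  have tq: "inf_linked E (range t) (range q)" using assms(3) by (rule inf_linked_self)
  have qt: "inf_linked E (range q) (range t)" using assms(3) by (intro inf_linked_self) (simp add: Int_commute)
  have q: "q \<in> rays E" "inf_linked E (range q) (range R)" "inf_linked E (range R) (range q)"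
    using assms(1) by (auto simp: own_rays_def)
  show ?thesis
    using inf_linked_trans[OF tq q(2,1)] inf_linked_trans[OF q(3) qt q(1)] assms(2)
    by (simp add: own_rays_def)
qed

text \<open>Prepending \<open>a\<close> to a ray fails if \<open>a\<close> already lies on it; then
  the tail from \<open>a\<close> is used. Either ray shares infinitely many vertices with the old
  one and so stays lower.\<close>

lemma esc_step:
  assumes "(a, b) \<in> E" "a \<notin> S" "esc S b"
  shows "esc S a"
proof -
  from assms(3) have b: "b \<notin> S" by (simp add: escapes_def)
  from assms(3) consider
      (path) w where "w \<in> dominators" "reach E S b w"
    | (ray) q where "q \<in> lower_rays" "q \<in> rays E" "q 0 = b" "range q \<inter> S = {}"
    unfolding escapes_def by blast
  then show ?thesis
  proof cases
    case path
    have "(a, b) \<in> avoid E S" using assms b by simp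
    then have "reach E S a w" using path(2) by (rule converse_rtrancl_into_rtrancl)
    then show ?thesis using path(1) assms(2) unfolding escapes_def by blast
  next
    case (ray q)
    show ?thesis
    proof (cases "a \<in> range q")
      case True
      then obtain k where k: "a = q k" by blast
      let ?t = "\<lambda>i. q (k + i)"
      have t: "?t \<in> rays E" using ray(2) by (rule rays_tail)
      have "range ?t \<inter> range q = range ?t" by auto
      then have "?t \<in> lower_rays"
        using lower_meet[OF ray(1) t] infinite_ray[OF t] by simp
      moreover have "range ?t \<inter> S = {}" using ray(4) by auto
      ultimately show ?thesis
        unfolding escapes_def using t assms(2) k by (auto intro!: bexI[of _ ?t])
    next
      case False
      let ?t = "\<lambda>i. case i of 0 \<Rightarrow> a | Suc j \<Rightarrow> q j"
      have inj: "inj ?t" using False rays_inj[OF ray(2)] by (auto simp: inj_def split: nat.splits)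
      have t: "?t \<in> rays E"
        using inj assms(1) ray(2,3) by (auto simp: rays_def split: nat.splits)
      have rt: "range ?t = insert a (range q)"
        by (auto simp: image_iff split: nat.splits)
      then have "range ?t \<inter> range q = range q" by auto
      then have "?t \<in> lower_rays"
        using lower_meet[OF ray(1) t] infinite_ray[OF ray(2)] by simp
      moreover have "range ?t \<inter> S = {}" using ray(4) rt assms(2) by auto
      ultimately show ?thesis
        unfolding escapes_def using t assms(2) by (auto intro!: bexI[of _ ?t])
    qed
  qed
qed

lemma esc_back: "reach E S a b \<Longrightarrow> esc S b \<Longrightarrow> esc S a"
  by (induction rule: converse_rtrancl_induct) (auto intro: esc_step)

text \<open>From far out on \<open>q\<close> one gets to \<open>R\<close> beyond the last vertex of
  \<open>S\<close>, and then along \<open>R\<close> to a later vertex that escapes. With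
  \<open>infinite_escapes_all\<close> as the converse, separation can be tested on any single ray of
  the end.\<close>

lemma infinite_esc:
  assumes S: "finite S" and inf: "infinite {i. esc S (R i)}" and q: "q \<in> own_rays"
  shows "infinite {i. esc S (q i)}"
  unfolding infinite_nat_iff_unbounded
proof
  fix m
  have "finite (S \<inter> range R)" using S by simp
  then obtain n where n: "\<And>i. i \<ge> n \<Longrightarrow> R i \<notin> S"
    using inj_eventually_notin[OF rays_inj[OF R]] by blast
  have "inf_linked E (range q) (range R)" using q by (simp add: own_rays_def)
  moreover have "finite (S \<union> R ` {..n})" using S by simp
  ultimately obtain i b where ib: "m < i" "b \<in> range R" "q i \<notin> S \<union> R ` {..n}" "b \<notin> S \<union> R ` {..n}"
    "reach E (S \<union> R ` {..n}) (q i) b"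
    by (rule inf_linked_rayE)
  obtain j where j: "b = R j" using ib(2) by blast
  have "n < j" using ib(4) j by (auto intro: leI simp: not_le[symmetric])
  obtain k where k: "k > j" "esc S (R k)" using inf unfolding infinite_nat_iff_unbounded by blast
  have "reach E S (R j) (R k)"
    using n \<open>n < j\<close> k(1) R by (intro chain_avoid) (auto simp: rays_def)
  then have "esc S b" using esc_back k(2) j by blast
  moreover have "reach E S (q i) b" using ib(5) by (rule avoid_mono[rotated 2]) auto
  ultimately have "esc S (q i)" using esc_back by blast
  then show "\<exists>i>m. i \<in> {i. esc S (q i)}" using ib(1) by blast
qed

end

section \<open>Ears of a finite family of disjoint rays in the end\<close>

lemma not_inf_linkedE:
  assumes "\<not> inf_linked E A B"
  obtains X where "finite X" "\<And>a b. a \<in> A \<Longrightarrow> b \<in> B \<Longrightarrow> a \<notin> X \<Longrightarrow> \<not> reach E X a b"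
  using assms unfolding inf_linked_def by blast

text \<open>With \<open>W = {}\<close> no orbit can stop, so the linkage consists of disjoint
  out-rays of the end, one for each vertex of \<open>Y\<close>.\<close>

locale end_linkage =
  base_ray E R + linkage E "{}" "base_ray.own_rays E R" Y F for E :: "'a rel" and R Y F +
  assumes Y_ne: "Y \<noteq> {}"
begin

definition orb :: "'a \<Rightarrow> nat \<Rightarrow> 'a" where
  "orb y = (SOME q. q 0 = y \<and> (\<forall>i. (q i, q (Suc i)) \<in> F) \<and> F\<^sup>* `` {y} = range q)"

lemma orb:
  assumes "y \<in> Y"
  shows "orb y 0 = y" "(orb y i, orb y (Suc i)) \<in> F" "range (orb y) = F\<^sup>* `` {y}"
    "orb y \<in> rays E" "orb y \<in> own_rays"
proof -
  have "\<exists>q. q 0 = y \<and> (\<forall>i. (q i, q (Suc i)) \<in> F) \<and> F\<^sup>* `` {y} = range q"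
    using assms by (cases rule: orbit_cases) auto
  then have *: "orb y 0 = y \<and> (\<forall>i. (orb y i, orb y (Suc i)) \<in> F) \<and> F\<^sup>* `` {y} = range (orb y)"
    unfolding orb_def by (rule someI_ex)
  then show "orb y 0 = y" "(orb y i, orb y (Suc i)) \<in> F" "range (orb y) = F\<^sup>* `` {y}" by auto
  show "orb y \<in> rays E" "orb y \<in> own_rays" using chain_ray[of "orb y"] * assms by auto
qed

lemma V_orb: "V = (\<Union>y\<in>Y. range (orb y))"
  unfolding V_orbits using orb(3) by auto

lemma own_linked: "q \<in> own_rays \<Longrightarrow> q' \<in> own_rays \<Longrightarrow> inf_linked E (range q) (range q')"
  using inf_linked_trans[OF _ _ R, of "range q" "range q'"] by (simp add: own_rays_def)

text \<open>This and the next two lemmas let \<open>V\<close> stand in for \<open>R\<close>: it is a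
  finite nonempty union of rays equivalent to \<open>R\<close>.\<close>

lemma linked_V: "inf_linked E A (range R) \<Longrightarrow> inf_linked E A V"
proof -
  assume *: "inf_linked E A (range R)"
  obtain y where y: "y \<in> Y" using Y_ne by blast
  have "inf_linked E A (range (orb y))"
    using inf_linked_trans[OF * own_linked[OF R_own orb(5)[OF y]] R] .
  then show ?thesis by (rule inf_linked_mono) (use y V_orb in auto)
qed

lemma linked_R: "inf_linked E A V \<Longrightarrow> inf_linked E A (range R)"
proof -
  assume "inf_linked E A V"
  then obtain q where "q \<in> own_rays" "q \<in> rays E" "inf_linked E A (range q)" by (rule inf_linked_V)
  then show ?thesis using inf_linked_trans own_linked[OF _ R_own] by blast
qed

lemma R_linked: "inf_linked E V A \<Longrightarrow> inf_linked E (range R) A"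
proof -
  assume "inf_linked E V A"
  then obtain y where y: "y \<in> Y" "inf_linked E (range (orb y)) A"
    unfolding V_orb using inf_linked_UN_left[OF finite_Y] by blast
  then show ?thesis using inf_linked_trans own_linked[OF R_own] orb(4,5) by blast
qed

text \<open>
  An ear with start \<open>x\<close> is the vertex set of a path from \<open>x\<close> to a dominating vertex or of a lower
  ray from \<open>x\<close>. Both are finitely separable from the linkage in the direction towards the ear, and
  both allow a return to the linkage that avoids any given finite set missing the rest of the ear.
\<close>

definition ear :: "'a \<Rightarrow> 'a set \<Rightarrow> bool" where
  "ear x T \<longleftrightarrow> T \<inter> V = {x} \<and> (\<forall>u \<in> T. (x, u) \<in> (E \<inter> T \<times> T)\<^sup>*) \<and> \<not> inf_linked E V T \<and>
     (\<forall>u \<in> T. \<forall>X. finite X \<longrightarrow> X \<inter> T \<subseteq> {x} \<longrightarrow>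
        (\<exists>c b. (u, c) \<in> E \<and> c \<notin> X \<and> b \<in> V \<and> reach E X c b))"

lemma earD:
  assumes "ear x T"
  shows "T \<inter> V = {x}" "u \<in> T \<Longrightarrow> (x, u) \<in> (E \<inter> T \<times> T)\<^sup>*" "\<not> inf_linked E V T"
  using assms unfolding ear_def by blast+

lemma ear_start: "ear x T \<Longrightarrow> x \<in> T \<and> x \<in> V"
  unfolding ear_def by blast

lemma ear_returns:
  assumes "ear x T" "u \<in> T" "finite X" "X \<inter> T \<subseteq> {x}"
  obtains c b where "(u, c) \<in> E" "c \<notin> X" "b \<in> V" "reach E X c b"
  using assms unfolding ear_def by blast

lemma ear_avoid: "ear x T \<Longrightarrow> u \<in> T \<Longrightarrow> T \<inter> X = {} \<Longrightarrow> reach E X x u"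
proof -
  assume "ear x T" "u \<in> T" and TX: "T \<inter> X = {}"
  then have "(x, u) \<in> (E \<inter> T \<times> T)\<^sup>*" unfolding ear_def by blast
  moreover have "E \<inter> T \<times> T \<subseteq> avoid E X" using TX by (auto simp: avoid_def)
  ultimately show ?thesis using rtrancl_mono by blast
qed

lemma dominator_returns:
  assumes "w \<in> dominators" "finite X"
  obtains c b where "(w, c) \<in> E" "c \<notin> X" "b \<in> V" "reach E X c b"
proof -
  have "inf_linked E (E `` {w}) V" using assms(1) linked_V unfolding dominators_def by blast
  then obtain c b where "c \<in> E `` {w}" "b \<in> V" "c \<notin> X" "b \<notin> X" "reach E X c b"
    using assms(2) by (rule inf_linkedE)
  then show ?thesis using that by blast
qed

text \<open>The ear begins at the last vertex of the path in \<open>V\<close>. Being finite, it is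
  separable from \<open>V\<close>; the way back follows the rest of the path and leaves through its
  dominating end.\<close>

lemma path_ear:
  fixes f :: "nat \<Rightarrow> 'a"
  assumes inj: "inj_on f {..n}" and arcs: "\<And>i. i < n \<Longrightarrow> (f i, f (Suc i)) \<in> E"
    and f0: "f 0 \<in> V" and w: "f n \<in> dominators"
  shows "\<exists>x T. ear x T \<and> T \<subseteq> f ` {..n}"
proof -
  have "finite {i. i \<le> n \<and> f i \<in> V}" by simp
  then obtain k where "k \<le> n \<and> f k \<in> V" "\<And>j. k < j \<Longrightarrow> \<not> (j \<le> n \<and> f j \<in> V)"
    by (rule last_index[of _ 0]) (use f0 in auto)
  then have k: "k \<le> n" "f k \<in> V" and later: "\<And>j. k < j \<Longrightarrow> j \<le> n \<Longrightarrow> f j \<notin> V" by auto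
  define T where "T = f ` {k..n}"
  have ne: "f (Suc j) \<noteq> f k" if "k \<le> j" "j < n" for j
    using inj_onD[OF inj, of "Suc j" k] that by auto
  have "ear (f k) T"
    unfolding ear_def
  proof (intro conjI ballI allI impI)
    show "T \<inter> V = {f k}"
    proof
      show "T \<inter> V \<subseteq> {f k}"
      proof
        fix v assume "v \<in> T \<inter> V"
        then obtain j where "k \<le> j" "j \<le> n" "v = f j" "f j \<in> V" unfolding T_def by auto
        then show "v \<in> {f k}" using later[of j] by (cases "j = k") auto
      qed
      show "{f k} \<subseteq> T \<inter> V" using k by (auto simp: T_def)
    qed
    show "\<not> inf_linked E V T" by (rule not_inf_linked_finite) (simp add: T_def)
  next
    fix u assume "u \<in> T"
    then obtain j where j: "k \<le> j" "j \<le> n" "u = f j" unfolding T_def by auto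
    show "(f k, u) \<in> (E \<inter> T \<times> T)\<^sup>*"
      unfolding j(3) using j(1,2) arcs by (intro chain_rtrancl) (auto simp: T_def)
    fix X assume X: "finite X" "X \<inter> T \<subseteq> {f k}"
    obtain c b where cb: "(f n, c) \<in> E" "c \<notin> X" "b \<in> V" "reach E X c b"
      using w X(1) by (rule dominator_returns)
    show "\<exists>c b. (u, c) \<in> E \<and> c \<notin> X \<and> b \<in> V \<and> reach E X c b"
    proof (cases "j = n")
      case True
      then show ?thesis using cb j(3) by blast
    next
      case False
      then have "j < n" using j(2) by simp
      have nX: "f i \<notin> X" if "j < i" "i \<le> n" for i
        using ne[of "i - 1"] X(2) j(1) that unfolding T_def by force
      have "reach E X (f (Suc j)) (f n)"
        using \<open>j < n\<close> by (intro chain_rtrancl) (simp_all add: arcs nX)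
      moreover have "(f n, c) \<in> avoid E X" using cb nX[of n] \<open>j < n\<close> by simp
      ultimately have "reach E X (f (Suc j)) b" using cb(4) by (meson converse_rtrancl_into_rtrancl rtrancl_trans)
      then show ?thesis using arcs[OF \<open>j < n\<close>] nX[of "Suc j"] \<open>j < n\<close> j(3) cb(3) by (meson Suc_leI lessI)
    qed
  qed
  moreover have "T \<subseteq> f ` {..n}" by (auto simp: T_def)
  ultimately show ?thesis by blast
qed

text \<open>If \<open>q\<close> met \<open>V\<close> infinitely often, \<open>R\<close> would be
  linked to it, against \<open>q\<close> being lower. So there is a last vertex in \<open>V\<close>,
  and the ear begins there.\<close>

lemma ray_ear:
  assumes q: "q \<in> lower_rays" "q 0 \<in> V"
  shows "\<exists>x T. ear x T \<and> T \<subseteq> range q"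
proof -
  have qr: "q \<in> rays E" and qR: "inf_linked E (range q) (range R)" and
    Rq: "\<not> inf_linked E (range R) (range q)"
    using q(1) by (auto simp: lower_rays_def)
  have "finite (V \<inter> range q)"
  proof (rule ccontr)
    assume "infinite (V \<inter> range q)"
    then show False using R_linked[OF inf_linked_self] Rq by blast
  qed
  then obtain m where m: "\<And>i. i \<ge> m \<Longrightarrow> q i \<notin> V"
    using inj_eventually_notin[OF rays_inj[OF qr]] by blast
  have "finite {i. q i \<in> V}"
    by (rule finite_subset[of _ "{..m}"]) (use m in \<open>auto intro: leI simp: not_le[symmetric]\<close>)
  then obtain k where k: "q k \<in> V" and later: "\<And>j. k < j \<Longrightarrow> q j \<notin> V"
    using q(2) by (rule last_index) blast
  define T where "T = q ` {k..}"
  have "ear (q k) T"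
    unfolding ear_def
  proof (intro conjI ballI allI impI)
    show "T \<inter> V = {q k}"
    proof
      show "T \<inter> V \<subseteq> {q k}"
      proof
        fix v assume "v \<in> T \<inter> V"
        then obtain j where "k \<le> j" "v = q j" "q j \<in> V" unfolding T_def by auto
        then show "v \<in> {q k}" using later[of j] by (cases "j = k") auto
      qed
      show "{q k} \<subseteq> T \<inter> V" using k by (auto simp: T_def)
    qed
    show "\<not> inf_linked E V T"
    proof
      assume "inf_linked E V T"
      then have "inf_linked E (range R) T" by (rule R_linked)
      then have "inf_linked E (range R) (range q)" by (rule inf_linked_mono) (auto simp: T_def)
      then show False using Rq by blast
    qed
  next
    fix u assume "u \<in> T"
    then obtain j where j: "k \<le> j" "u = q j" unfolding T_def by auto
    show "(q k, u) \<in> (E \<inter> T \<times> T)\<^sup>*"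
      unfolding j(2) using j(1) rays_arc[OF qr] by (intro chain_rtrancl) (auto simp: T_def)
    fix X assume X: "finite X" "X \<inter> T \<subseteq> {q k}"
    have "inf_linked E (range q) V" using qR by (rule linked_V)
    then obtain l b where lb: "j < l" "b \<in> V" "q l \<notin> X" "b \<notin> X" "reach E X (q l) b"
      using X(1) by (rule inf_linked_rayE)
    have nX: "q i \<notin> X" if "j < i" for i
    proof
      assume "q i \<in> X"
      then have "q i = q k" using X(2) j(1) that unfolding T_def by force
      then show False using rays_inj[OF qr] j(1) that by (auto dest: injD)
    qed
    have "reach E X (q (Suc j)) (q l)"
      using lb(1) by (intro chain_rtrancl) (simp_all add: rays_arc[OF qr] nX)
    then have "reach E X (q (Suc j)) b" using lb(5) by simp
    then show "\<exists>c b. (u, c) \<in> E \<and> c \<notin> X \<and> b \<in> V \<and> reach E X c b"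
      using rays_arc[OF qr, of j] nX[of "Suc j"] j(2) lb(2) by blast
  qed
  moreover have "T \<subseteq> range q" by (auto simp: T_def)
  ultimately show ?thesis by blast
qed

lemma ear_exists:
  assumes S: "finite S" and inf: "infinite {i. esc S (R i)}"
  shows "\<exists>x T. ear x T \<and> T \<inter> S = {}"
proof -
  obtain y where y: "y \<in> Y" using Y_ne by blast
  have "infinite {i. esc S (orb y i)}" using infinite_esc[OF S inf orb(5)[OF y]] .
  from not_finite_existsD[OF this] obtain j where j: "esc S (orb y j)" ..
  have V: "orb y j \<in> V" using V_orb y by blast
  from j consider
      (path) w where "w \<in> dominators" "reach E S (orb y j) w"
    | (ray) q where "q \<in> lower_rays" "q 0 = orb y j" "range q \<inter> S = {}"
    unfolding escapes_def by blast
  then show ?thesis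
  proof cases
    case path
    from path(2) obtain f n where f: "f 0 = orb y j" "f n = w" "inj_on f {..n}"
      "\<And>i. i < n \<Longrightarrow> (f i, f (Suc i)) \<in> avoid E S"
      by (rule simple_path) blast
    have "\<exists>x T. ear x T \<and> T \<subseteq> f ` {..n}"
      using f V path(1) by (intro path_ear) auto
    moreover have "f i \<notin> S" if "i \<le> n" for i
      using f(4)[of i] f(2) that j avoid_notin[OF path(2)] unfolding escapes_def
      by (cases "i = n") auto
    ultimately show ?thesis by blast
  next
    case (ray q)
    then have "\<exists>x T. ear x T \<and> T \<subseteq> range q" using ray_ear[of q] V by simp
    then show ?thesis using ray(3) by blast
  qed
qed

text \<open>Each earlier ear has a finite separator from \<open>V\<close>. A new ear that avoids all
  these separators cannot meet an earlier one, since it would carry a path from its start in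
  \<open>V\<close> to that ear.\<close>

lemma disjoint_ears:
  assumes sep: "\<And>S. finite S \<Longrightarrow> infinite {i. esc S (R i)}"
  shows "\<exists>\<T>. infinite \<T> \<and> pairwise disjnt \<T> \<and> (\<forall>T \<in> \<T>. \<exists>x. ear x T)"
proof -
  have "\<exists>P \<subseteq> {T. \<exists>x. ear x T}. infinite P \<and> pairwise disjnt P"
  proof (rule infinite_pairwise)
    fix P assume P: "finite P" "P \<subseteq> {T. \<exists>x. ear x T}"
    have "\<forall>T \<in> P. \<exists>X. finite X \<and> (\<forall>a \<in> V. \<forall>b \<in> T. a \<notin> X \<longrightarrow> \<not> reach E X a b)"
    proof
      fix T assume "T \<in> P"
      then have "\<not> inf_linked E V T" using P(2) earD(3) by blast
      then show "\<exists>X. finite X \<and> (\<forall>a \<in> V. \<forall>b \<in> T. a \<notin> X \<longrightarrow> \<not> reach E X a b)"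
        by (rule not_inf_linkedE) blast
    qed
    from bchoice[OF this] obtain X where
      "\<forall>T\<in>P. finite (X T) \<and> (\<forall>a\<in>V. \<forall>b\<in>T. a \<notin> X T \<longrightarrow> \<not> reach E (X T) a b)" ..
    then have X: "\<And>T. T \<in> P \<Longrightarrow> finite (X T)"
      "\<And>T a b. T \<in> P \<Longrightarrow> a \<in> V \<Longrightarrow> b \<in> T \<Longrightarrow> a \<notin> X T \<Longrightarrow> \<not> reach E (X T) a b"
      by simp_all
    have "finite (\<Union>T\<in>P. X T)" using P(1) X(1) by blast
    from ear_exists[OF this sep[OF this]] obtain x T where T: "ear x T" "T \<inter> (\<Union>T\<in>P. X T) = {}"
      by blast
    have "disjnt T T'" if T': "T' \<in> P" for T'
    proof (rule ccontr)
      assume "\<not> disjnt T T'"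
      then obtain u where u: "u \<in> T" "u \<in> T'" by (auto simp: disjnt_def)
      have "T \<inter> X T' = {}" using T(2) T' by blast
      then have "reach E (X T') x u" "x \<notin> X T'"
        using ear_avoid[OF T(1) u(1)] ear_start[OF T(1)] by blast+
      then show False using X(2)[OF T' _ u(2)] ear_start[OF T(1)] by blast
    qed
    moreover from this have "T \<notin> P" using ear_start[OF T(1)] by (auto simp: disjnt_def)
    ultimately show "\<exists>p\<in>{T. \<exists>x. ear x T} - P. \<forall>q\<in>P. disjnt p q \<and> disjnt q p"
      using T(1) by (auto simp: disjnt_sym intro!: bexI[of _ T])
  qed
  then show ?thesis by blast
qed

lemma residual_in: "y \<in> Y \<Longrightarrow> (orb y (Suc i), orb y i) \<in> residual"
  using residual_back orb(2) by blast

lemma residual_trans: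
  assumes "y \<in> Y" "inf_linked residual A (range (orb y))" "inf_linked residual (range (orb y)) C"
  shows "inf_linked residual A C"
  using inf_linked_trans_in[OF assms(2,3)] rays_inj[OF orb(4)[OF assms(1)]] residual_in[OF assms(1)]
  by blast

lemma residual_linked:
  assumes "y \<in> Y" "y' \<in> Y"
  shows "inf_linked residual (range (orb y)) (range (orb y'))"
proof (rule ccontr)
  assume no: "\<not> ?thesis"
  \<comment> \<open>In \<open>residual\<close> the rays of the linkage are traversed backwards, so being linked is transitive
    through them. If \<open>I\<close> were not everything, a path from a ray in \<open>I\<close> to a ray outside \<open>I\<close> contains
    a segment without inner vertices in \<open>V\<close>, which is also a residual path.\<close>
  define I where "I = {l \<in> Y. inf_linked residual (range (orb y)) (range (orb l))}"
  have inf_orb: "infinite (range (orb l))" if "l \<in> Y" for l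
    using inj_infinite_range[OF rays_inj[OF orb(4)[OF that]]] .
  have "inf_linked residual (range (orb y)) (range (orb y))"
    by (rule inf_linked_self) (use inf_orb[OF assms(1)] in simp)
  then have yI: "y \<in> I" using assms(1) by (simp add: I_def)
  have y'I: "y' \<in> Y - I" using assms(2) no by (simp add: I_def)
  define P where "P = (\<Union>l\<in>I. range (orb l))"
  define Q where "Q = (\<Union>l\<in>Y - I. range (orb l))"
  have finI: "finite I" "finite (Y - I)" using finite_Y by (auto simp: I_def)
  have PQ: "P \<inter> Q = {}"
  proof (rule ccontr)
    assume "P \<inter> Q \<noteq> {}"
    then obtain v l l' where l: "l \<in> I" "l' \<in> Y - I" "v \<in> range (orb l)" "v \<in> range (orb l')"
      unfolding P_def Q_def by blast
    then have lY: "l \<in> Y" "l' \<in> Y" by (auto simp: I_def)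
    have "l = l'" using l(3,4) orb(3) lY by (intro orbit_disjoint[OF lY, of v]) auto
    then show False using l by blast
  qed
  have V_PQ: "V = P \<union> Q" unfolding V_orb P_def Q_def I_def by blast
  have "\<not> inf_linked residual P Q"
  proof
    assume "inf_linked residual P Q"
    then obtain l where l: "l \<in> I" "inf_linked residual (range (orb l)) Q"
      unfolding P_def using inf_linked_UN_left[OF finI(1)] by blast
    then obtain l' where l': "l' \<in> Y - I" "inf_linked residual (range (orb l)) (range (orb l'))"
      unfolding Q_def using inf_linked_UN_right[OF finI(2)] by blast
    then show False using l residual_trans[of l "range (orb y)" "range (orb l')"] unfolding I_def by blast
  qed
  then obtain X0 where X0: "finite X0"
    "\<And>a b. a \<in> P \<Longrightarrow> b \<in> Q \<Longrightarrow> a \<notin> X0 \<Longrightarrow> \<not> reach residual X0 a b"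
    by (rule not_inf_linkedE) blast
  \<comment> \<open>Avoiding \<open>Y\<close> ensures that an entered vertex of \<open>Q\<close> has
    an \<open>F\<close>-predecessor; avoiding the \<open>F\<close>-successors of \<open>X0\<close>
    keeps this predecessor off \<open>X0\<close>.\<close>
  let ?X = "X0 \<union> F `` X0 \<union> Y"
  have finX: "finite ?X" using X0(1) finite_Y finite_Image_single_valued[OF X0(1) out_unique] by blast
  have "inf_linked E (range (orb y)) (range (orb y'))" using own_linked orb(5) assms by blast
  then have "inf_linked E P Q"
    by (rule inf_linked_mono) (use yI y'I in \<open>auto simp: P_def Q_def\<close>)
  then obtain a b where ab: "a \<in> P" "b \<in> Q" "a \<notin> ?X" "b \<notin> ?X" "reach E ?X a b"
    using finX by (rule inf_linkedE)
  from ab(5,3) have "a \<in> Q \<or> a \<notin> V \<and> (\<exists>b' \<in> Q. reach residual X0 a b')"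
  proof (induction rule: converse_rtrancl_induct)
    case base
    then show ?case using ab(2) by blast
  next
    case (step a a1)
    have aX: "a \<notin> X0" "a1 \<notin> ?X" "(a, a1) \<in> E" using step(1) by auto
    show ?case
    proof (rule ccontr)
      assume neg: "\<not> ?case"
      then have aQ: "a \<notin> Q" by blast
      have "\<exists>c b'. b' \<in> Q \<and> (a, c) \<in> residual \<and> c \<notin> X0 \<and> reach residual X0 c b'"
        using step.IH[OF aX(2)]
      proof (elim disjE conjE bexE)
        assume "a1 \<in> Q"
        then obtain l m where l: "l \<in> Y - I" "a1 = orb l m" unfolding Q_def by blast
        then have "m \<noteq> 0" using aX(2) orb(1)[of l] by (cases m) auto
        then obtain m' where m': "m = Suc m'" by (cases m) auto
        have arc: "(orb l m', a1) \<in> F" using orb(2)[of l m'] l m' by simp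
        have cQ: "orb l m' \<in> Q" using l(1) unfolding Q_def by blast
        have "(a, a1) \<notin> F" using in_eq[OF _ arc] aQ cQ by blast
        then have "(a, orb l m') \<in> residual"
          using aX(3) arc by (intro residual_forward) (auto simp: entry_def)
        moreover have "orb l m' \<notin> X0" using arc aX(2) by blast
        ultimately show ?thesis using cQ by blast
      next
        fix b' assume b': "a1 \<notin> V" "b' \<in> Q" "reach residual X0 a1 b'"
        have "(a, a1) \<in> E - F" using aX(3) b'(1) F_V(2) by blast
        then have "(a, a1) \<in> residual" using entry_self[OF b'(1)] by (rule residual_forward)
        then show ?thesis using b' aX(2) by blast
      qed
      then obtain c b' where c: "b' \<in> Q" "(a, c) \<in> residual" "c \<notin> X0" "reach residual X0 c b'"
        by blast
      have "(a, c) \<in> avoid residual X0" using c aX by simp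
      then have "reach residual X0 a b'" using c(4) by (rule converse_rtrancl_into_rtrancl)
      then show False using neg c(1) X0(2)[of a b'] aX(1) V_PQ by blast
    qed
  qed
  then show False using ab(1) PQ V_PQ by blast
qed

end

context end_linkage
begin

text \<open>One leg of the infinite alternating walk: \<open>X\<close> holds the vertices used so
  far and \<open>v\<close> is the current vertex on the ear \<open>T\<close>. The walk leaves
  \<open>T\<close> by its way back to the linkage, turns back along the ray it enters, and goes on
  to the start of another ear.\<close>

lemma ear_step:
  assumes inf: "infinite \<T>" and disj: "pairwise disjnt \<T>" and ears: "\<And>T. T \<in> \<T> \<Longrightarrow> \<exists>x. ear x T"
    and T: "T \<in> \<T>" "v \<in> T" and X: "finite X" "X \<inter> T = {}"
  obtains x' T' where "T' \<in> \<T>" "ear x' T'" "T' \<inter> X = {}" "T' \<noteq> T" "reach residual X v x'"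
proof -
  obtain x where x: "ear x T" using ears T(1) by blast
  define \<T>' where "\<T>' = {S \<in> \<T>. S \<inter> X = {} \<and> S \<noteq> T}"
  define st where "st S = (SOME x. ear x S)" for S
  have st: "ear (st S) S" if "S \<in> \<T>" for S
    unfolding st_def by (rule someI_ex) (rule ears[OF that])
  have "\<T> \<subseteq> \<T>' \<union> ({S \<in> \<T>. S \<inter> X \<noteq> {}} \<union> {T})" by (auto simp: \<T>'_def)
  then have inf': "infinite \<T>'"
    using inf finite_meeting[OF disj X(1)] by (meson finite.emptyI finite.insertI finite_UnI finite_subset)
  have "inj_on st \<T>'"
  proof (rule inj_onI)
    fix S S' assume S: "S \<in> \<T>'" "S' \<in> \<T>'" "st S = st S'"
    then have "S \<in> \<T>" "S' \<in> \<T>" by (simp_all add: \<T>'_def)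
    moreover from this have "st S \<in> S" "st S' \<in> S'" using ear_start[OF st] by blast+
    ultimately show "S = S'" using disj S(3) unfolding pairwise_def disjnt_def by (metis IntI emptyE)
  qed
  then have infZ: "infinite (st ` \<T>')" using inf' by (simp add: finite_image_iff)
  have "st S \<in> V" if "S \<in> \<T>'" for S
    using ear_start[OF st[of S]] that by (simp add: \<T>'_def)
  then have "st ` \<T>' \<subseteq> V" by blast
  then have "st ` \<T>' \<subseteq> (\<Union>y\<in>Y. st ` \<T>' \<inter> range (orb y))" unfolding V_orb by blast
  then have "infinite (\<Union>y\<in>Y. st ` \<T>' \<inter> range (orb y))" using infZ finite_subset by blast
  \<comment> \<open>Infinitely many starts of ears lie on one of the finitely many rays, and by
    \<open>residual_linked\<close> every ray of the linkage leads there.\<close>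
  then obtain y' where y': "y' \<in> Y" "infinite (st ` \<T>' \<inter> range (orb y'))" using finite_Y by (meson finite_UN)
  have "inf_linked residual (range (orb y')) (st ` \<T>')"
    by (rule inf_linked_self) (use y'(2) in \<open>simp add: Int_commute\<close>)
  then have Z: "inf_linked residual (range (orb y)) (st ` \<T>')" if "y \<in> Y" for y
    by (rule residual_trans[OF y'(1) residual_linked[OF that y'(1)]])
  \<comment> \<open>The continuation from each ray of the linkage to a new ear is chosen first. The ear \<open>T\<close> is
    then left so that it returns to the linkage only beyond the starts of these continuations.\<close>
  have "\<exists>b z. z \<in> st ` \<T>' \<and> (\<forall>i\<ge>b. orb y i \<notin> X) \<and> reach residual X (orb y b) z" if y: "y \<in> Y" for y
  proof -
    have "finite (X \<inter> range (orb y))" using X(1) by simp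
    then obtain n where n: "\<And>i. i \<ge> n \<Longrightarrow> orb y i \<notin> X"
      using inj_eventually_notin[OF rays_inj[OF orb(4)[OF y]]] by blast
    from Z[OF y] X(1) obtain b z where "n < b" "z \<in> st ` \<T>'" "orb y b \<notin> X" "z \<notin> X"
      "reach residual X (orb y b) z"
      by (rule inf_linked_rayE)
    moreover from this(1) have "\<forall>i\<ge>b. orb y i \<notin> X" using n by simp
    ultimately show ?thesis by blast
  qed
  then have "\<forall>y \<in> Y. \<exists>b. \<exists>z \<in> st ` \<T>'. (\<forall>i\<ge>b. orb y i \<notin> X) \<and> reach residual X (orb y b) z"
    by blast
  from bchoice[OF this] obtain b where b:
    "\<forall>y\<in>Y. \<exists>z \<in> st ` \<T>'. (\<forall>i\<ge>b y. orb y i \<notin> X) \<and> reach residual X (orb y (b y)) z" ..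
  have "x \<in> V" using ear_start[OF x] by simp
  then obtain yx a where yx: "yx \<in> Y" "x = orb yx a" unfolding V_orb by blast
  define N where "N = Max (insert a (b ` Y))"
  have N: "a \<le> N" "\<And>y. y \<in> Y \<Longrightarrow> b y \<le> N" using finite_Y by (auto simp: N_def)
  \<comment> \<open>Entering \<open>orb y (Suc n)\<close> makes \<open>orb y n\<close> available:
    the bound \<open>Suc N\<close> puts it beyond \<open>b y\<close>, and avoiding the
    \<open>F\<close>-successors of \<open>X\<close> keeps it off \<open>X\<close>. Since
    \<open>a \<le> N\<close>, the way back cannot begin with the linkage arc that leaves
    \<open>x\<close>.\<close>
  let ?X = "X \<union> F `` X \<union> (\<Union>y\<in>Y. orb y ` {..Suc N})"
  have finX: "finite ?X"
    using X(1) finite_Y finite_Image_single_valued[OF X(1) out_unique] by simp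
  have "?X \<inter> T \<subseteq> {x}"
  proof
    fix u assume u: "u \<in> ?X \<inter> T"
    then have "u \<in> V" using X(2) F_V(2) V_orb by blast
    then show "u \<in> {x}" using u earD(1)[OF x] by blast
  qed
  with x T(2) finX obtain c e where ce: "(v, c) \<in> E" "c \<notin> ?X" "e \<in> V" "reach E ?X c e"
    by (rule ear_returns)
  from ce(4,2) have "\<exists>y\<in>Y. \<exists>n. orb y (Suc n) \<notin> ?X \<and>
      (c = orb y (Suc n) \<or> c \<notin> V \<and> reach residual X c (orb y n))"
  proof (induction rule: converse_rtrancl_induct)
    case base
    from ce(3) obtain y m where m: "y \<in> Y" "e = orb y m" unfolding V_orb by blast
    then have "m \<noteq> 0" using base by (cases m) auto
    then show ?case using m base by (metis not0_implies_Suc)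
  next
    case (step c c1)
    have c: "c \<notin> ?X" "c1 \<notin> ?X" "(c, c1) \<in> E" using step(1) by auto
    show ?case
    proof (cases "c \<in> V")
      case True
      then obtain y m where m: "y \<in> Y" "c = orb y m" unfolding V_orb by blast
      then have "m \<noteq> 0" using c(1) by (cases m) auto
      then show ?thesis using m c(1) by (metis not0_implies_Suc)
    next
      case False
      obtain y n where y: "y \<in> Y" "orb y (Suc n) \<notin> ?X"
        "c1 = orb y (Suc n) \<or> c1 \<notin> V \<and> reach residual X c1 (orb y n)"
        using step.IH[OF c(2)] by blast
      have cF: "(c, c1) \<in> E - F" using c(3) False F_V(1) by blast
      have "reach residual X c (orb y n)"
      proof (cases "c1 \<in> V")
        case True
        then have arc: "(orb y n, c1) \<in> F" using y orb(2) by blast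
        then have "(c, orb y n) \<in> residual" using cF by (intro residual_forward) (auto simp: entry_def)
        moreover have "orb y n \<notin> X" using arc c(2) by blast
        ultimately show ?thesis using c(1) by auto
      next
        case False
        then have "(c, c1) \<in> residual" by (intro residual_forward[OF cF] entry_self)
        then have "(c, c1) \<in> avoid residual X" using c by simp
        moreover have "reach residual X c1 (orb y n)" using y(3,1) False V_orb by blast
        ultimately show ?thesis by (rule converse_rtrancl_into_rtrancl)
      qed
      then show ?thesis using y False by blast
    qed
  qed
  then obtain y n where y: "y \<in> Y" "orb y (Suc n) \<notin> ?X"
    "c = orb y (Suc n) \<or> c \<notin> V \<and> reach residual X c (orb y n)" by blast
  have vX: "v \<notin> X" using X(2) T(2) by blast
  have vc: "(v, c) \<in> E - F"
  proof (rule DiffI[OF ce(1)], rule)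
    assume vcF: "(v, c) \<in> F"
    then have "v = x" using earD(1)[OF x] T(2) F_V(1) by blast
    then have "c = orb yx (Suc a)" using out_eq vcF orb(2)[OF yx(1)] yx(2) by blast
    then have "c \<in> ?X" using N(1) yx(1) by blast
    then show False using ce(2) by blast
  qed
  have "reach residual X v (orb y n)"
  proof (cases "c \<in> V")
    case True
    then have c: "c = orb y (Suc n)" using y(3) by blast
    have "(v, orb y n) \<in> residual"
      using vc c orb(2)[OF y(1), of n] by (intro residual_forward) (auto simp: entry_def)
    moreover have "orb y n \<notin> X" using y(1,2) orb(2)[OF y(1), of n] by blast
    ultimately show ?thesis using vX by auto
  next
    case False
    then have "(v, c) \<in> residual" by (intro residual_forward[OF vc] entry_self)
    then have "(v, c) \<in> avoid residual X" using vX ce(2) by simp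
    moreover have "reach residual X c (orb y n)" using y(1,3) False V_orb by blast
    ultimately show ?thesis by (rule converse_rtrancl_into_rtrancl)
  qed
  moreover obtain z where z: "z \<in> st ` \<T>'" "\<forall>i\<ge>b y. orb y i \<notin> X" "reach residual X (orb y (b y)) z"
    using b y(1) by blast
  have "Suc N < Suc n" using y(1,2) by (auto intro: leI simp: not_le[symmetric])
  then have "b y \<le> n" using N(2)[OF y(1)] by simp
  then have "(orb y (b y), orb y n) \<in> ((avoid residual X)\<inverse>)\<^sup>*"
    using z(2) by (intro chain_rtrancl) (simp_all add: residual_in[OF y(1)])
  then have "reach residual X (orb y n) (orb y (b y))" by (simp add: rtrancl_converse)
  ultimately have path: "reach residual X v z" using z(3) by (meson rtrancl_trans)
  from z(1) obtain S where S: "S \<in> \<T>'" "z = st S" by blast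
  then have "S \<in> \<T>" "S \<inter> X = {}" "S \<noteq> T" by (simp_all add: \<T>'_def)
  then show ?thesis using that[of S z] st S(2) path by blast
qed

text \<open>A state is a finite simple residual path together with the ear on which it ends. It
  meets this ear only in its last vertex, which lets \<open>ear_step\<close> continue while avoiding
  all earlier vertices. Each new ear misses the whole path so far, so the ears are pairwise
  distinct.\<close>

lemma ear_visiting_ray:
  assumes inf: "infinite \<T>" and disj: "pairwise disjnt \<T>" and ears: "\<And>T. T \<in> \<T> \<Longrightarrow> \<exists>x. ear x T"
    and T1: "T1 \<in> \<T>" "u0 \<in> T1"
  obtains u where "u \<in> rays residual" "u 0 = u0" "infinite {T \<in> \<T>. T \<inter> range u \<noteq> {}}"
proof -
  define inv where "inv = (\<lambda>(p, T). p \<noteq> [] \<and> distinct p \<and> successively (\<lambda>a b. (a, b) \<in> residual) p \<and>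
    T \<in> \<T> \<and> last p \<in> T \<and> set (butlast p) \<inter> T = {})"
  define stp where "stp = (\<lambda>(p :: 'a list, T :: 'a set) (p', T' :: 'a set). (\<exists>r. r \<noteq> [] \<and> p' = p @ r) \<and> T' \<inter> set p = {})"
  have "inv ([u0], T1)" using T1 by (simp add: inv_def)
  moreover have "\<exists>s'. inv s' \<and> stp s s'" if "inv s" for s
  proof -
    obtain p T where s: "s = (p, T)" by (cases s)
    have p: "p \<noteq> []" "distinct p" "successively (\<lambda>a b. (a, b) \<in> residual) p" "T \<in> \<T>" "last p \<in> T"
      "set (butlast p) \<inter> T = {}"
      using that unfolding s inv_def by simp_all
    let ?X = "set (butlast p)"
    have p_eq: "p = butlast p @ [last p]" using p(1) by simp
    have set_p: "set p = insert (last p) ?X" by (subst p_eq) auto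
    obtain x' T' where x': "T' \<in> \<T>" "ear x' T'" "T' \<inter> ?X = {}" "T' \<noteq> T"
      "reach residual ?X (last p) x'"
      by (rule ear_step[OF inf disj ears p(4,5) finite_set p(6)])
    from x'(5) obtain f n where f: "f 0 = last p" "f n = x'" "inj_on f {..n}"
      "\<And>i. i < n \<Longrightarrow> (f i, f (Suc i)) \<in> avoid residual ?X"
      by (rule simple_path) blast
    \<comment> \<open>Stopping at the first vertex on the new ear, possibly before its start
      \<open>x'\<close>, restores the invariant.\<close>
    define m where "m = (LEAST i. f i \<in> T')"
    have fn: "f n \<in> T'" using ear_start[OF x'(2)] f(2) by simp
    then have m: "f m \<in> T'" "m \<le> n" unfolding m_def by (rule LeastI, rule Least_le)
    have less: "f i \<notin> T'" if "i < m" for i using not_less_Least that unfolding m_def by blast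
    have lT': "last p \<notin> T'" using p(4,5) x'(1,4) disj unfolding pairwise_def disjnt_def by blast
    then have "m \<noteq> 0" using m(1) f(1) by (cases m) auto
    define r where "r = map f [1..<Suc m]"
    have r_ne: "r \<noteq> []" using \<open>m \<noteq> 0\<close> by (simp add: r_def)
    have set_r: "set r = f ` {1..m}" unfolding r_def by (auto simp: atLeastLessThanSuc_atLeastAtMost)
    have last_r: "last r = f m" using \<open>m \<noteq> 0\<close> by (simp add: r_def)
    have butlast_r: "set (butlast r) = f ` {1..<m}" using \<open>m \<noteq> 0\<close> by (simp add: r_def)
    have "inj_on f (set [1..<Suc m])" by (rule inj_on_subset[OF f(3)]) (use m(2) in auto)
    then have dr: "distinct r" by (simp add: r_def distinct_map del: upt_Suc)
    have disj_r: "set p \<inter> set r = {}"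
    proof -
      have "f i \<notin> ?X" "f i \<noteq> last p" if i: "1 \<le> i" "i \<le> m" for i
      proof -
        show "f i \<notin> ?X" using f(4)[of "i - 1"] i m(2) by simp
        show "f i \<noteq> last p" using inj_onD[OF f(3), of i 0] i m(2) f(1) by auto
      qed
      then show ?thesis unfolding set_p set_r by fastforce
    qed
    have succ_r: "successively (\<lambda>a b. (a, b) \<in> residual) r"
      unfolding successively_conv_nth
    proof (intro allI impI)
      fix i assume "Suc i < length r"
      then have i: "Suc i < m" by (simp add: r_def del: upt_Suc)
      then have "r ! i = f (Suc i)" "r ! Suc i = f (Suc (Suc i))"
        by (simp_all add: r_def del: upt_Suc)
      then show "(r ! i, r ! Suc i) \<in> residual" using f(4)[of "Suc i"] i m(2) by simp
    qed
    have "(last p, hd r) \<in> residual"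
      using f(4)[of 0] f(1) m(2) \<open>m \<noteq> 0\<close> by (simp add: r_def hd_map del: upt_Suc)
    then have "successively (\<lambda>a b. (a, b) \<in> residual) (p @ r)"
      using p(3) succ_r by (simp add: successively_append_iff)
    moreover have pT': "set p \<inter> T' = {}" using x'(3) lT' unfolding set_p by blast
    moreover have "set (butlast r) \<inter> T' = {}" unfolding butlast_r using less by fastforce
    moreover have "set (butlast (p @ r)) = set p \<union> set (butlast r)"
      using r_ne by (simp add: butlast_append)
    ultimately have "inv (p @ r, T')"
      unfolding inv_def using p(1,2) r_ne dr disj_r x'(1) m(1) last_r
      by (simp add: Int_Un_distrib2)
    moreover have "stp s (p @ r, T')"
      unfolding stp_def s using r_ne pT' by (simp add: Int_commute)
    ultimately show ?thesis by blast
  qed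
  ultimately have "\<exists>f. f 0 = ([u0], T1) \<and> (\<forall>n. inv (f n) \<and> stp (f n) (f (Suc n)))"
    using dependent_nat_choice[of "\<lambda>n s. inv s \<and> (n = 0 \<longrightarrow> s = ([u0], T1))" "\<lambda>n. stp"] by auto
  then obtain f where f: "f 0 = ([u0], T1)" "\<And>n. inv (f n)" "\<And>n. stp (f n) (f (Suc n))" by blast
  define p where "p n = fst (f n)" for n
  define \<tau> where "\<tau> n = snd (f n)" for n
  have f_eq: "f n = (p n, \<tau> n)" for n by (simp add: p_def \<tau>_def)
  have p: "p n \<noteq> []" "distinct (p n)" "successively (\<lambda>a b. (a, b) \<in> residual) (p n)" "\<tau> n \<in> \<T>" "last (p n) \<in> \<tau> n" for n
    using f(2)[of n] unfolding f_eq inv_def by simp_all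
  have ext: "\<exists>r. r \<noteq> [] \<and> p (Suc n) = p n @ r" and new: "\<tau> (Suc n) \<inter> set (p n) = {}" for n
    using f(3)[of n] unfolding f_eq stp_def by simp_all
  obtain u where u: "u \<in> rays residual" "u 0 = hd (p 0)" "\<And>k. set (p k) \<subseteq> range u"
    using limit_ray[of p residual] p(1)[of 0] ext p(2,3) by blast
  have mono: "set (p i) \<subseteq> set (p j)" if "i \<le> j" for i j
    using that
  proof (induction j rule: dec_induct)
    case (step j)
    obtain r where "p (Suc j) = p j @ r" using ext by blast
    then show ?case using step by auto
  qed simp
  have "\<tau> i \<noteq> \<tau> j" if "i < j" for i j
  proof
    assume eq: "\<tau> i = \<tau> j"
    obtain k where k: "j = Suc k" using \<open>i < j\<close> by (cases j) auto
    then have "last (p i) \<in> set (p k)" using mono[of i k] that p(1)[of i] by auto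
    then show False using new[of k] p(5)[of i] eq k by blast
  qed
  then have "inj \<tau>" by (metis linorder_injI)
  then have "infinite (range \<tau>)" by (rule inj_infinite_range)
  moreover have "range \<tau> \<subseteq> {T \<in> \<T>. T \<inter> range u \<noteq> {}}"
  proof
    fix T assume "T \<in> range \<tau>"
    then obtain n where n: "T = \<tau> n" by blast
    have "last (p n) \<in> T \<inter> range u" using p(1,5)[of n] u(3)[of n] n by auto
    then show "T \<in> {T \<in> \<T>. T \<inter> range u \<noteq> {}}" using p(4)[of n] n by blast
  qed
  ultimately have "infinite {T \<in> \<T>. T \<inter> range u \<noteq> {}}" using finite_subset by blast
  moreover have "u 0 = u0" using u(2) f(1) by (simp add: p_def)
  ultimately show ?thesis using that u(1) by blast
qed

text \<open>The ray through \<open>x1\<close> is cut behind \<open>x1\<close>: its tail from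
  \<open>y\<close> gets a start of its own, and the part up to \<open>x1\<close> is freed to
  continue along the alternating walk. A ray that finally follows this walk meets infinitely many
  ears; their ways back link it to \<open>V\<close>, and the paths inside the ears link
  \<open>V\<close> to it.\<close>

theorem more_rays:
  assumes sep: "\<And>S. finite S \<Longrightarrow> infinite {i. esc S (R i)}"
  shows "\<exists>y F'. y \<notin> Y \<and> linkage E {} own_rays (insert y Y) F'"
proof -
  obtain \<T> where \<T>: "infinite \<T>" "pairwise disjnt \<T>" "\<And>T. T \<in> \<T> \<Longrightarrow> \<exists>x. ear x T"
    using disjoint_ears[OF sep] by blast
  obtain T1 where T1: "T1 \<in> \<T>" using \<T>(1) by fastforce
  obtain x1 where x1: "ear x1 T1" using \<T>(3) T1 by blast
  obtain u where u: "u \<in> rays residual" "u 0 = x1" "infinite {T \<in> \<T>. T \<inter> range u \<noteq> {}}"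
    using ear_visiting_ray[OF \<T> T1] ear_start[OF x1] by blast
  obtain y1 m where "y1 \<in> Y" "x1 = orb y1 m" using ear_start[OF x1] unfolding V_orb by blast
  then obtain y where y: "(x1, y) \<in> F" using orb(2) by blast
  have "y \<notin> Y" using y Y_start by blast
  moreover have "\<exists>F'. linkage E {} own_rays (insert y Y) F'"
  proof (rule augment[of UNIV u y])
    show "entry (u 0) y" using y u(2) by (simp add: entry_def)
    show "q \<in> own_rays" if "q \<in> rays E" "q' \<in> own_rays" "infinite (range q \<inter> range q')" for q q'
      using own_meet that by blast
    show "q \<in> own_rays" if q: "q \<in> rays E" "\<And>i. q (k + i) = u (n + i)" "\<And>i. n \<le> i \<Longrightarrow> u i \<notin> V" for q k n
    proof -
      \<comment> \<open>Only finitely many ears meet \<open>X\<close> or the part of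
        \<open>u\<close> up to \<open>n\<close>, so some ear avoids these and is met by
        \<open>u\<close> at a later index, where \<open>u\<close> runs along
        \<open>q\<close>.\<close>
      have fresh: "\<exists>T v x. ear x T \<and> v \<in> T \<and> v \<in> range q \<and> T \<inter> X = {}" if X: "finite X" for X
      proof -
        have fin: "finite (X \<union> u ` {..n})" using X by simp
        have "{T \<in> \<T>. T \<inter> range u \<noteq> {}} \<subseteq> {T \<in> \<T>. T \<inter> (X \<union> u ` {..n}) \<noteq> {}} \<or>
          (\<exists>T \<in> \<T>. T \<inter> range u \<noteq> {} \<and> T \<inter> (X \<union> u ` {..n}) = {})" by blast
        then obtain T where T: "T \<in> \<T>" "T \<inter> range u \<noteq> {}" "T \<inter> (X \<union> u ` {..n}) = {}"
          using u(3) finite_meeting[OF \<T>(2) fin] finite_subset by blast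
        then obtain j where j: "u j \<in> T" by blast
        have "n < j" using T(3) j by (auto intro: leI simp: not_le[symmetric])
        then have "u j = q (k + (j - n))" using q(2)[of "j - n"] by simp
        then have "u j \<in> range q" by blast
        then show ?thesis using \<T>(3)[OF T(1)] j T(3) by blast
      qed
      have "inf_linked E (range q) V"
        unfolding inf_linked_def
      proof (intro allI impI)
        fix X :: "'a set" assume X: "finite X"
        from fresh[OF this] obtain T v x where T: "ear x T" "v \<in> T" "v \<in> range q" "T \<inter> X = {}"
          by blast
        have "X \<inter> T \<subseteq> {x}" using T(4) by blast
        with T(1,2) X obtain c b where cb: "(v, c) \<in> E" "c \<notin> X" "b \<in> V" "reach E X c b"
          by (rule ear_returns)
        have "v \<notin> X" using T by blast
        then have "(v, c) \<in> avoid E X" using cb(1,2) by simp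
        then have "reach E X v b" using cb(4) by (rule converse_rtrancl_into_rtrancl)
        then show "\<exists>a\<in>range q. \<exists>b\<in>V. a \<notin> X \<and> reach E X a b" using \<open>v \<notin> X\<close> T(3) cb(3) by blast
      qed
      then have "inf_linked E (range q) (range R)" by (rule linked_R)
      moreover have "inf_linked E V (range q)"
        unfolding inf_linked_def
      proof (intro allI impI)
        fix X :: "'a set" assume X: "finite X"
        from fresh[OF this] obtain T v x where T: "ear x T" "v \<in> T" "v \<in> range q" "T \<inter> X = {}"
          by blast
        then show "\<exists>a\<in>V. \<exists>b\<in>range q. a \<notin> X \<and> reach E X a b"
          using ear_avoid[OF T(1,2,4)] ear_start[OF T(1)] by blast
      qed
      then have "inf_linked E (range R) (range q)" by (rule R_linked)
      ultimately show ?thesis using q(1) by (simp add: own_rays_def)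
    qed
  qed (use u(1) in \<open>simp_all add: rays_def\<close>)
  ultimately show ?thesis by blast
qed

end

context base_ray
begin

lemma many_rays:
  assumes sep: "\<And>S. finite S \<Longrightarrow> infinite {i. esc S (R i)}"
  shows "\<exists>Y F. card Y = Suc n \<and> linkage E {} own_rays Y F"
proof (induction n)
  case 0
  let ?F = "{(R i, R (Suc i)) |i. True}"
  have R_inj: "R i = R j \<longleftrightarrow> i = j" for i j using rays_inj[OF R] by (simp add: inj_eq)
  have reach: "?F\<^sup>* `` {R 0} = range R"
  proof
    show "?F\<^sup>* `` {R 0} \<subseteq> range R"
    proof safe
      fix v assume "(R 0, v) \<in> ?F\<^sup>*"
      then show "v \<in> range R" by induction auto
    qed
    show "range R \<subseteq> ?F\<^sup>* `` {R 0}" using chain_rtrancl[of 0 _ R ?F] by auto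
  qed
  have "linkage E {} own_rays {R 0} ?F"
  proof
    show "?F \<subseteq> E" using rays_arc[OF R] by auto
    show "single_valued ?F" "single_valued (?F\<inverse>)" by (auto simp: single_valued_def R_inj)
    show "{R 0} \<inter> Range ?F = {}" by (auto simp: R_inj)
    show "Domain ?F \<subseteq> ?F\<^sup>* `` {R 0}" unfolding reach by auto
    show "v \<in> {}" if "v \<in> ?F\<^sup>* `` {R 0}" "v \<notin> Domain ?F" for v using that unfolding reach by auto
  next
    fix q assume q: "q 0 \<in> {R 0}" "\<And>i. (q i, q (Suc i)) \<in> ?F"
    have "q i = R i" for i
    proof (induction i)
      case (Suc i)
      then show ?case using q(2)[of i] by (auto simp: R_inj)
    qed (use q(1) in simp)
    then have "q = R" by blast
    then show "q \<in> own_rays" using R_own by simp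
  qed simp
  then show ?case by (intro exI[of _ "{R 0}"]) auto
next
  case (Suc n)
  then obtain Y F where Y: "card Y = Suc n" "linkage E {} own_rays Y F" by blast
  then interpret l: linkage E "{}" own_rays Y F by blast
  interpret end_linkage E R Y F by standard (use Y(1) in auto)
  obtain y F' where "y \<notin> Y" "linkage E {} own_rays (insert y Y) F'" using more_rays[OF sep] by blast
  then show ?case using Y(1) l.finite_Y by (intro exI[of _ "insert y Y"]) auto
qed

end

section \<open>The two sides of a smallest separator\<close>

lemma (in linkage) V_subset:
  assumes "E \<subseteq> A \<times> A" "Y \<subseteq> A"
  shows "V \<subseteq> A"
proof
  fix v assume "v \<in> V"
  then obtain y where "y \<in> Y" "(y, v) \<in> F\<^sup>*" by (auto simp: V_def)
  from this(2,1) show "v \<in> A" by (induction rule: rtrancl_induct) (use assms F_E in auto)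
qed

definition epath :: "'a rel \<Rightarrow> 'a list \<Rightarrow> bool" where
  "epath E p \<longleftrightarrow> p \<noteq> [] \<and> distinct p \<and> successively (\<lambda>a b. (a, b) \<in> E) p"

lemma epath_rev [simp]: "epath (E\<inverse>) (rev p) \<longleftrightarrow> epath E p"
  by (simp add: epath_def)

lemma epath_mono: "E \<subseteq> E' \<Longrightarrow> epath E p \<Longrightarrow> epath E' p"
  unfolding epath_def using successively_mono[of "\<lambda>a b. (a, b) \<in> E" p "\<lambda>a b. (a, b) \<in> E'"] by blast

text \<open>No arc of the linkage leaves \<open>W\<close>, so only a last vertex can lie in
  \<open>W\<close>.\<close>

lemma half_track:
  assumes "linkage {(u, v) \<in> E. u \<notin> W} W B Y F" "y \<in> Y"
  obtains (path) p where "epath E p" "hd p = y" "set p = F\<^sup>* `` {y}" "F\<^sup>* `` {y} \<inter> W = {last p}"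
    | (ray) q where "q \<in> B" "q \<in> rays E" "q 0 = y" "range q = F\<^sup>* `` {y}" "F\<^sup>* `` {y} \<inter> W = {}"
proof -
  interpret linkage "{(u, v) \<in> E. u \<notin> W}" W B Y F by fact
  from assms(2) show thesis
  proof (cases rule: orbit_cases)
    case f: (path f n)
    have arcs: "(f i, f (Suc i)) \<in> E" "f i \<notin> W" if "i < n" for i using f(3)[OF that] F_E by auto
    define p where "p = map f [0..<Suc n]"
    have "epath E p"
      unfolding epath_def successively_conv_nth using arcs(1) f(2)
      by (simp add: p_def distinct_map atLeast0LessThan lessThan_Suc_atMost del: upt_Suc)
    moreover have "hd p = y" using f(1) by (simp add: p_def hd_map del: upt_Suc)
    moreover have "set p = F\<^sup>* `` {y}"
      using f(6) by (simp add: p_def atLeast0LessThan lessThan_Suc_atMost del: upt_Suc)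
    moreover have "i = n" if "i \<le> n" "f i \<in> W" for i using arcs(2)[of i] that by (cases "i = n") auto
    then have "f ` {..n} \<inter> W = {f n}" using f(4) by auto
    then have "F\<^sup>* `` {y} \<inter> W = {last p}" using f(6) by (simp add: p_def)
    ultimately show thesis by (rule path)
  next
    case q: (ray q)
    have "q \<in> rays {(u, v) \<in> E. u \<notin> W}" "q \<in> B" using chain_ray[of q] q assms(2) by auto
    moreover from this(1) have "range q \<inter> W = {}" "q \<in> rays E" by (auto simp: rays_def)
    ultimately show thesis using q(1,3) by (intro ray) auto
  qed
qed

context base_ray
begin

definition in_dominators :: "'a set" where
  "in_dominators = {v. inf_linked (E\<inverse>) (E\<inverse> `` {v}) (range R)}"

text \<open>Equivalence with \<open>R\<close> is not excluded, in contrast to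
  \<open>lower_rays\<close>, because \<open>end_up\<close> contains the end itself. The members are
  in-rays, enumerated from their endvertex.\<close>

definition upper_rays :: "(nat \<Rightarrow> 'a) set" where
  "upper_rays = {q \<in> rays (E\<inverse>). inf_linked E (range R) (range q)}"

lemma lower_tail: "q \<in> lower_rays \<Longrightarrow> (\<lambda>i. q (n + i)) \<in> lower_rays"
proof -
  assume q: "q \<in> lower_rays"
  then have r: "(\<lambda>i. q (n + i)) \<in> rays E" by (auto simp: lower_rays_def intro: rays_tail)
  have "range (\<lambda>i. q (n + i)) \<inter> range q = range (\<lambda>i. q (n + i))" by auto
  then show ?thesis using lower_meet[OF q r] infinite_ray[OF r] by simp
qed

text \<open>Being equivalent, \<open>q\<close> and \<open>R\<close> define the same dominating
  vertices and lower rays, so \<open>infinite_esc\<close> applies with their roles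
  exchanged.\<close>

lemma infinite_escapes_all:
  assumes "finite S" "q \<in> own_rays" "\<And>i. i \<ge> n \<Longrightarrow> \<not> esc S (R i)"
  shows "finite {i. esc S (q i)}"
proof (rule ccontr)
  assume inf: "infinite {i. esc S (q i)}"
  interpret q: base_ray E q by standard (use assms(2) in \<open>simp add: own_rays_def\<close>)
  have qR: "inf_linked E (range q) (range R)" "inf_linked E (range R) (range q)" "q \<in> rays E"
    using assms(2) by (auto simp: own_rays_def)
  have "q.dominators = dominators"
    unfolding q.dominators_def dominators_def
    using inf_linked_trans[OF _ qR(1,3)] inf_linked_trans[OF _ qR(2) R] by blast
  moreover have "q.lower_rays = lower_rays"
    unfolding q.lower_rays_def lower_rays_def
    using inf_linked_trans[OF _ qR(1,3)] inf_linked_trans[OF _ qR(2) R]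
      inf_linked_trans[OF qR(1) _ R] inf_linked_trans[OF qR(2) _ qR(3)] by blast
  moreover have "R \<in> q.own_rays" using qR R by (simp add: q.own_rays_def)
  ultimately have "infinite {i. esc S (R i)}" using q.infinite_esc[OF assms(1)] inf by simp
  moreover have "{i. esc S (R i)} \<subseteq> {..n}" using assms(3) by (auto intro: leI simp: not_le[symmetric])
  ultimately show False using finite_subset by blast
qed

end

locale separated_ray = base_ray E R for E :: "'a rel" and R +
  fixes S :: "'a set" and n0 :: nat
  assumes finite_S: "finite S"
    and R_S: "i \<ge> n0 \<Longrightarrow> R i \<notin> S"
    and sep: "i \<ge> n0 \<Longrightarrow> \<not> esc S (R i)"
begin

text \<open>\<open>near\<close> is the side of \<open>S\<close> that contains the tails of \<open>R\<close>.\<close>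

definition near :: "'a set" where
  "near = {v. \<exists>i\<ge>n0. reach E S (R i) v}"

lemma R_near: "i \<ge> n0 \<Longrightarrow> R i \<in> near" by (auto simp: near_def)

lemma near_step: "v \<in> near \<Longrightarrow> (v, w) \<in> E \<Longrightarrow> w \<notin> S \<Longrightarrow> w \<in> near"
proof -
  assume "v \<in> near" and vw: "(v, w) \<in> E" "w \<notin> S"
  then obtain i where i: "i \<ge> n0" "reach E S (R i) v" by (auto simp: near_def)
  from i(2) R_S[OF i(1)] have "v \<notin> S" by (rule avoid_notin)
  then have "(v, w) \<in> avoid E S" using vw by simp
  with i(2) have "reach E S (R i) w" by (rule rtrancl_into_rtrancl)
  then show ?thesis using i(1) by (auto simp: near_def)
qed

lemma near_S: "near \<inter> S = {}"
  using avoid_notin[OF _ R_S] by (auto simp: near_def)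

lemma near_esc: "v \<in> near \<Longrightarrow> \<not> esc S v"
  using esc_back sep by (auto simp: near_def)

lemma dominators_near: "dominators \<inter> near = {}"
proof (rule ccontr)
  assume "dominators \<inter> near \<noteq> {}"
  then obtain v where v: "v \<in> dominators" "v \<in> near" by blast
  then have "esc S v" using near_S unfolding escapes_def by blast
  then show False using near_esc v(2) by blast
qed

lemma in_dominators_near: "in_dominators \<subseteq> near \<union> S"
proof
  fix v assume "v \<in> in_dominators"
  then have "inf_linked E (range R) (E\<inverse> `` {v})" by (simp add: in_dominators_def)
  then obtain i c where c: "n0 < i" "c \<in> E\<inverse> `` {v}" "R i \<notin> S" "c \<notin> S" "reach E S (R i) c"
    using finite_S by (rule inf_linked_rayE)
  then have "c \<in> near" unfolding near_def by (auto intro: less_imp_le)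
  then show "v \<in> near \<union> S" using near_step c(2) by blast
qed

text \<open>While avoiding \<open>S\<close>, tails of \<open>R\<close> reach only
  \<open>near\<close>. This puts the comb rays found on the far side strictly below the end, as
  membership in \<open>lower_rays\<close> requires.\<close>

lemma far_ray_not_linked:
  assumes "range t \<inter> near = {}"
  shows "\<not> inf_linked E (range R) (range t)"
proof
  assume "inf_linked E (range R) (range t)"
  then obtain i b where b: "n0 < i" "b \<in> range t" "R i \<notin> S" "b \<notin> S" "reach E S (R i) b"
    using finite_S by (rule inf_linked_rayE)
  then have "b \<in> near" unfolding near_def by (auto intro: less_imp_le)
  then show False using b(2) assms by blast
qed

text \<open>Both sides include \<open>S\<close>, where the half tracks start. \<open>E_near\<close>
  is reversed because the near half of a track runs into \<open>S\<close>.\<close>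

definition E_far :: "'a rel" where "E_far = E \<inter> (- near) \<times> (- near)"

definition E_near :: "'a rel" where "E_near = (E \<inter> (near \<union> S) \<times> (near \<union> S))\<inverse>"

lemma far_sub: "E_far \<subseteq> E" and near_sub: "E_near \<subseteq> E\<inverse>"
  by (auto simp: E_far_def E_near_def)

text \<open>After its last vertex in \<open>S\<close> the escape avoids \<open>S\<close>, so it
  cannot lie in \<open>near\<close> any more, as vertices of \<open>near\<close> do not escape
  \<open>S\<close>.\<close>

lemma far_escapes:
  assumes z: "z \<in> near" "esc H z"
  shows "\<exists>y \<in> S. escapes E_far dominators lower_rays H y"
proof -
  from z(2) consider
      (path) w where "w \<in> dominators" "reach E H z w" "z \<notin> H"
    | (ray) q where "q \<in> lower_rays" "q \<in> rays E" "q 0 = z" "range q \<inter> H = {}"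
    unfolding escapes_def by blast
  then show ?thesis
  proof cases
    case path
    show ?thesis
    proof (rule ccontr)
      assume no: "\<not> ?thesis"
      \<comment> \<open>The path is read from its end: as long as no vertex of \<open>S\<close>
        serves as \<open>y\<close>, each vertex escapes \<open>S\<close>, and this fails at
        \<open>z\<close>.\<close>
      from path(2,3) have "esc S z \<and> reach E_far H z w"
      proof (induction rule: converse_rtrancl_induct)
        case base
        have "w \<notin> S" using no base path(1) unfolding escapes_def by blast
        then show ?case using path(1) unfolding escapes_def by blast
      next
        case (step a b)
        then have b: "esc S b" "reach E_far H b w" and ab: "(a, b) \<in> E" "a \<notin> H" "b \<notin> H" by auto
        have "b \<notin> near" using near_esc b(1) by blast
        have to_w: "reach E_far H a w" if "a \<notin> near"
        proof -
          have "(a, b) \<in> avoid E_far H" using ab that \<open>b \<notin> near\<close> by (simp add: E_far_def)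
          then show ?thesis using b(2) by (rule converse_rtrancl_into_rtrancl)
        qed
        have "a \<notin> S"
        proof
          assume "a \<in> S"
          then have "escapes E_far dominators lower_rays H a"
            using to_w near_S path(1) ab(2) unfolding escapes_def by blast
          then show False using no \<open>a \<in> S\<close> by blast
        qed
        then have "esc S a" using esc_step[OF ab(1) _ b(1)] by blast
        then show ?case using to_w near_esc by blast
      qed
      then show False using near_esc z(1) by blast
    qed
  next
    case (ray q)
    have "range q \<inter> S \<noteq> {}"
      using near_esc[OF z(1)] near_S z(1) ray unfolding escapes_def by blast
    then obtain j where j: "q j \<in> S" by blast
    obtain m where m: "\<And>i. i \<ge> m \<Longrightarrow> q i \<notin> S"
      using inj_eventually_notin[OF rays_inj[OF ray(2)], of S] finite_S by auto
    have "finite {i. q i \<in> S}"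
      by (rule finite_subset[of _ "{..m}"]) (use m in \<open>auto intro: leI simp: not_le[symmetric]\<close>)
    then obtain l where l: "q l \<in> S" and later: "\<And>i. l < i \<Longrightarrow> q i \<notin> S"
      using j by (rule last_index) blast
    have far: "q i \<notin> near" if "l < i" for i
    proof -
      let ?t = "\<lambda>k. q (i + k)"
      have "?t \<in> lower_rays" "?t \<in> rays E" using lower_tail[OF ray(1)] rays_tail[OF ray(2)] by auto
      moreover have "range ?t \<inter> S = {}" using later that by auto
      moreover have "?t 0 = q i" by simp
      ultimately have "esc S (q i)" using later[OF that] unfolding escapes_def by blast
      then show ?thesis using near_esc by blast
    qed
    let ?t = "\<lambda>k. q (l + k)"
    have nn: "q (l + k) \<notin> near" for k using far[of "l + k"] l near_S by (cases k) auto
    have "?t \<in> rays E" "?t \<in> lower_rays" using lower_tail[OF ray(1)] rays_tail[OF ray(2)] by auto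
    moreover from this(1) have "?t \<in> rays E_far"
      using nn[of "Suc _"] nn unfolding rays_def E_far_def by auto
    moreover have "range ?t \<inter> H = {}" using ray(4) by blast
    moreover have "?t 0 = q l" by simp
    moreover have "q l \<notin> H" using ray(4) by blast
    ultimately show ?thesis using l unfolding escapes_def by blast
  qed
qed

text \<open>Here the first vertex of the escape in \<open>S\<close> matters: up to it the escape
  stays in \<open>near\<close>.\<close>

lemma near_reaches_S:
  assumes z: "z \<in> near" "esc H z"
  shows "\<exists>y \<in> S. y \<notin> H \<and> reach E_near H y z"
proof -
  have zH: "z \<notin> H" using z(2) by (simp add: escapes_def)
  have "\<exists>y \<in> S. reach (E_near\<inverse>) H z y"
  proof -
    from z(2) consider
        (path) w where "w \<in> dominators" "reach E H z w"
      | (ray) q where "q \<in> lower_rays" "q \<in> rays E" "q 0 = z" "range q \<inter> H = {}"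
      unfolding escapes_def by blast
    then show ?thesis
    proof cases
      case path
      from path(2) z(1) show ?thesis
      proof (induction rule: converse_rtrancl_induct)
        case base
        then show ?case using path(1) dominators_near by blast
      next
        case (step a b)
        have b: "b \<in> near \<union> S" using near_step step by auto
        then have ab: "(a, b) \<in> avoid (E_near\<inverse>) H" using step by (auto simp: E_near_def)
        show ?case
        proof (cases "b \<in> S")
          case False
          then obtain y where "y \<in> S" "reach (E_near\<inverse>) H b y" using step b by blast
          then show ?thesis using ab by (meson converse_rtrancl_into_rtrancl)
        qed (use ab in blast)
      qed
    next
      case (ray q)
      have "range q \<inter> S \<noteq> {}"
        using near_esc[OF z(1)] near_S z(1) ray unfolding escapes_def by blast
      then obtain j where j: "q j \<in> S" by blast
      define l where "l = (LEAST i. q i \<in> S)"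
      have l: "q l \<in> S" unfolding l_def using j by (rule LeastI)
      have less: "q i \<notin> S" if "i < l" for i using not_less_Least that unfolding l_def by blast
      have nr: "q i \<in> near" if "i < l" for i
        using that
      proof (induction i)
        case (Suc i)
        then show ?case using near_step[of "q i" "q (Suc i)"] rays_arc[OF ray(2)] less by simp
      qed (use ray(3) z(1) in simp)
      have "q i \<in> near \<union> S" if "i \<le> l" for i using nr[of i] l that by (cases "i = l") auto
      then have "reach (E_near\<inverse>) H (q 0) (q l)"
        using ray(4) rays_arc[OF ray(2)] by (intro chain_rtrancl) (auto simp: E_near_def)
      then show ?thesis using l ray(3) by blast
    qed
  qed
  then obtain y where y: "y \<in> S" "reach (E_near\<inverse>) H z y" by blast
  from y(2) zH have "y \<notin> H" by (rule avoid_notin)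
  moreover have "reach E_near H y z" using y(2) by (simp add: avoid_converse rtrancl_converse)
  ultimately show ?thesis using y(1) by blast
qed

text \<open>By pigeonhole one vertex of \<open>S\<close> leads, in the reversed digraph, to
  infinitely many vertices of \<open>R\<close>. The star-comb dichotomy is applied after deleting
  \<open>H\<close>, so the centre or ray it gives is reached without meeting
  \<open>H\<close>.\<close>

lemma near_escapes:
  assumes H: "infinite {i. esc H (R i)}"
  shows "\<exists>y \<in> S. escapes E_near in_dominators upper_rays H y"
proof -
  let ?I = "{i. i \<ge> n0 \<and> esc H (R i)}"
  have "{i. esc H (R i)} \<subseteq> ?I \<union> {..n0}" by auto
  then have infI: "infinite ?I" using H finite_subset by blast
  have "\<forall>i \<in> ?I. \<exists>y \<in> S. y \<notin> H \<and> reach E_near H y (R i)"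
    using near_reaches_S R_near by blast
  from pigeonhole_infinite_rel[OF infI finite_S this]
  obtain y where y: "y \<in> S" "infinite {i \<in> ?I. y \<notin> H \<and> reach E_near H y (R i)}"
    by (elim bexE)
  let ?J = "{i \<in> ?I. y \<notin> H \<and> reach E_near H y (R i)}"
  let ?\<rho> = "avoid E_near H"
  have sub: "?\<rho> \<subseteq> E\<inverse>" using near_sub by (auto simp: avoid_def)
  have yH: "y \<notin> H" using not_finite_existsD[OF y(2)[unfolded Collect_mem_eq]] by (elim exE) simp
  have inf: "infinite (R ` ?J)" using y(2) rays_inj[OF R] by (simp add: finite_image_iff inj_on_subset)
  have "R ` ?J \<subseteq> ?\<rho>\<^sup>* `` {y}" by auto
  from star_comb[OF inf this] show ?thesis
  proof (elim disjE bexE conjE)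
    fix v assume v: "v \<in> ?\<rho>\<^sup>* `` {y}" "inf_linked ?\<rho> (?\<rho> `` {v}) (R ` ?J)"
    from v(2) have "inf_linked (E\<inverse>) (E\<inverse> `` {v}) (range R)"
      by (rule inf_linked_mono) (use sub in auto)
    then have "v \<in> in_dominators" by (simp add: in_dominators_def)
    then show ?thesis using v(1) y(1) yH unfolding escapes_def by blast
  next
    fix q assume q: "q \<in> rays ?\<rho>" "q 0 = y" "inf_linked ?\<rho> (range q) (R ` ?J)"
    from q(3) have "inf_linked (E\<inverse>) (range q) (range R)"
      by (rule inf_linked_mono) (use sub in auto)
    then have "q \<in> upper_rays" using rays_mono[OF sub q(1)] by (simp add: upper_rays_def)
    moreover have "q \<in> rays E_near" by (rule rays_mono[OF _ q(1)]) (auto simp: avoid_def)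
    moreover have "range q \<inter> H = {}" using rays_arc[OF q(1)] by auto
    ultimately show ?thesis using q(2) y(1) yH unfolding escapes_def by blast
  qed
qed

lemma far_orbits:
  assumes "linkage {(u, v) \<in> E_far. u \<notin> W} W B S F"
  shows "F\<^sup>* `` S \<inter> near = {}"
proof -
  interpret linkage "{(u, v) \<in> E_far. u \<notin> W}" W B S F by fact
  have "V \<subseteq> - near" by (rule V_subset) (use near_S in \<open>auto simp: E_far_def\<close>)
  then show ?thesis by (auto simp: V_def)
qed

lemma near_orbits:
  assumes "linkage {(u, v) \<in> E_near. u \<notin> W} W B S F"
  shows "F\<^sup>* `` S \<subseteq> near \<union> S"
proof -
  interpret linkage "{(u, v) \<in> E_near. u \<notin> W}" W B S F by fact
  have "V \<subseteq> near \<union> S" by (rule V_subset) (auto simp: E_near_def)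
  then show ?thesis by (simp add: V_def)
qed

lemma far_linkage:
  assumes min: "\<And>H. finite H \<Longrightarrow> card H < card S \<Longrightarrow> infinite {i. esc H (R i)}"
  shows "\<exists>F. linkage {(u, v) \<in> E_far. u \<notin> dominators} dominators lower_rays S F"
proof (rule ray_menger)
  fix H :: "'a set" assume "finite H" "card H < card S"
  then have "infinite {i. esc H (R i)}" by (rule min)
  then obtain i where "i > n0" "esc H (R i)" unfolding infinite_nat_iff_unbounded by blast
  then show "\<exists>y \<in> S. escapes E_far dominators lower_rays H y" by (intro far_escapes[OF R_near[of i]]) simp_all
next
  fix q v assume q: "q \<in> lower_rays" "inf_linked E_far (E_far `` {v}) (range q)"
  from q(2) have "inf_linked E (E `` {v}) (range q)" by (rule inf_linked_mono) (use far_sub in auto)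
  then show "v \<in> dominators"
    using inf_linked_trans q(1) unfolding lower_rays_def dominators_def by blast
next
  fix q t assume q: "q \<in> lower_rays" "t \<in> rays E_far" "inf_linked E_far (range t) (range q)"
  from q(3) have "inf_linked E (range t) (range q)" by (rule inf_linked_mono) (use far_sub in auto)
  then have "inf_linked E (range t) (range R)" using inf_linked_trans q(1) unfolding lower_rays_def by blast
  moreover have "range t \<inter> near = {}" using rays_arc[OF q(2)] by (auto simp: E_far_def)
  then have "\<not> inf_linked E (range R) (range t)" by (rule far_ray_not_linked)
  ultimately show "t \<in> lower_rays" using rays_mono[OF far_sub q(2)] by (simp add: lower_rays_def)
qed (rule finite_S)

lemma near_linkage:
  assumes min: "\<And>H. finite H \<Longrightarrow> card H < card S \<Longrightarrow> infinite {i. esc H (R i)}"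
  shows "\<exists>F. linkage {(u, v) \<in> E_near. u \<notin> in_dominators} in_dominators upper_rays S F"
proof (rule ray_menger)
  fix H :: "'a set" assume "finite H" "card H < card S"
  then show "\<exists>y \<in> S. escapes E_near in_dominators upper_rays H y" by (intro near_escapes min)
next
  fix q v assume q: "q \<in> upper_rays" "inf_linked E_near (E_near `` {v}) (range q)"
  from q(2) have "inf_linked (E\<inverse>) (E\<inverse> `` {v}) (range q)" by (rule inf_linked_mono) (use near_sub in auto)
  moreover have "inf_linked (E\<inverse>) (range q) (range R)" "q \<in> rays (E\<inverse>)"
    using q(1) by (simp_all add: upper_rays_def)
  ultimately show "v \<in> in_dominators" using inf_linked_trans unfolding in_dominators_def by blast
next
  fix q t assume q: "q \<in> upper_rays" "t \<in> rays E_near" "inf_linked E_near (range t) (range q)"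
  from q(3) have "inf_linked (E\<inverse>) (range t) (range q)" by (rule inf_linked_mono) (use near_sub in auto)
  moreover have "inf_linked (E\<inverse>) (range q) (range R)" "q \<in> rays (E\<inverse>)"
    using q(1) by (simp_all add: upper_rays_def)
  ultimately have "inf_linked (E\<inverse>) (range t) (range R)" using inf_linked_trans by blast
  then show "t \<in> upper_rays" using rays_mono[OF near_sub q(2)] by (simp add: upper_rays_def)
qed (rule finite_S)

end

section \<open>Ends of digraphs\<close>

definition connecting :: "'a rel \<Rightarrow> 'a set \<Rightarrow> 'a set \<Rightarrow> 'a list \<Rightarrow> bool" where
  "connecting E X Y p \<longleftrightarrow> epath E p \<and> set p \<inter> X = {hd p} \<and> set p \<inter> Y = {last p}"

lemma connecting_rev: "connecting (E\<inverse>) Y X (rev p) \<longleftrightarrow> connecting E X Y p"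
  by (auto simp: connecting_def epath_def hd_rev last_rev)

lemma successively_path:
  assumes "successively (\<lambda>a b. (a, b) \<in> E) p" "p \<noteq> []" "set p \<inter> X = {}"
  shows "reach E X (hd p) (last p)"
  using assms
proof (induction p rule: induct_list012)
  case (3 x y zs)
  then have "(x, y) \<in> avoid E X" "reach E X y (last (y # zs))" by auto
  then show ?case by (auto intro: converse_rtrancl_into_rtrancl)
qed auto

lemma connecting_exists:
  assumes "reach E X a b" "a \<notin> X" "a \<in> A" "b \<in> B"
  obtains p where "connecting E A B p" "set p \<inter> X = {}"
proof -
  from assms(1) obtain f n where f: "f 0 = a" "f n = b" "inj_on f {..n}"
    "\<And>i. i < n \<Longrightarrow> (f i, f (Suc i)) \<in> avoid E X"
    by (rule simple_path) blast
  define m where "m = (LEAST i. f i \<in> B)"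
  have fn: "f n \<in> B" using f(2) assms(4) by simp
  then have m: "f m \<in> B" "m \<le> n" unfolding m_def by (rule LeastI, rule Least_le)
  have less: "f i \<notin> B" if "i < m" for i using not_less_Least that unfolding m_def by blast
  have "finite {i. i \<le> m \<and> f i \<in> A}" by simp
  then obtain k where "k \<le> m \<and> f k \<in> A" "\<And>j. k < j \<Longrightarrow> \<not> (j \<le> m \<and> f j \<in> A)"
    by (rule last_index[of _ 0]) (use f(1) assms(3) in auto)
  then have k: "k \<le> m" "f k \<in> A" and later: "\<And>j. k < j \<Longrightarrow> j \<le> m \<Longrightarrow> f j \<notin> A" by auto
  have nX: "f i \<notin> X" if "i \<le> n" for i
    using f(4)[of i] f(1) assms(2) f(4)[of "i - 1"] that by (cases i) auto
  define p where "p = map f [k..<Suc m]"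
  have ne: "p \<noteq> []" using k(1) by (simp add: p_def)
  have set_p: "set p = f ` {k..m}" by (simp add: p_def atLeastLessThanSuc_atLeastAtMost del: upt_Suc)
  have hd_p: "hd p = f k" using k(1) by (simp add: p_def hd_map del: upt_Suc)
  have last_p: "last p = f m" using k(1) by (simp add: p_def)
  have "inj_on f (set [k..<Suc m])" by (rule inj_on_subset[OF f(3)]) (use m(2) in auto)
  then have "distinct p" by (simp add: p_def distinct_map del: upt_Suc)
  moreover have "successively (\<lambda>a b. (a, b) \<in> E) p"
    unfolding successively_conv_nth
  proof (intro allI impI)
    fix i assume "Suc i < length p"
    then have i: "Suc (k + i) \<le> m" by (simp add: p_def del: upt_Suc)
    then have "p ! i = f (k + i)" "p ! Suc i = f (Suc (k + i))" by (simp_all add: p_def del: upt_Suc)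
    then show "(p ! i, p ! Suc i) \<in> E" using f(4)[of "k + i"] i m(2) by simp
  qed
  moreover have "set p \<inter> A = {f k}"
  proof
    show "set p \<inter> A \<subseteq> {f k}"
    proof
      fix v assume "v \<in> set p \<inter> A"
      then obtain j where j: "k \<le> j" "j \<le> m" "v = f j" "f j \<in> A" unfolding set_p by auto
      then show "v \<in> {f k}" using later[of j] by (cases "j = k") auto
    qed
  qed (use k set_p in auto)
  moreover have "set p \<inter> B = {f m}"
  proof
    show "set p \<inter> B \<subseteq> {f m}"
    proof
      fix v assume "v \<in> set p \<inter> B"
      then obtain j where j: "k \<le> j" "j \<le> m" "v = f j" "f j \<in> B" unfolding set_p by auto
      then show "v \<in> {f m}" using less[of j] by (cases "j = m") auto
    qed
  qed (use k m set_p in auto)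
  ultimately have "connecting E A B p" using ne hd_p last_p by (simp add: connecting_def epath_def)
  moreover have "set p \<inter> X = {}" unfolding set_p using nX m(2) by auto
  ultimately show ?thesis by (rule that)
qed

lemma connecting_path:
  assumes "connecting E A B p" "set p \<inter> X = {}"
  shows "hd p \<in> A" "last p \<in> B" "hd p \<notin> X" "reach E X (hd p) (last p)"
proof -
  have p: "p \<noteq> []" "set p \<inter> A = {hd p}" "set p \<inter> B = {last p}" "successively (\<lambda>a b. (a, b) \<in> E) p"
    using assms(1) by (simp_all add: connecting_def epath_def)
  show "hd p \<in> A" "last p \<in> B" using p(2,3) by auto
  show "hd p \<notin> X" using hd_in_set[OF p(1)] assms(2) by blast
  show "reach E X (hd p) (last p)" using successively_path[OF p(4,1) assms(2)] .
qed

text \<open>Finitely many paths cover a finite set, which one more path can avoid; conversely, a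
  finite set meets only finitely many disjoint paths.\<close>

lemma inf_linked_iff_disjoint:
  "inf_linked E A B \<longleftrightarrow> (\<exists>P. infinite P \<and> (\<forall>p \<in> P. connecting E A B p) \<and> disjoint_family_on set P)"
proof
  assume link: "inf_linked E A B"
  have "\<exists>P \<subseteq> {p. connecting E A B p}. infinite P \<and> pairwise (\<lambda>p q. set p \<inter> set q = {}) P"
  proof (rule infinite_pairwise)
    fix P assume "finite P" "P \<subseteq> {p. connecting E A B p}"
    then have "finite (\<Union>p\<in>P. set p)" by simp
    with link obtain a b where "a \<in> A" "b \<in> B" "a \<notin> (\<Union>p\<in>P. set p)" "b \<notin> (\<Union>p\<in>P. set p)"
      "reach E (\<Union>p\<in>P. set p) a b" by (rule inf_linkedE)
    then obtain p where p: "connecting E A B p" "set p \<inter> (\<Union>p\<in>P. set p) = {}"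
      by (metis connecting_exists)
    have "set p \<noteq> {}" using p(1) by (simp add: connecting_def epath_def)
    then have "p \<notin> P" using p(2) by (metis UN_upper inf.absorb1)
    moreover have "\<forall>q\<in>P. set p \<inter> set q = {} \<and> set q \<inter> set p = {}" using p(2) by blast
    ultimately show "\<exists>p\<in>{p. connecting E A B p} - P. \<forall>q\<in>P. set p \<inter> set q = {} \<and> set q \<inter> set p = {}"
      using p(1) by blast
  qed
  then show "\<exists>P. infinite P \<and> (\<forall>p \<in> P. connecting E A B p) \<and> disjoint_family_on set P"
    unfolding pairwise_def disjoint_family_on_def by blast
next
  assume "\<exists>P. infinite P \<and> (\<forall>p \<in> P. connecting E A B p) \<and> disjoint_family_on set P"
  then obtain P where P: "infinite P" "\<And>p. p \<in> P \<Longrightarrow> connecting E A B p"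
    "pairwise (\<lambda>p q. disjnt (set p) (set q)) P"
    unfolding pairwise_def disjoint_family_on_def disjnt_def by blast
  show "inf_linked E A B"
    unfolding inf_linked_def
  proof (intro allI impI)
    fix X :: "'a set" assume "finite X"
    then have "finite {p \<in> P. set p \<inter> X \<noteq> {}}" by (rule finite_meeting[OF P(3)])
    then obtain p where p: "p \<in> P" "set p \<inter> X = {}"
      using P(1) by (metis (mono_tags, lifting) finite_subset mem_Collect_eq subsetI)
    show "\<exists>a\<in>A. \<exists>b\<in>B. a \<notin> X \<and> reach E X a b"
      using connecting_path[OF P(2)[OF p(1)] p(2)] by blast
  qed
qed

lemma inf_linked_star:
  assumes P: "infinite P" "\<And>p. p \<in> P \<Longrightarrow> connecting E {v} A p"
    "pairwise (\<lambda>p q. set p \<inter> set q = {v}) P"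
  shows "inf_linked E (E `` {v}) A"
proof -
  have conn: "p \<noteq> []" "distinct p" "successively (\<lambda>a b. (a, b) \<in> E) p" "hd p = v" "set p \<inter> A = {last p}"
    if "p \<in> P" for p
    using P(2)[OF that] by (auto simp: connecting_def epath_def)
  \<comment> \<open>If \<open>v\<close> were in \<open>A\<close>, the trivial path would be the only
    possible member of the infinite set \<open>P\<close>.\<close>
  have "v \<notin> A"
  proof
    assume vA: "v \<in> A"
    have "P \<subseteq> {[v]}"
    proof
      fix p assume p: "p \<in> P"
      have "v \<in> set p \<inter> A" using conn(1,4)[OF p] vA by auto
      then have "last p = v" using conn(5)[OF p] by simp
      obtain q where q: "p = v # q" using conn(1,4)[OF p] by (cases p) auto
      then have "q = []" using conn(2)[OF p] \<open>last p = v\<close> by (auto split: if_splits)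
      then show "p \<in> {[v]}" using q by simp
    qed
    then show False using P(1) finite_subset by blast
  qed
  have pw: "pairwise (\<lambda>p q. disjnt (set p - {v}) (set q - {v})) P"
    using P(3) unfolding pairwise_def disjnt_def by blast
  show ?thesis
    unfolding inf_linked_def
  proof (intro allI impI)
    fix X :: "'a set" assume "finite X"
    then have "finite {p \<in> P. (set p - {v}) \<inter> X \<noteq> {}}" by (rule finite_meeting[OF pw])
    then obtain p where p: "p \<in> P" "(set p - {v}) \<inter> X = {}"
      using P(1) by (metis (mono_tags, lifting) finite_subset mem_Collect_eq subsetI)
    obtain q where q: "p = v # q" using conn(1,4)[OF p(1)] by (cases p) auto
    have "last p \<in> A" using conn(5)[OF p(1)] by blast
    then have "q \<noteq> []" using q \<open>v \<notin> A\<close> by auto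
    moreover have "set q \<inter> X = {}" using p(2) q conn(2)[OF p(1)] by auto
    moreover from this \<open>q \<noteq> []\<close> have "hd q \<notin> X" using hd_in_set by blast
    moreover have "successively (\<lambda>a b. (a, b) \<in> E) q"
      using conn(3)[OF p(1)] q \<open>q \<noteq> []\<close> by (simp add: successively_Cons)
    ultimately have "reach E X (hd q) (last q)" "hd q \<notin> X"
      by (auto intro: successively_path)
    moreover have "(v, hd q) \<in> E" using conn(3)[OF p(1)] q \<open>q \<noteq> []\<close> by (simp add: successively_Cons)
    moreover have "last q \<in> A" using \<open>last p \<in> A\<close> q \<open>q \<noteq> []\<close> by simp
    ultimately show "\<exists>a\<in>E `` {v}. \<exists>b\<in>A. a \<notin> X \<and> reach E X a b" by blast
  qed
qed

text \<open>Deleting \<open>v\<close> along with the earlier paths leaves a path from an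
  out-neighbour of \<open>v\<close>, to which \<open>v\<close> is prepended.\<close>

lemma star_exists:
  assumes link: "inf_linked E (E `` {v}) A" and v: "v \<notin> A"
  obtains P where "infinite P" "\<And>p. p \<in> P \<Longrightarrow> connecting E {v} A p"
    "pairwise (\<lambda>p q. set p \<inter> set q = {v}) P"
proof -
  have "\<exists>P \<subseteq> {p. connecting E {v} A p}. infinite P \<and> pairwise (\<lambda>p q. set p \<inter> set q = {v}) P"
  proof (rule infinite_pairwise)
    fix P assume P: "finite P" "P \<subseteq> {p. connecting E {v} A p}"
    define X where "X = insert v (\<Union>p\<in>P. set p)"
    have "finite X" using P(1) by (simp add: X_def)
    with link obtain c b where cb: "c \<in> E `` {v}" "b \<in> A" "c \<notin> X" "b \<notin> X" "reach E X c b"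
      by (rule inf_linkedE)
    from cb(5,3) singletonI cb(2) obtain p where p: "connecting E {c} A p" "set p \<inter> X = {}"
      by (rule connecting_exists)
    have p': "p \<noteq> []" "distinct p" "successively (\<lambda>a b. (a, b) \<in> E) p" "hd p = c" "set p \<inter> A = {last p}"
      using p(1) by (auto simp: connecting_def epath_def)
    have vp: "v \<notin> set p" using p(2) by (auto simp: X_def)
    have "connecting E {v} A (v # p)"
      unfolding connecting_def epath_def using p' vp cb(1) v by (auto simp: successively_Cons)
    moreover have "v \<in> set q" if "q \<in> P" for q
    proof -
      have "set q \<inter> {v} = {hd q}" using P(2) that by (auto simp: connecting_def)
      then have "hd q \<in> set q \<inter> {v}" by (simp only: singletonI)
      then show ?thesis by auto
    qed
    then have "\<forall>q\<in>P. set (v # p) \<inter> set q = {v} \<and> set q \<inter> set (v # p) = {v}"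
      using p(2) unfolding X_def by fastforce
    moreover have "v # p \<notin> P"
    proof
      assume "v # p \<in> P"
      then have "set p \<subseteq> X" by (auto simp: X_def)
      then show False using p(2) p'(1) by (simp add: inf.absorb1)
    qed
    ultimately show "\<exists>p\<in>{p. connecting E {v} A p} - P. \<forall>q\<in>P. set p \<inter> set q = {v} \<and> set q \<inter> set p = {v}"
      by blast
  qed
  then show ?thesis using that by blast
qed

section \<open>Paths and rays of a digraph in terms of its adjacency relation\<close>

lemma successively_vwalk_arcs:
  "set (vwalk_arcs p) \<subseteq> E \<longleftrightarrow> successively (\<lambda>a b. (a, b) \<in> E) p"
  by (induction p rule: vwalk_arcs.induct) auto

lemma vpath_iff: "vpath p D \<longleftrightarrow> epath (arcs_ends D) p \<and> set p \<subseteq> verts D"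
  by (auto simp: vpath_def vwalk_def epath_def successively_vwalk_arcs)

lemma is_ray_iff [simp]:
  "is_ray D (Out_Ray r) \<longleftrightarrow> r \<in> rays (arcs_ends D)"
  "is_ray D (In_Ray r) \<longleftrightarrow> r \<in> rays ((arcs_ends D)\<inverse>)"
  by (auto simp: rays_def)

lemma ray_trans:
  assumes "inf_linked (arcs_ends D) A (ray_verts Q)" "inf_linked (arcs_ends D) (ray_verts Q) C" "is_ray D Q"
  shows "inf_linked (arcs_ends D) A C"
proof (cases Q)
  case (Out_Ray q)
  then have "q \<in> rays (arcs_ends D)" using assms(3) is_ray_iff(1) by blast
  then show ?thesis using inf_linked_trans[of _ A q C] assms(1,2) Out_Ray by simp
next
  case (In_Ray q)
  have "inf_linked (arcs_ends D) A (range q)" "inf_linked (arcs_ends D) (range q) C" using assms(1,2) In_Ray by simp_all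
  moreover have "inj q" "\<And>i. (q (Suc i), q i) \<in> arcs_ends D" using assms(3) In_Ray by auto
  ultimately show ?thesis by (rule inf_linked_trans_in)
qed

context wf_digraph
begin

lemma arc_verts: "(u, v) \<in> arcs_ends G \<Longrightarrow> u \<in> verts G \<and> v \<in> verts G"
  by (auto simp: arcs_ends_conv)

lemma epath_verts:
  assumes "epath (arcs_ends G) p" "hd p \<in> verts G"
  shows "set p \<subseteq> verts G"
proof -
  have "p \<noteq> []" "successively (\<lambda>a b. (a, b) \<in> arcs_ends G) p" using assms(1) by (simp_all add: epath_def)
  then show ?thesis using assms(2)
  proof (induction p rule: induct_list012)
    case (3 x y zs)
    then show ?case using arc_verts[of x y] by auto
  qed auto
qed

lemma ray_verts_verts: "is_ray G Q \<Longrightarrow> ray_verts Q \<subseteq> verts G"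
  using arc_verts by (cases Q) (auto simp: rays_def)

lemma set_path_iff: "X \<subseteq> verts G \<Longrightarrow> set_path G X Y p \<longleftrightarrow> connecting (arcs_ends G) X Y p"
  unfolding set_path_def connecting_def vpath_iff using epath_verts[of p] by blast

lemma inf_disjoint_paths_iff: "X \<subseteq> verts G \<Longrightarrow> inf_disjoint_paths G X Y \<longleftrightarrow> inf_linked (arcs_ends G) X Y"
  unfolding inf_disjoint_paths_def inf_linked_iff_disjoint by (simp add: set_path_iff)

lemma ray_equiv_iff:
  "(Q, Q') \<in> ray_equiv G \<longleftrightarrow> is_ray G Q \<and> is_ray G Q' \<and>
    inf_linked (arcs_ends G) (ray_verts Q) (ray_verts Q') \<and> inf_linked (arcs_ends G) (ray_verts Q') (ray_verts Q)"
  unfolding ray_equiv_def using inf_disjoint_paths_iff[OF ray_verts_verts] by auto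

lemma ray_equiv_equiv: "equiv {Q. is_ray G Q} (ray_equiv G)"
proof (rule equivI)
  show "ray_equiv G \<subseteq> {Q. is_ray G Q} \<times> {Q. is_ray G Q}" by (auto simp: ray_equiv_def)
  show "refl_on {Q. is_ray G Q} (ray_equiv G)"
  proof (rule refl_onI)
    fix Q assume "Q \<in> {Q. is_ray G Q}"
    moreover from this have "infinite (ray_verts Q)"
      by (cases Q) (auto simp: rays_def inj_infinite_range)
    ultimately show "(Q, Q) \<in> ray_equiv G" by (simp add: ray_equiv_iff inf_linked_self)
  qed
  show "sym (ray_equiv G)" by (rule symI) (simp add: ray_equiv_iff)
  show "trans (ray_equiv G)"
    by (rule transI) (auto simp: ray_equiv_iff intro: ray_trans)
qed

end

text \<open>The last vertex of \<open>l\<close> is meant to be \<open>q 0\<close>, which is not repeated.\<close>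

definition glue :: "'a list \<Rightarrow> (nat \<Rightarrow> 'a) \<Rightarrow> nat \<Rightarrow> 'a" where
  "glue l q i = (if i < length l then l ! i else q (Suc i - length l))"

lemma glue:
  assumes l: "epath E l" "last l = q 0" and q: "q \<in> rays E" and meet: "set l \<inter> range q = {q 0}"
  shows "glue l q \<in> rays E" "range (glue l q) = set l \<union> range q" "glue l q 0 = hd l"
proof -
  have ne: "l \<noteq> []" and d: "distinct l" and s: "successively (\<lambda>a b. (a, b) \<in> E) l"
    using l(1) by (auto simp: epath_def)
  have q_eq: "q i = q j \<longleftrightarrow> i = j" for i j using rays_inj[OF q] by (simp add: inj_eq)
  show "glue l q 0 = hd l" using ne by (simp add: glue_def hd_conv_nth)
  have less: "glue l q i \<noteq> glue l q j" if "i < j" for i j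
  proof (cases "j < length l")
    case True
    then show ?thesis using that d by (simp add: glue_def nth_eq_iff_index_eq)
  next
    case False
    then have j: "glue l q j = q (Suc j - length l)" by (simp add: glue_def)
    show ?thesis
    proof (cases "i < length l")
      case True
      then have "glue l q i \<in> set l" by (simp add: glue_def)
      moreover have "q (Suc j - length l) \<notin> set l"
      proof
        assume "q (Suc j - length l) \<in> set l"
        then have "q (Suc j - length l) = q 0" using meet by blast
        then show False using False q_eq by simp
      qed
      ultimately show ?thesis using j by metis
    next
      case 2: False
      then show ?thesis using that j by (simp add: glue_def q_eq)
    qed
  qed
  have "inj (glue l q)" by (rule linorder_injI) (rule less)
  moreover have "(glue l q i, glue l q (Suc i)) \<in> E" for i
  proof -
    consider "Suc i < length l" | "Suc i = length l" | "length l < Suc i" by linarith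
    then show ?thesis
    proof cases
      case 1
      then show ?thesis using s unfolding successively_conv_nth by (simp add: glue_def)
    next
      case 2
      then have "i < length l" "l ! i = last l" using ne by (auto simp: last_conv_nth simp flip: 2)
      then have "glue l q i = q 0" using l(2) by (simp add: glue_def)
      moreover have "glue l q (Suc i) = q (Suc 0)" unfolding glue_def 2 by simp
      ultimately show ?thesis using rays_arc[OF q, of 0] by simp
    next
      case 3
      then show ?thesis using rays_arc[OF q, of "Suc i - length l"] by (simp add: glue_def Suc_diff_le)
    qed
  qed
  ultimately show "glue l q \<in> rays E" by (simp add: rays_def)
  show "range (glue l q) = set l \<union> range q"
  proof
    show "range (glue l q) \<subseteq> set l \<union> range q" by (auto simp: glue_def)
    have "set l \<subseteq> range (glue l q)"
    proof
      fix x assume "x \<in> set l"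
      then obtain i where "i < length l" "x = l ! i" by (auto simp: in_set_conv_nth)
      then have "x = glue l q i" by (simp add: glue_def)
      then show "x \<in> range (glue l q)" by blast
    qed
    moreover have "q i \<in> range (glue l q)" for i
    proof (cases i)
      case 0
      then have "q i \<in> set l" using meet by blast
      then show ?thesis using calculation by blast
    next
      case (Suc j)
      then have "q i = glue l q (length l + j)" by (simp add: glue_def)
      then show ?thesis by blast
    qed
    ultimately show "set l \<union> range q \<subseteq> range (glue l q)" by blast
  qed
qed

section \<open>The end, its order relations and its separators expressed by linking\<close>

locale digraph_end = wf_digraph D for D :: "('a, 'b) pre_digraph" +
  fixes \<omega> :: "'a ray set" and R :: "nat \<Rightarrow> 'a"
  assumes \<omega>: "\<omega> \<in> ends D" and R_in: "Out_Ray R \<in> \<omega>"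
begin

abbreviation "E \<equiv> arcs_ends D"

lemma ends_members: "\<alpha> \<in> ends D \<Longrightarrow> Q \<in> \<alpha> \<Longrightarrow> is_ray D Q \<and> \<alpha> = ray_equiv D `` {Q}"
proof -
  assume "\<alpha> \<in> ends D" and Q: "Q \<in> \<alpha>"
  then obtain Q0 where \<alpha>: "\<alpha> = ray_equiv D `` {Q0}" unfolding ends_def by (auto elim: quotientE)
  then have "(Q0, Q) \<in> ray_equiv D" using Q by simp
  then show ?thesis using equiv_class_eq[OF ray_equiv_equiv] \<alpha> ray_equiv_iff by simp
qed

lemma class_end: "is_ray D Q \<Longrightarrow> ray_equiv D `` {Q} \<in> ends D \<and> Q \<in> ray_equiv D `` {Q}"
proof -
  assume "is_ray D Q"
  then have "Q \<in> {Q. is_ray D Q}" by simp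
  then show ?thesis using equiv_class_self[OF ray_equiv_equiv] unfolding ends_def by (blast intro: quotientI)
qed

sublocale base_ray "arcs_ends D" R
  by standard (use ends_members[OF \<omega> R_in] is_ray_iff(1) in blast)

lemma \<omega>_iff: "Q \<in> \<omega> \<longleftrightarrow> is_ray D Q \<and> inf_linked E (ray_verts Q) (range R) \<and> inf_linked E (range R) (ray_verts Q)"
proof -
  have "\<omega> = ray_equiv D `` {Out_Ray R}" using ends_members[OF \<omega> R_in] by blast
  then show ?thesis using ray_equiv_iff[of "Out_Ray R" Q] R is_ray_iff(1)[of D R] by auto
qed

lemma Out_Ray_\<omega>: "Out_Ray r \<in> \<omega> \<longleftrightarrow> r \<in> own_rays"
  unfolding \<omega>_iff own_rays_def by (simp del: is_ray.simps)

lemma same_end: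
  assumes "\<alpha> \<in> ends D" "Q \<in> \<alpha>" "Q' \<in> \<alpha>"
  shows "is_ray D Q" "inf_linked E (ray_verts Q) (ray_verts Q')"
proof -
  have "(Q, Q') \<in> ray_equiv D" using ends_members[OF assms(1,2)] assms(3) by blast
  then show "is_ray D Q" "inf_linked E (ray_verts Q) (ray_verts Q')" by (simp_all add: ray_equiv_iff)
qed

text \<open>Transitivity through rays makes the order independent of the representatives.\<close>

lemma end_le_iff:
  assumes "\<alpha> \<in> ends D" "Q \<in> \<alpha>" "\<beta> \<in> ends D" "Q' \<in> \<beta>"
  shows "end_le D \<alpha> \<beta> \<longleftrightarrow> inf_linked E (ray_verts Q) (ray_verts Q')"
proof
  assume "end_le D \<alpha> \<beta>"
  then obtain A B where AB: "A \<in> \<alpha>" "B \<in> \<beta>" "inf_disjoint_paths D (ray_verts A) (ray_verts B)"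
    unfolding end_le_def by blast
  have rays: "is_ray D A" "is_ray D B" using ends_members AB(1,2) assms(1,3) by blast+
  have "inf_linked E (ray_verts A) (ray_verts B)"
    using AB(3) inf_disjoint_paths_iff[OF ray_verts_verts[OF rays(1)]] by blast
  then have "inf_linked E (ray_verts Q) (ray_verts B)"
    using ray_trans[OF same_end(2)[OF assms(1,2) AB(1)] _ rays(1)] by blast
  then show "inf_linked E (ray_verts Q) (ray_verts Q')"
    using ray_trans[OF _ same_end(2)[OF assms(3) AB(2) assms(4)] rays(2)] by blast
next
  assume "inf_linked E (ray_verts Q) (ray_verts Q')"
  then have "inf_disjoint_paths D (ray_verts Q) (ray_verts Q')"
    using inf_disjoint_paths_iff[OF ray_verts_verts] ends_members[OF assms(1,2)] by blast
  then show "end_le D \<alpha> \<beta>" unfolding end_le_def using assms by blast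
qed

lemma below_iff:
  "(\<exists>\<alpha> \<in> {\<alpha> \<in> ends D. end_le D \<alpha> \<omega>} - {\<omega>}. Q \<in> \<alpha>) \<longleftrightarrow>
    is_ray D Q \<and> inf_linked E (ray_verts Q) (range R) \<and> \<not> inf_linked E (range R) (ray_verts Q)"
proof
  assume "\<exists>\<alpha> \<in> {\<alpha> \<in> ends D. end_le D \<alpha> \<omega>} - {\<omega>}. Q \<in> \<alpha>"
  then obtain \<alpha> where \<alpha>: "\<alpha> \<in> ends D" "end_le D \<alpha> \<omega>" "\<alpha> \<noteq> \<omega>" "Q \<in> \<alpha>" by blast
  have Q: "is_ray D Q" "inf_linked E (ray_verts Q) (range R)"
    using ends_members[OF \<alpha>(1,4)] end_le_iff[OF \<alpha>(1,4) \<omega> R_in] \<alpha>(2) by auto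
  moreover have "Q \<notin> \<omega>" using ends_members[OF \<alpha>(1,4)] ends_members[OF \<omega>, of Q] \<alpha>(3) by blast
  ultimately show "is_ray D Q \<and> inf_linked E (ray_verts Q) (range R) \<and> \<not> inf_linked E (range R) (ray_verts Q)"
    using \<omega>_iff by blast
next
  assume Q: "is_ray D Q \<and> inf_linked E (ray_verts Q) (range R) \<and> \<not> inf_linked E (range R) (ray_verts Q)"
  define \<alpha> where "\<alpha> = ray_equiv D `` {Q}"
  have \<alpha>: "\<alpha> \<in> ends D" "Q \<in> \<alpha>" using class_end Q unfolding \<alpha>_def by blast+
  moreover have "end_le D \<alpha> \<omega>" using end_le_iff[OF \<alpha> \<omega> R_in] Q by simp
  moreover have "\<alpha> \<noteq> \<omega>" using \<alpha>(2) \<omega>_iff Q by blast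
  ultimately show "\<exists>\<alpha> \<in> {\<alpha> \<in> ends D. end_le D \<alpha> \<omega>} - {\<omega>}. Q \<in> \<alpha>" by blast
qed

lemma above_iff:
  "(\<exists>\<alpha> \<in> {\<alpha> \<in> ends D. end_le D \<omega> \<alpha>}. Q \<in> \<alpha>) \<longleftrightarrow>
    is_ray D Q \<and> inf_linked E (range R) (ray_verts Q)"
proof
  assume "\<exists>\<alpha> \<in> {\<alpha> \<in> ends D. end_le D \<omega> \<alpha>}. Q \<in> \<alpha>"
  then obtain \<alpha> where \<alpha>: "\<alpha> \<in> ends D" "end_le D \<omega> \<alpha>" "Q \<in> \<alpha>" by blast
  then show "is_ray D Q \<and> inf_linked E (range R) (ray_verts Q)"
    using ends_members[OF \<alpha>(1,3)] end_le_iff[OF \<omega> R_in \<alpha>(1,3)] by auto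
next
  assume Q: "is_ray D Q \<and> inf_linked E (range R) (ray_verts Q)"
  define \<alpha> where "\<alpha> = ray_equiv D `` {Q}"
  have \<alpha>: "\<alpha> \<in> ends D" "Q \<in> \<alpha>" using class_end Q unfolding \<alpha>_def by blast+
  moreover have "end_le D \<omega> \<alpha>" using end_le_iff[OF \<omega> R_in \<alpha>] Q by simp
  ultimately show "\<exists>\<alpha> \<in> {\<alpha> \<in> ends D. end_le D \<omega> \<alpha>}. Q \<in> \<alpha>" by blast
qed

text \<open>A dominating vertex may lie on \<open>R\<close>, and then only the trivial path would
  connect the two. A tail of \<open>R\<close> beyond \<open>v\<close> represents the end equally
  well.\<close>

lemma R_avoiding:
  obtains r where "r \<in> own_rays" "v \<notin> range r"
proof -
  obtain n where n: "\<And>i. i \<ge> n \<Longrightarrow> R i \<notin> {v}"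
    using inj_eventually_notin[OF rays_inj[OF R], of "{v}"] by auto
  let ?r = "\<lambda>i. R (n + i)"
  have r: "?r \<in> rays E" using R by (rule rays_tail)
  have "range ?r \<inter> range R = range ?r" by auto
  then have "?r \<in> own_rays" using own_meet[OF R_own r] infinite_ray[OF r] by simp
  moreover have "v \<notin> range ?r" using n[of "n + _"] by auto
  ultimately show ?thesis by (rule that)
qed

lemma dominators_verts: "dominators \<subseteq> verts D" and in_dominators_verts: "in_dominators \<subseteq> verts D"
proof -
  show "dominators \<subseteq> verts D"
  proof
    fix v assume "v \<in> dominators"
    then have "E `` {v} \<noteq> {}" unfolding dominators_def by (metis inf_linked_empty(2) mem_Collect_eq)
    then show "v \<in> verts D" using arc_verts by blast
  qed
  show "in_dominators \<subseteq> verts D"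
  proof
    fix v assume "v \<in> in_dominators"
    then have "E\<inverse> `` {v} \<noteq> {}" unfolding in_dominators_def by (metis inf_linked_empty(2) mem_Collect_eq)
    then show "v \<in> verts D" using arc_verts by blast
  qed
qed

lemma set_path_connecting: "set_path D X Y p \<Longrightarrow> connecting E X Y p"
  by (simp add: set_path_def connecting_def vpath_iff)

lemma out_dominating_iff: "out_dominating D \<omega> v \<longleftrightarrow> v \<in> dominators"
proof
  assume "out_dominating D \<omega> v"
  then obtain Q P where Q: "Q \<in> \<omega>" and P: "infinite P" "\<And>p. p \<in> P \<Longrightarrow> set_path D {v} (ray_verts Q) p"
    "pairwise (\<lambda>p q. set p \<inter> set q = {v}) P"
    unfolding out_dominating_def by blast
  have "inf_linked E (E `` {v}) (ray_verts Q)"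
    using P(1) set_path_connecting[OF P(2)] P(3) by (rule inf_linked_star)
  then have "inf_linked E (E `` {v}) (range R)" using Q \<omega>_iff ray_trans by blast
  then show "v \<in> dominators" by (simp add: dominators_def)
next
  assume v: "v \<in> dominators"
  obtain r where r: "r \<in> own_rays" "v \<notin> range r" by (rule R_avoiding)
  have "inf_linked E (E `` {v}) (range r)"
    using v r(1) inf_linked_trans[OF _ _ R] unfolding dominators_def own_rays_def by blast
  then obtain P where P: "infinite P" "\<And>p. p \<in> P \<Longrightarrow> connecting E {v} (range r) p"
    "pairwise (\<lambda>p q. set p \<inter> set q = {v}) P" using r(2) by (rule star_exists) blast
  have "{v} \<subseteq> verts D" using v dominators_verts by blast
  then have "\<forall>p\<in>P. set_path D {v} (ray_verts (Out_Ray r)) p" using P(2) set_path_iff by simp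
  then show "out_dominating D \<omega> v"
    unfolding out_dominating_def using P(1,3) r(1) Out_Ray_\<omega> by blast
qed

lemma in_dominating_iff: "in_dominating D \<omega> v \<longleftrightarrow> v \<in> in_dominators"
proof
  assume "in_dominating D \<omega> v"
  then obtain Q P where Q: "Q \<in> \<omega>" and P: "infinite P" "\<And>p. p \<in> P \<Longrightarrow> set_path D (ray_verts Q) {v} p"
    "pairwise (\<lambda>p q. set p \<inter> set q = {v}) P"
    unfolding in_dominating_def by blast
  have "inf_linked (E\<inverse>) (E\<inverse> `` {v}) (ray_verts Q)"
  proof (rule inf_linked_star)
    show "infinite (rev ` P)" using P(1) by (simp add: finite_image_iff)
    show "connecting (E\<inverse>) {v} (ray_verts Q) p" if "p \<in> rev ` P" for p
      using that set_path_connecting[OF P(2)] connecting_rev by blast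
    show "pairwise (\<lambda>p q. set p \<inter> set q = {v}) (rev ` P)"
      using P(3) by (simp add: pairwise_def)
  qed
  then have "inf_linked E (ray_verts Q) (E\<inverse> `` {v})" by simp
  then have "inf_linked E (range R) (E\<inverse> `` {v})" using Q \<omega>_iff ray_trans by blast
  then show "v \<in> in_dominators" by (simp add: in_dominators_def)
next
  assume v: "v \<in> in_dominators"
  obtain r where r: "r \<in> own_rays" "v \<notin> range r" by (rule R_avoiding)
  have "inf_linked E (range R) (E\<inverse> `` {v})" using v by (simp add: in_dominators_def)
  then have "inf_linked E (range r) (E\<inverse> `` {v})"
    using r(1) inf_linked_trans[OF _ _ R] unfolding own_rays_def by blast
  then have "inf_linked (E\<inverse>) (E\<inverse> `` {v}) (range r)" by simp
  then obtain P where P: "infinite P" "\<And>p. p \<in> P \<Longrightarrow> connecting (E\<inverse>) {v} (range r) p"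
    "pairwise (\<lambda>p q. set p \<inter> set q = {v}) P" using r(2) by (rule star_exists) blast
  have "range r \<subseteq> verts D" using ray_verts_verts[of "Out_Ray r"] r(1) is_ray_iff(1)[of D r]
    unfolding own_rays_def by auto
  then have "\<forall>p\<in>rev ` P. set_path D (ray_verts (Out_Ray r)) {v} p"
    using P(2) set_path_iff[of "range r" "{v}"] connecting_rev[of E "{v}" "range r" "rev _"] by auto
  moreover have "infinite (rev ` P)" using P(1) by (simp add: finite_image_iff)
  moreover have "pairwise (\<lambda>p q. set p \<inter> set q = {v}) (rev ` P)"
    using P(3) by (simp add: pairwise_def)
  ultimately show "in_dominating D \<omega> v"
    unfolding in_dominating_def using r(1) Out_Ray_\<omega> by blast
qed

abbreviation "up \<equiv> end_up D \<omega>"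
abbreviation "down \<equiv> end_down D \<omega> - {End \<omega>}"

lemma vertices_in_up: "vertices_in D up = in_dominators"
  using in_dominators_verts by (auto simp: vertices_in_def end_up_def in_dominating_iff)

lemma vertices_in_down: "vertices_in D down = dominators"
  using dominators_verts by (auto simp: vertices_in_def end_down_def out_dominating_iff)

lemma ends_in_up: "(\<exists>\<alpha> \<in> ends_in D up. Q \<in> \<alpha>) \<longleftrightarrow> is_ray D Q \<and> inf_linked E (range R) (ray_verts Q)"
proof -
  have "ends_in D up = {\<alpha> \<in> ends D. end_le D \<omega> \<alpha>}" by (auto simp: ends_in_def end_up_def)
  then show ?thesis using above_iff by simp
qed

lemma ends_in_down: "(\<exists>\<alpha> \<in> ends_in D down. Q \<in> \<alpha>) \<longleftrightarrow>
    is_ray D Q \<and> inf_linked E (ray_verts Q) (range R) \<and> \<not> inf_linked E (range R) (ray_verts Q)"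
proof -
  have "ends_in D down = {\<alpha> \<in> ends D. end_le D \<alpha> \<omega>} - {\<omega>}" by (auto simp: ends_in_def end_down_def)
  then show ?thesis using below_iff by simp
qed

lemma esc_iff:
  assumes z: "z \<in> verts D"
  shows "esc S z \<longleftrightarrow> (\<exists>p. vpath p D \<and> hd p = z \<and> out_dominating D \<omega> (last p) \<and> S \<inter> set p = {}) \<or>
    (\<exists>s \<in> lower_rays. s 0 = z \<and> S \<inter> range s = {})"
proof
  assume e: "esc S z"
  then have zS: "z \<notin> S" by (simp add: escapes_def)
  from e consider
      (path) w where "w \<in> dominators" "reach E S z w"
    | (ray) q where "q \<in> lower_rays" "q 0 = z" "range q \<inter> S = {}"
    unfolding escapes_def by blast
  then show "(\<exists>p. vpath p D \<and> hd p = z \<and> out_dominating D \<omega> (last p) \<and> S \<inter> set p = {}) \<or>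
    (\<exists>s \<in> lower_rays. s 0 = z \<and> S \<inter> range s = {})"
  proof cases
    case path
    from path(2) zS singletonI singletonI obtain p where p: "connecting E {z} {w} p" "set p \<inter> S = {}"
      by (rule connecting_exists)
    then have ep: "epath E p" and "{hd p} = set p \<inter> {z}" "{last p} = set p \<inter> {w}" by (auto simp: connecting_def)
    then have hl: "hd p = z" "last p = w" by auto
    then have "vpath p D" using ep epath_verts[OF ep] z unfolding vpath_iff by simp
    then show ?thesis using hl path(1) p(2) out_dominating_iff by blast
  qed blast
next
  assume "(\<exists>p. vpath p D \<and> hd p = z \<and> out_dominating D \<omega> (last p) \<and> S \<inter> set p = {}) \<or>
    (\<exists>s \<in> lower_rays. s 0 = z \<and> S \<inter> range s = {})"
  then show "esc S z"
  proof (elim disjE exE bexE conjE)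
    fix p assume p: "vpath p D" "hd p = z" "out_dominating D \<omega> (last p)" "S \<inter> set p = {}"
    then have ep: "p \<noteq> []" "successively (\<lambda>a b. (a, b) \<in> E) p" by (simp_all add: vpath_iff epath_def)
    have "set p \<inter> S = {}" using p(4) by blast
    then have "reach E S z (last p)" using successively_path[OF ep(2,1)] p(2) by blast
    moreover have "z \<notin> S" using p(2,4) hd_in_set[OF ep(1)] by blast
    ultimately show ?thesis using p(3) out_dominating_iff unfolding escapes_def by blast
  next
    fix s assume s: "s \<in> lower_rays" "s 0 = z" "S \<inter> range s = {}"
    then have "s \<in> rays E" "z \<notin> S" "range s \<inter> S = {}" by (auto simp: lower_rays_def)
    then show ?thesis using s unfolding escapes_def by blast
  qed
qed

lemma own_verts: "r \<in> own_rays \<Longrightarrow> range r \<subseteq> verts D"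
  using ray_verts_verts[of "Out_Ray r"] is_ray_iff(1)[of D r] unfolding own_rays_def by auto

lemma end_separating_iff:
  "end_separating D \<omega> S \<longleftrightarrow> S \<subseteq> verts D \<and> (\<forall>r \<in> own_rays. \<exists>n. \<forall>i\<ge>n. \<not> esc S (r i))"
proof -
  have below: "s \<in> lower_rays \<longleftrightarrow> (\<exists>\<alpha> \<in> {\<alpha> \<in> ends D. end_le D \<alpha> \<omega>} - {\<omega>}. Out_Ray s \<in> \<alpha>)" for s
    unfolding below_iff is_ray_iff ray_verts.simps lower_rays_def by simp
  have lower: "(\<forall>\<alpha> \<in> {\<alpha> \<in> ends D. end_le D \<alpha> \<omega>} - {\<omega>}. \<forall>s. Out_Ray s \<in> \<alpha> \<and> s 0 \<in> A \<longrightarrow> S \<inter> range s \<noteq> {}) \<longleftrightarrow>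
    (\<forall>s. s \<in> lower_rays \<longrightarrow> s 0 \<in> A \<longrightarrow> S \<inter> range s \<noteq> {})" for A
    unfolding below Ball_def Bex_def by blast
  have tail: "(\<exists>q. is_tail q r \<and> P (range q)) \<longleftrightarrow> (\<exists>n. P (r ` {n..}))" for r :: "nat \<Rightarrow> 'a" and P
  proof -
    have rng: "range (\<lambda>i. r (n + i)) = r ` {n..}" for n
    proof
      show "r ` {n..} \<subseteq> range (\<lambda>i. r (n + i))"
      proof
        fix x assume "x \<in> r ` {n..}"
        then obtain i where "n \<le> i" "x = r i" by auto
        then have "x = r (n + (i - n))" by simp
        then show "x \<in> range (\<lambda>i. r (n + i))" by blast
      qed
    qed auto
    have "is_tail q r \<longleftrightarrow> (\<exists>n. q = (\<lambda>i. r (n + i)))" for q unfolding is_tail_def by (auto simp: fun_eq_iff)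
    then show ?thesis using rng by auto
  qed
  have "(\<exists>q. is_tail q r \<and>
           (\<forall>p. vpath p D \<and> hd p \<in> range q \<and> out_dominating D \<omega> (last p) \<longrightarrow> S \<inter> set p \<noteq> {}) \<and>
           (\<forall>\<alpha> \<in> {\<alpha> \<in> ends D. end_le D \<alpha> \<omega>} - {\<omega>}. \<forall>s. Out_Ray s \<in> \<alpha> \<and> s 0 \<in> range q \<longrightarrow>
              S \<inter> range s \<noteq> {})) \<longleftrightarrow> (\<exists>n. \<forall>i\<ge>n. \<not> esc S (r i))" if r: "r \<in> own_rays" for r
  proof -
    have v: "r i \<in> verts D" for i using own_verts[OF r] by blast
    have "(\<forall>p. vpath p D \<and> hd p \<in> r ` {n..} \<and> out_dominating D \<omega> (last p) \<longrightarrow> S \<inter> set p \<noteq> {}) \<and>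
      (\<forall>s. s \<in> lower_rays \<longrightarrow> s 0 \<in> r ` {n..} \<longrightarrow> S \<inter> range s \<noteq> {}) \<longleftrightarrow> (\<forall>i\<ge>n. \<not> esc S (r i))" for n
      unfolding esc_iff[OF v] by (auto simp: image_iff)
    then show ?thesis
      unfolding lower tail[where P = "\<lambda>A. (\<forall>p. vpath p D \<and> hd p \<in> A \<and> out_dominating D \<omega> (last p) \<longrightarrow> S \<inter> set p \<noteq> {}) \<and>
        (\<forall>s. s \<in> lower_rays \<longrightarrow> s 0 \<in> A \<longrightarrow> S \<inter> range s \<noteq> {})"] by simp
  qed
  then show ?thesis unfolding end_separating_def Out_Ray_\<omega> by blast
qed

text \<open>All rays of the end give the same answer, so \<open>R\<close> suffices. The intersection
  appears because separators consist of vertices of \<open>D\<close> by definition, while the sets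
  \<open>H\<close> in the Menger argument are arbitrary.\<close>

lemma finite_end_separating_iff:
  assumes "finite S"
  shows "end_separating D \<omega> (S \<inter> verts D) \<longleftrightarrow> finite {i. esc S (R i)}"
proof -
  have av: "avoid E (S \<inter> verts D) = avoid E S" using arc_verts by (auto simp: avoid_def)
  have rv: "range q \<inter> (S \<inter> verts D) = range q \<inter> S" if "q \<in> rays E" for q
    using ray_verts_verts[of "Out_Ray q"] is_ray_iff(1)[of D q] that by auto
  have esc_eq: "esc (S \<inter> verts D) z \<longleftrightarrow> esc S z" if "z \<in> verts D" for z
    unfolding escapes_def av using rv that by (auto; metis)
  have fin: "(\<exists>n. \<forall>i\<ge>n. \<not> esc S (r i)) \<longleftrightarrow> finite {i. esc S (r i)}" for r :: "nat \<Rightarrow> 'a"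
    unfolding finite_nat_set_iff_bounded by (auto simp: not_le[symmetric])
  have "esc (S \<inter> verts D) (r i) \<longleftrightarrow> esc S (r i)" if "r \<in> own_rays" for r i
    using esc_eq own_verts[OF that] by blast
  then have "end_separating D \<omega> (S \<inter> verts D) \<longleftrightarrow> (\<forall>r \<in> own_rays. \<exists>n. \<forall>i\<ge>n. \<not> esc S (r i))"
    unfolding end_separating_iff by simp
  also have "\<dots> \<longleftrightarrow> (\<forall>r \<in> own_rays. finite {i. esc S (r i)})" by (simp only: fin)
  also have "\<dots> \<longleftrightarrow> finite {i. esc S (R i)}"
  proof
    assume "finite {i. esc S (R i)}"
    then obtain n where "\<forall>i\<ge>n. \<not> esc S (R i)" using fin by blast
    then show "\<forall>r \<in> own_rays. finite {i. esc S (r i)}" using infinite_escapes_all[OF assms] by blast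
  qed (use R_own in blast)
  finally show ?thesis .
qed

end

section \<open>Tracks against separators\<close>

lemma enat_le_SUP_card: "(\<And>n. \<exists>x \<in> A. enat n \<le> f x) \<Longrightarrow> (SUP x \<in> A. f x) = (\<infinity> :: enat)"
proof -
  assume *: "\<And>n. \<exists>x \<in> A. enat n \<le> f x"
  have "enat n \<le> (SUP x \<in> A. f x)" for n using *[of n] by (meson SUP_upper order_trans)
  then show ?thesis by (metis enat_ord_code(4) enat_ord_simps(1) not_enat_eq Suc_n_not_le_n)
qed

lemma card_le_max_disjoint:
  assumes "F \<subseteq> X" "disjoint_family_on V F"
  shows "ecard F \<le> max_disjoint V X"
  unfolding max_disjoint_def by (rule SUP_upper) (use assms in blast)

lemma inj_on_disjoint:
  assumes "\<And>x y. x \<in> S \<Longrightarrow> y \<in> S \<Longrightarrow> x \<noteq> y \<Longrightarrow> V (f x) \<inter> V (f y) = {}" "\<And>x. x \<in> S \<Longrightarrow> V (f x) \<noteq> {}"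
  shows "inj_on f S"
  by (rule inj_onI) (metis assms inf.idem)

context digraph_end
begin

lemma track_meets:
  assumes S: "finite S" "end_separating D \<omega> S" and T: "is_track D up down T"
  shows "track_verts T \<inter> S \<noteq> {}"
proof
  assume disj: "track_verts T \<inter> S = {}"
  obtain n where n: "\<And>i. i \<ge> n \<Longrightarrow> \<not> esc S (R i)"
    using S(2) R_own unfolding end_separating_iff by blast
  \<comment> \<open>\<open>A\<close> will be the set of in-neighbours of an in-dominating vertex, or
    the in-ray of the track: vertices of \<open>A\<close> outside \<open>S\<close> escape along the
    track, so late vertices of \<open>R\<close>, which reach \<open>A\<close>, would escape as
    well.\<close>
  have no: False if A: "inf_linked E (range R) A" "\<And>b. b \<in> A \<Longrightarrow> b \<notin> S \<Longrightarrow> esc S b" for A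
  proof -
    obtain i b where b: "n < i" "b \<in> A" "R i \<notin> S" "b \<notin> S" "reach E S (R i) b"
      using A(1) S(1) by (rule inf_linked_rayE)
    then have "esc S (R i)" using esc_back A(2) by blast
    then show False using n b(1) by simp
  qed
  have no_dom: False if v: "v \<in> in_dominators" "esc S v" for v
  proof (rule no)
    show "inf_linked E (range R) (E\<inverse> `` {v})" using v(1) by (simp add: in_dominators_def)
    show "esc S b" if "b \<in> E\<inverse> `` {v}" "b \<notin> S" for b using that esc_step v(2) by blast
  qed
  have no_in: False if q: "q \<in> upper_rays" "esc S (q 0)" "range q \<inter> S = {}" for q
  proof (rule no)
    show "inf_linked E (range R) (range q)" using q(1) by (simp add: upper_rays_def)
    show "esc S b" if bq: "b \<in> range q" for b
    proof -
      obtain j where j: "b = q j" using bq by blast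
      have "q \<in> rays (E\<inverse>)" using q(1) by (simp add: upper_rays_def)
      then have "reach (E\<inverse>) S (q 0) (q j)" using q(3) by (rule ray_avoid) simp
      then have "reach E S (q j) (q 0)" by (simp add: avoid_converse rtrancl_converse)
      then show ?thesis using esc_back q(2) j by blast
    qed
  qed
  have lower_esc: "esc S (q 0)" if "q \<in> lower_rays" "range q \<inter> S = {}" for q
    using that unfolding escapes_def lower_rays_def by blast
  have dom_esc: "esc S v" if "v \<in> dominators" "v \<notin> S" for v
    using that unfolding escapes_def by blast
  have up_ray: "r \<in> upper_rays" if "\<exists>\<alpha> \<in> ends_in D up. In_Ray r \<in> \<alpha>" for r
    using that unfolding ends_in_up is_ray_iff upper_rays_def by simp
  have down_ray: "r \<in> lower_rays" if "\<exists>\<alpha> \<in> ends_in D down. Out_Ray r \<in> \<alpha>" for r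
    using that unfolding ends_in_down is_ray_iff lower_rays_def by simp
  have type: "track_type D up down T" using T by (simp add: is_track_def)
  show False
  proof (cases T)
    case (Path_Track p)
    then have "set_path D in_dominators dominators p"
      using type vertices_in_up vertices_in_down by simp
    then have c: "connecting E in_dominators dominators p" by (rule set_path_connecting)
    have pS: "set p \<inter> S = {}" using disj Path_Track by simp
    note path = connecting_path[OF c pS]
    have "last p \<notin> S" using avoid_notin[OF path(4,3)] .
    then have "esc S (hd p)" using esc_back[OF path(4)] dom_esc path(2) by blast
    then show False using no_dom path(1) by blast
  next
    case (In_Ray_Track r)
    then have r: "\<exists>\<alpha> \<in> ends_in D up. In_Ray r \<in> \<alpha>" "r 0 \<in> dominators"
      using type vertices_in_down by (simp_all del: is_ray.simps)
    have "range r \<inter> S = {}" using disj In_Ray_Track by simp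
    moreover from this have "esc S (r 0)" using dom_esc r(2) by blast
    ultimately show False using no_in up_ray[OF r(1)] by blast
  next
    case (Out_Ray_Track r)
    then have r: "\<exists>\<alpha> \<in> ends_in D down. Out_Ray r \<in> \<alpha>" "r 0 \<in> in_dominators"
      using type vertices_in_up by (simp_all del: is_ray.simps)
    have "range r \<inter> S = {}" using disj Out_Ray_Track by simp
    then show False using no_dom r(2) lower_esc down_ray[OF r(1)] by blast
  next
    case (Double_Ray_Track z)
    then have r: "\<exists>\<alpha> \<in> ends_in D up. In_Ray (\<lambda>n. z (- int n)) \<in> \<alpha>"
      "\<exists>\<alpha> \<in> ends_in D down. Out_Ray (\<lambda>n. z (int n)) \<in> \<alpha>"
      using type by (simp_all del: is_ray.simps)
    have zS: "z i \<notin> S" for i using disj Double_Ray_Track by auto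
    have "esc S (z 0)" using lower_esc[OF down_ray[OF r(2)]] zS by auto
    then show False using no_in[OF up_ray[OF r(1)]] zS by auto
  qed
qed

lemma max_tracks_le:
  assumes "end_separating D \<omega> S"
  shows "max_tracks D up down \<le> ecard S"
proof (cases "finite S")
  case True
  show ?thesis
    unfolding max_tracks_def max_disjoint_def
  proof (rule SUP_least)
    fix F assume "F \<in> {F. F \<subseteq> {T. is_track D up down T} \<and> disjoint_family_on track_verts F}"
    then have F: "F \<subseteq> {T. is_track D up down T}" "disjoint_family_on track_verts F" by auto
    have pw: "pairwise (\<lambda>T T'. disjnt (track_verts T) (track_verts T')) F"
      using F(2) unfolding pairwise_def disjoint_family_on_def disjnt_def by blast
    define g where "g T = (SOME x. x \<in> track_verts T \<inter> S)" for T
    have g: "g T \<in> track_verts T \<inter> S" if "T \<in> F" for T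
      unfolding g_def
    proof (rule someI_ex)
      show "\<exists>x. x \<in> track_verts T \<inter> S" using track_meets[OF True assms] F(1) that by blast
    qed
    have "inj_on g F"
    proof (rule inj_onI)
      fix T T' assume *: "T \<in> F" "T' \<in> F" "g T = g T'"
      then have "\<not> disjnt (track_verts T) (track_verts T')" using g[of T] g[of T'] by (auto simp: disjnt_def)
      then show "T = T'" using pw * unfolding pairwise_def by blast
    qed
    moreover have "g ` F \<subseteq> S" using g by blast
    ultimately have "finite F \<and> card F \<le> card S"
      using True by (meson card_inj_on_le inj_on_finite)
    then show "ecard F \<le> ecard S" using True by (simp add: ecard_def)
  qed
qed (simp add: ecard_def)

text \<open>Disjoint families of every finite size are constructed, not an infinite one; for a
  supremum in \<open>enat\<close> this suffices.\<close>

lemma in_degree_infinite: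
  assumes none: "\<And>S. finite S \<Longrightarrow> \<not> end_separating D \<omega> S"
  shows "end_in_degree \<omega> = \<infinity>"
proof -
  have sep: "infinite {i. esc S (R i)}" if "finite S" for S
    using none[of "S \<inter> verts D"] finite_end_separating_iff[OF that] that by blast
  have "\<exists>F \<in> {F. F \<subseteq> {r. Out_Ray r \<in> \<omega>} \<and> disjoint_family_on range F}. enat n \<le> ecard F" for n
  proof -
    obtain Y F where Y: "card Y = Suc n" "linkage E {} own_rays Y F" using many_rays[OF sep] by blast
    interpret l: linkage E "{}" own_rays Y F by (rule Y(2))
    interpret end_linkage E R Y F by standard (use Y(1) in auto)
    have disj: "range (orb x) \<inter> range (orb y) = {}" if xy: "x \<in> Y" "y \<in> Y" "x \<noteq> y" for x y
    proof (rule ccontr)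
      assume "range (orb x) \<inter> range (orb y) \<noteq> {}"
      then obtain v where "v \<in> F\<^sup>* `` {x}" "v \<in> F\<^sup>* `` {y}" using orb(3) xy(1,2) by blast
      then show False using l.orbit_disjoint[OF xy(1,2)] xy(3) by blast
    qed
    then have "inj_on orb Y" by (rule inj_on_disjoint[where V = range]) simp_all
    then have "ecard (orb ` Y) = enat (Suc n)" using Y(1) l.finite_Y by (simp add: ecard_def card_image)
    moreover have "disjoint_family_on range (orb ` Y)"
      using disj unfolding disjoint_family_on_def by blast
    moreover have "orb ` Y \<subseteq> {r. Out_Ray r \<in> \<omega>}" using orb(5) Out_Ray_\<omega> by blast
    ultimately show ?thesis by (intro bexI[of _ "orb ` Y"]) auto
  qed
  then show ?thesis unfolding end_in_degree_def max_disjoint_def by (rule enat_le_SUP_card)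
qed

lemma double_ray:
  assumes "q \<in> rays E" "r \<in> rays (E\<inverse>)" "q 0 = r 0" "range q \<inter> range r = {q 0}"
  defines "z \<equiv> \<lambda>i. if i \<ge> 0 then q (nat i) else r (nat (- i))"
  shows "is_double_ray D z" "range z = range q \<union> range r" "(\<lambda>n. z (int n)) = q" "(\<lambda>n. z (- int n)) = r"
proof -
  show zq: "(\<lambda>n. z (int n)) = q" by (simp add: z_def)
  show zr: "(\<lambda>n. z (- int n)) = r" using assms(3) by (auto simp: z_def fun_eq_iff)
  have q_eq: "q i = q j \<longleftrightarrow> i = j" for i j using rays_inj[OF assms(1)] by (simp add: inj_eq)
  have r_eq: "r i = r j \<longleftrightarrow> i = j" for i j using rays_inj[OF assms(2)] by (simp add: inj_eq)
  have qr: "q i = r j \<Longrightarrow> j = 0" for i j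
  proof -
    assume "q i = r j"
    then have "r j \<in> range q \<inter> range r" by (metis IntI rangeI)
    then have "r j = r 0" using assms(3,4) by simp
    then show "j = 0" using r_eq by simp
  qed
  have "inj z"
  proof (rule injI)
    fix i j assume "z i = z j"
    then show "i = j"
      using qr[of "nat i" "nat (- j)"] qr[of "nat j" "nat (- i)"]
      by (auto simp: z_def q_eq r_eq split: if_splits)
  qed
  moreover have "(z i, z (i + 1)) \<in> E" for i
  proof -
    consider "i \<ge> 0" | "i = -1" | "i < -1" by linarith
    then show ?thesis
    proof cases
      case 1
      then show ?thesis using rays_arc[OF assms(1), of "nat i"] by (simp add: z_def nat_add_distrib)
    next
      case 2
      then show ?thesis using rays_arc[OF assms(2), of 0] assms(3) by (simp add: z_def)
    next
      case 3
      then have "nat (- i) = Suc (nat (- (i + 1)))" by simp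
      then show ?thesis using rays_arc[OF assms(2), of "nat (- (i + 1))"] 3 by (simp add: z_def)
    qed
  qed
  ultimately show "is_double_ray D z" by (simp add: is_double_ray_def)
  show "range z = range q \<union> range r"
  proof
    show "range z \<subseteq> range q \<union> range r" by (auto simp: z_def)
    have "q i = z (int i)" "r i = z (- int i)" for i using zq zr by metis+
    then show "range q \<union> range r \<subseteq> range z" by (metis (no_types) Un_least image_subsetI rangeI)
  qed
qed

text \<open>The far half avoids \<open>near\<close>, the near half lies in
  \<open>near \<union> S\<close>, and each meets \<open>S\<close> only in \<open>x\<close>; hence
  they meet only there. Apart from \<open>x\<close>, the far half has no in-dominating and the near
  half no dominating vertex, so no internal vertex of the union is of either kind. A path or a ray
  on each side gives the four kinds of tracks.\<close>

lemma glued_track: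
  assumes sep: "separated_ray E R S n0" and x: "x \<in> S" "x \<in> verts D"
    and Fa: "linkage {(u, v) \<in> separated_ray.E_far E R S n0. u \<notin> dominators} dominators lower_rays S Fa"
    and Fb: "linkage {(u, v) \<in> separated_ray.E_near E R S n0. u \<notin> in_dominators} in_dominators upper_rays S Fb"
  shows "\<exists>T. is_track D up down T \<and> track_verts T = Fa\<^sup>* `` {x} \<union> Fb\<^sup>* `` {x}"
proof -
  interpret separated_ray E R S n0 by (rule sep)
  interpret a: linkage "{(u, v) \<in> E_far. u \<notin> dominators}" dominators lower_rays S Fa by (rule Fa)
  interpret b: linkage "{(u, v) \<in> E_near. u \<notin> in_dominators}" in_dominators upper_rays S Fb by (rule Fb)
  let ?A = "Fa\<^sup>* `` {x}" and ?B = "Fb\<^sup>* `` {x}"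
  have A: "?A \<inter> near = {}" using far_orbits[OF Fa] x(1) by blast
  have B: "?B \<subseteq> near \<union> S" using near_orbits[OF Fb] x(1) by blast
  have A_S: "z = x" if "z \<in> ?A" "z \<in> S" for z using a.orbit_disjoint[of x z z] x(1) that by auto
  have B_S: "z = x" if "z \<in> ?B" "z \<in> S" for z using b.orbit_disjoint[of x z z] x(1) that by auto
  have xAB: "x \<in> ?A" "x \<in> ?B" by auto
  have AB: "?A \<inter> ?B = {x}" using A B A_S xAB by blast
  have "z = x" if "z \<in> ?A" "z \<in> in_dominators" for z using in_dominators_near A A_S that by blast
  then have U: "(?A \<union> ?B) \<inter> in_dominators = ?B \<inter> in_dominators" using xAB(2) by blast
  have "z = x" if "z \<in> ?B" "z \<in> dominators" for z using dominators_near B B_S that by blast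
  then have Dm: "(?A \<union> ?B) \<inter> dominators = ?A \<inter> dominators" using xAB(1) by blast
  have is_track: "\<exists>T. is_track D up down T \<and> track_verts T = ?A \<union> ?B"
    if "track_type D up down T" "track_verts T = ?A \<union> ?B"
      "internal_verts T \<inter> (in_dominators \<union> dominators) = {}" for T
    using that by (auto simp: is_track_def vertices_in_up vertices_in_down)
  from Fa x(1) show ?thesis
  proof (cases rule: half_track)
    case pa: (path pa)
    have ea: "epath E pa" using far_sub pa(1) by (rule epath_mono)
    have pa_ne: "pa \<noteq> []" using ea by (simp add: epath_def)
    from Fb x(1) show ?thesis
    proof (cases rule: half_track)
      case pb: (path pb)
      have "epath (E\<inverse>) pb" using near_sub pb(1) by (rule epath_mono)
      then have eb: "epath E (rev pb)" using epath_rev[of "E\<inverse>" pb] by simp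
      have pb_ne: "pb \<noteq> []" using eb by (simp add: epath_def)
      obtain ta where ta: "pa = x # ta" using pa_ne pa(2) by (cases pa) auto
      let ?p = "rev pb @ ta"
      have set_p: "set ?p = ?A \<union> ?B" using pa(3) pb(3) ta xAB(2) by auto
      have "set ta \<subseteq> ?A - {x}" using ea pa(3) ta by (auto simp: epath_def)
      then have set_ta: "set ta \<inter> set pb = {}" using AB pb(3) by blast
      have last_rev_pb: "last (rev pb) = x" using pb_ne pb(2) by (simp add: last_rev)
      have hd_p: "hd ?p = last pb" using pb_ne by (simp add: hd_rev)
      have last_p: "last ?p = last pa" using ta last_rev_pb by auto
      have "successively (\<lambda>a b. (a, b) \<in> E) ?p"
        using ea eb last_rev_pb unfolding epath_def ta successively_append_iff
        by (auto simp: successively_Cons)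
      then have "epath E ?p" using ea eb ta set_ta unfolding epath_def by auto
      then have c: "connecting E in_dominators dominators ?p"
        unfolding connecting_def set_p hd_p last_p U Dm using pa(4) pb(4) by simp
      then have "set_path D in_dominators dominators ?p"
        using set_path_iff[OF in_dominators_verts] by blast
      then show ?thesis
        using c set_p unfolding connecting_def
        by (intro is_track[of "Path_Track ?p"]) (auto simp: vertices_in_up vertices_in_down)
    next
      case qb: (ray qb)
      let ?r = "glue (rev pa) qb"
      have "epath (E\<inverse>) (rev pa)" using ea by simp
      moreover have "last (rev pa) = qb 0" using pa_ne pa(2) qb(3) by (simp add: last_rev)
      moreover have "qb \<in> rays (E\<inverse>)" using rays_mono[OF near_sub qb(2)] .
      moreover have "set (rev pa) \<inter> range qb = {qb 0}" using AB pa(3) qb(3,4) by simp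
      ultimately have r: "?r \<in> rays (E\<inverse>)" "range ?r = set (rev pa) \<union> range qb" "?r 0 = hd (rev pa)"
        by (rule glue)+
      have rng: "range ?r = ?A \<union> ?B" using r(2) pa(3) qb(4) by simp
      have r0: "?r 0 = last pa" using r(3) pa_ne by (simp add: hd_rev)
      have "inf_linked E (range R) (range qb)" using qb(1) by (simp add: upper_rays_def)
      then have "inf_linked E (range R) (range ?r)" by (rule inf_linked_mono) (use r(2) in auto)
      then have "\<exists>\<alpha> \<in> ends_in D up. In_Ray ?r \<in> \<alpha>"
        unfolding ends_in_up is_ray_iff using r(1) by simp
      then have "track_type D up down (In_Ray_Track ?r)"
        using r(1) r0 pa(4) unfolding track_type.simps is_ray_iff vertices_in_down by auto
      moreover have "(range ?r - {?r 0}) \<inter> (in_dominators \<union> dominators) = {}"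
        using U Dm pa(4) qb(5) unfolding rng r0 by blast
      ultimately show ?thesis using rng by (intro is_track[of "In_Ray_Track ?r"]) simp_all
    qed
  next
    case qa: (ray qa)
    have ra: "qa \<in> rays E" using rays_mono[OF far_sub qa(2)] .
    from Fb x(1) show ?thesis
    proof (cases rule: half_track)
      case pb: (path pb)
      let ?r = "glue (rev pb) qa"
      have "epath (E\<inverse>) pb" using near_sub pb(1) by (rule epath_mono)
      then have eb: "epath E (rev pb)" using epath_rev[of "E\<inverse>" pb] by simp
      then have pb_ne: "pb \<noteq> []" by (simp add: epath_def)
      note eb
      moreover have "last (rev pb) = qa 0" using pb_ne pb(2) qa(3) by (simp add: last_rev)
      moreover note ra
      moreover have "set (rev pb) \<inter> range qa = {qa 0}" using AB pb(3) qa(3,4) by (simp add: Int_commute)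
      ultimately have r: "?r \<in> rays E" "range ?r = set (rev pb) \<union> range qa" "?r 0 = hd (rev pb)"
        by (rule glue)+
      have rng: "range ?r = ?A \<union> ?B" using r(2) pb(3) qa(4) by auto
      have r0: "?r 0 = last pb" using r(3) pb_ne by (simp add: hd_rev)
      have "range ?r \<inter> range qa = range qa" using r(2) by auto
      then have "infinite (range ?r \<inter> range qa)" using infinite_ray[OF qa(2)] by simp
      then have "?r \<in> lower_rays" using lower_meet[OF qa(1) r(1)] by blast
      then have "\<exists>\<alpha> \<in> ends_in D down. Out_Ray ?r \<in> \<alpha>"
        unfolding ends_in_down is_ray_iff by (simp add: lower_rays_def)
      then have "track_type D up down (Out_Ray_Track ?r)"
        using r(1) r0 pb(4) unfolding track_type.simps is_ray_iff vertices_in_up by auto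
      moreover have "(range ?r - {?r 0}) \<inter> (in_dominators \<union> dominators) = {}"
        using U Dm pb(4) qa(5) unfolding rng r0 by blast
      ultimately show ?thesis using rng by (intro is_track[of "Out_Ray_Track ?r"]) simp_all
    next
      case qb: (ray qb)
      define z where "z = (\<lambda>i. if i \<ge> 0 then qa (nat i) else qb (nat (- i)))"
      have z: "is_double_ray D z" "range z = range qa \<union> range qb"
        "(\<lambda>n. z (int n)) = qa" "(\<lambda>n. z (- int n)) = qb"
        unfolding z_def using ra rays_mono[OF near_sub qb(2)] AB qa(3,4) qb(3,4)
        by (intro double_ray; simp)+
      have "\<exists>\<alpha> \<in> ends_in D down. Out_Ray qa \<in> \<alpha>"
        unfolding ends_in_down is_ray_iff using qa(1) by (simp add: lower_rays_def)
      moreover have "\<exists>\<alpha> \<in> ends_in D up. In_Ray qb \<in> \<alpha>"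
        unfolding ends_in_up is_ray_iff using qb(1) by (simp add: upper_rays_def)
      ultimately have "track_type D up down (Double_Ray_Track z)"
        unfolding track_type.simps z(3,4) using z(1) by blast
      moreover have "range z \<inter> (in_dominators \<union> dominators) = {}"
        using U Dm qa(5) qb(5) unfolding z(2) qa(4) qb(4) by blast
      ultimately show ?thesis
        using z(2) qa(4) qb(4) by (intro is_track[of "Double_Ray_Track z"]) simp_all
    qed
  qed
qed

lemma separator_le_max_tracks:
  assumes S: "finite S" "end_separating D \<omega> S"
    and min: "\<And>S'. finite S' \<Longrightarrow> end_separating D \<omega> S' \<Longrightarrow> card S \<le> card S'"
  shows "enat (card S) \<le> max_tracks D up down"
proof -
  have sub: "S \<subseteq> verts D" using S(2) by (simp add: end_separating_def)
  obtain n where n: "\<And>i. i \<ge> n \<Longrightarrow> \<not> esc S (R i)"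
    using S(2) R_own unfolding end_separating_iff by blast
  obtain m where m: "\<And>i. i \<ge> m \<Longrightarrow> R i \<notin> S"
    using inj_eventually_notin[OF rays_inj[OF R], of S] S(1) by auto
  \<comment> \<open>Beyond both bounds \<open>R\<close> misses \<open>S\<close> and no vertex of
    \<open>R\<close> escapes \<open>S\<close>.\<close>
  have sray: "separated_ray E R S (max n m)"
    by standard (use S(1) n m in auto)
  interpret separated_ray E R S "max n m" by (rule sray)
  have inf: "infinite {i. esc H (R i)}" if H: "finite H" "card H < card S" for H
  proof
    assume "finite {i. esc H (R i)}"
    then have "end_separating D \<omega> (H \<inter> verts D)" using finite_end_separating_iff[OF H(1)] by blast
    then have "card S \<le> card (H \<inter> verts D)" using min H(1) by blast
    also have "\<dots> \<le> card H" using H(1) by (simp add: card_mono)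
    finally show False using H(2) by simp
  qed
  obtain Fa where Fa: "linkage {(u, v) \<in> E_far. u \<notin> dominators} dominators lower_rays S Fa"
    using far_linkage[OF inf] by blast
  obtain Fb where Fb: "linkage {(u, v) \<in> E_near. u \<notin> in_dominators} in_dominators upper_rays S Fb"
    using near_linkage[OF inf] by blast
  interpret a: linkage "{(u, v) \<in> E_far. u \<notin> dominators}" dominators lower_rays S Fa by (rule Fa)
  interpret b: linkage "{(u, v) \<in> E_near. u \<notin> in_dominators}" in_dominators upper_rays S Fb by (rule Fb)
  have "\<forall>x \<in> S. \<exists>T. is_track D up down T \<and> track_verts T = Fa\<^sup>* `` {x} \<union> Fb\<^sup>* `` {x}"
    using glued_track[OF sray _ _ Fa Fb] sub by blast
  from bchoice[OF this] obtain T where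
    T: "\<forall>x \<in> S. is_track D up down (T x) \<and> track_verts (T x) = Fa\<^sup>* `` {x} \<union> Fb\<^sup>* `` {x}" ..
  \<comment> \<open>A far and a near orbit can meet only in \<open>S\<close>, where each orbit
    contains just its own start.\<close>
  have mixed: "x = y" if "x \<in> S" "y \<in> S" "v \<in> Fa\<^sup>* `` {x}" "v \<in> Fb\<^sup>* `` {y}" for x y v
  proof -
    have "v \<in> S" using far_orbits[OF Fa] near_orbits[OF Fb] that by blast
    then have "x = v" "y = v"
      using a.orbit_disjoint[OF that(1), of v v] b.orbit_disjoint[OF that(2), of v v] that(3,4) by auto
    then show ?thesis by simp
  qed
  have disj: "track_verts (T x) \<inter> track_verts (T y) = {}" if xy: "x \<in> S" "y \<in> S" "x \<noteq> y" for x y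
  proof (rule ccontr)
    assume "track_verts (T x) \<inter> track_verts (T y) \<noteq> {}"
    then obtain v where "v \<in> track_verts (T x)" "v \<in> track_verts (T y)" by blast
    then have "v \<in> Fa\<^sup>* `` {x} \<union> Fb\<^sup>* `` {x}" "v \<in> Fa\<^sup>* `` {y} \<union> Fb\<^sup>* `` {y}" using T xy by simp_all
    then show False
      using a.orbit_disjoint[OF xy(1,2)] b.orbit_disjoint[OF xy(1,2)] mixed[OF xy(1,2)] mixed[OF xy(2,1)] xy(3)
      by blast
  qed
  then have "inj_on T S" by (rule inj_on_disjoint[where V = track_verts]) (use T in auto)
  then have "ecard (T ` S) = enat (card S)" using S(1) by (simp add: ecard_def card_image)
  moreover have "ecard (T ` S) \<le> max_disjoint track_verts {T. is_track D up down T}"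
  proof (rule card_le_max_disjoint)
    show "disjoint_family_on track_verts (T ` S)"
      using disj unfolding disjoint_family_on_def by blast
  qed (use T in blast)
  ultimately show ?thesis by (simp add: max_tracks_def)
qed

lemma combined_in_degree_eq: "combined_in_degree D \<omega> = end_in_degree \<omega> + max_tracks D up down"
proof (cases "end_in_degree \<omega> = \<infinity>")
  case True
  then show ?thesis by (simp add: combined_in_degree_def)
next
  case False
  have "\<exists>S0. finite S0 \<and> end_separating D \<omega> S0"
  proof (rule ccontr)
    assume "\<not> ?thesis"
    then have "\<not> end_separating D \<omega> S" if "finite S" for S using that by blast
    from in_degree_infinite[OF this] show False using False by simp
  qed
  then obtain S0 where "finite S0 \<and> end_separating D \<omega> S0" ..
  from ex_has_least_nat[of "\<lambda>S. finite S \<and> end_separating D \<omega> S", OF this, of card]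
  obtain S where S: "finite S" "end_separating D \<omega> S"
    "\<And>S'. finite S' \<Longrightarrow> end_separating D \<omega> S' \<Longrightarrow> card S \<le> card S'"
    by auto
  have "(INF S \<in> {S. end_separating D \<omega> S}. ecard S) \<le> ecard S"
    by (rule INF_lower) (use S(2) in simp)
  also have "\<dots> = enat (card S)" using S(1) by (simp add: ecard_def)
  also have "\<dots> \<le> max_tracks D up down" using S by (rule separator_le_max_tracks)
  finally have "(INF S \<in> {S. end_separating D \<omega> S}. ecard S) = max_tracks D up down"
    by (intro antisym INF_greatest) (auto intro: max_tracks_le)
  then show ?thesis by (simp add: combined_in_degree_def)
qed

end

theorem lemma7p1:
  fixes D :: "('a, 'b) pre_digraph" and \<omega> :: "'a ray set"
  assumes "wf_digraph D"
    and "\<omega> \<in> ends D"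
    and "end_in_degree \<omega> \<ge> 1"
  shows "combined_in_degree D \<omega> =
    end_in_degree \<omega> + max_tracks D (end_up D \<omega>) (end_down D \<omega> - {End \<omega>})"
proof -
  \<comment> \<open>Without an out-ray in the end, the supremum defining the degree would range over
    the empty family only and be 0.\<close>
  have "\<exists>R. Out_Ray R \<in> \<omega>"
  proof (rule ccontr)
    assume "\<not> ?thesis"
    then have "end_in_degree \<omega> \<le> 0"
      unfolding end_in_degree_def max_disjoint_def
      by (intro SUP_least) (auto simp: ecard_def zero_enat_def)
    then show False using assms(3) by simp
  qed
  then obtain R where R: "Out_Ray R \<in> \<omega>" ..
  interpret wf_digraph D by (rule assms(1))
  interpret digraph_end D \<omega> R by standard (use assms(2) R in auto)
  show ?thesis by (rule combined_in_degree_eq)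
qed

end
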